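(* Let $\Omega\subset\mathbb{R}^3$ be a bounded domain with $C^2$ boundary, let $\epsilon_0,\mu_0>0$ be constants, $\omega>0$ a frequency such that the boundary value problems below are uniquely solvable, and $k=\omega\sqrt{\epsilon_0\mu_0}$. Let $\sigma\in L^\infty(\Omega)$ satisfy $\|\sigma\|_{(1)}(\Omega)\le M_1$ and $\sigma=0$ on $\partial\Omega$, and assume $k\ge 1$. Let $0<\alpha\le 1$ and let $\varepsilon$, the operator norm of the linearised boundary map $\Lambda'$ (defined in the context) from $\mathrm{TH}(\partial\Omega)$ to $\mathrm{TH}(\partial\Omega)$, satisfy $0<\varepsilon<1$. Put $\mathcal{E}=-\ln\varepsilon$, and let $\chi_k(\mathcal{E})=0$ if $\mathcal{E}<k$ and $\chi_k(\mathcal{E})=1$ if $k\le\mathcal{E}$. Then \[ \begin{aligned} \|\sigma\|^{2}_{(0)}(\Omega) &\leq \frac{4}{3\pi^{2}} (\mathrm{Vol}(\Omega))^{2} \Big( (1-\chi_{k}(\mathcal{E})) (1+k)^{4} k^{3\alpha} + \chi_{k}(\mathcal{E}) (1+\mathcal{E})^{4} \mathcal{E}^{3} \Big) \varepsilon^{2} \\ &\qquad + \chi_{k}(\mathcal{E}) \frac{1}{4\pi^{2}} (\mathrm{Vol}_{2}(\Omega))^{2} \frac{1}{D} \big(1+(2D)^{2}\big)^{1/2} (1+\mathcal{E})^{4} \mathcal{E} \varepsilon \\ &\qquad + M_{1}^{2} \Big( (1-\chi_{k}(\mathcal{E})) \frac{1}{1+2\mathcal{E}^{2\alpha}+2k^{2\alpha}}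 + \chi_{k}(\mathcal{E}) \frac{1}{1+\frac{\mathcal{E}^{2}}{D^{2}}+4k^{2}} \Big). \end{aligned} \]
   Context: $\|\cdot\|_{(\ell)}(\Omega)$ denotes the norm of the Sobolev space $H^\ell(\Omega)$. $H(\Omega;\mathrm{curl})=\{u\in H^0(\Omega)^3:\ \mathrm{curl}\,u\in H^0(\Omega)^3\}$. $\mathrm{TH}(\partial\Omega)$ is the space of tangential traces $u\times\nu|_{\partial\Omega}$ of $u\in H(\Omega;\mathrm{curl})$ ($\nu$ the outward unit normal), normed by $\|g\|_{\mathrm{TH}(\partial\Omega)}=\inf\big(\|u\|_{(0)}(\Omega)+\|\mathrm{curl}\,u\|_{(0)}(\Omega)\big)$ over all $u\in H(\Omega;\mathrm{curl})$ with $u\times\nu=g$ on $\partial\Omega$. The linearised map is $\Lambda': E(\,;0)\times\nu|_{\partial\Omega}\mapsto H(\,;1)\times\nu|_{\partial\Omega}$, where $(E(\,;0),H(\,;0))\in H(\Omega;\mathrm{curl})^2$ solves $\mathrm{curl}\,E(\,;0)-i\omega\mu_0H(\,;0)=0$, $\mathrm{curl}\,H(\,;0)+i\omega\epsilon_0E(\,;0)=0$ in $\Omega$ with $E(\,;0)\times\nu=g$ on $\partial\Omega$, and $(E(\,;1),H(\,;1))$ solves $\mathrm{curl}\,E(\,;1)-i\omega\mu_0H(\,;1)=0$, $\mathrm{curl}\,H(\,;1)+i\omega\epsilon_0E(\,;1)=\sigma E(\,;0)$ in $\Omega$ with $E(\,;1)\times\nu=0$ on $\partial\Omega$. $D=\sup_{x,y\in\Omega}|x-y|$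 is the diameter of $\Omega$, $\mathrm{Vol}(\Omega)$ its volume, and $\mathrm{Vol}_2(\Omega)$ the supremum of the areas of all 2-dimensional orthogonal projections of $\Omega$. *)

theory Defs
  imports "HOL-Analysis.Analysis"
begin

definition partial_deriv :: "'n::finite \<Rightarrow> (real^'n \<Rightarrow> 'b::real_normed_vector) \<Rightarrow> real^'n \<Rightarrow> 'b" where
  "partial_deriv j f x = vector_derivative (\<lambda>t. f (x + t *\<^sub>R axis j 1)) (at 0)"

fun Ck_on :: "nat \<Rightarrow> (real^'n::finite) set \<Rightarrow> (real^'n \<Rightarrow> 'b::real_normed_vector) \<Rightarrow> bool" where
  "Ck_on 0 U f = continuous_on U f"
| "Ck_on (Suc k) U f =
     (continuous_on U f \<and>
      (\<forall>j. \<forall>x\<in>U. (\<lambda>t. f (x + t *\<^sub>R axis j 1)) differentiable (at 0)) \<and>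
      (\<forall>j. Ck_on k U (partial_deriv j f)))"

definition smooth_on :: "(real^'n::finite) set \<Rightarrow> (real^'n \<Rightarrow> 'b::real_normed_vector) \<Rightarrow> bool" where
  "smooth_on U f \<longleftrightarrow> (\<forall>k. Ck_on k U f)"

definition test_fun :: "(real^3) set \<Rightarrow> (real^3 \<Rightarrow> 'b::real_normed_vector) \<Rightarrow> bool" where
  "test_fun \<Omega> \<phi> \<longleftrightarrow> smooth_on UNIV \<phi> \<and> compact (closure {x. \<phi> x \<noteq> 0})
                      \<and> closure {x. \<phi> x \<noteq> 0} \<subseteq> \<Omega>"

definition C2_boundary :: "(real^3) set \<Rightarrow> bool" where
  "C2_boundary \<Omega> \<longleftrightarrow>
     (\<forall>p\<in>frontier \<Omega>. \<exists>(Q::real^3 \<Rightarrow> real^3) (U::(real^2) set) (h::real^2 \<Rightarrow> real) r.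
        orthogonal_transformation Q \<and> r > 0 \<and> open U \<and> Ck_on 2 U h \<and>
        (\<forall>x\<in>ball p r. vector [Q (x - p) $ 1, Q (x - p) $ 2] \<in> U \<and>
            (x \<in> \<Omega> \<longleftrightarrow> Q (x - p) $ 3 < h (vector [Q (x - p) $ 1, Q (x - p) $ 2]))))"

definition L2 :: "(real^3) set \<Rightarrow> (real^3 \<Rightarrow> 'b::{real_normed_vector,second_countable_topology}) \<Rightarrow> bool" where
  "L2 \<Omega> u \<longleftrightarrow> u \<in> borel_measurable (lebesgue_on \<Omega>) \<and>
                integrable (lebesgue_on \<Omega>) (\<lambda>x. (norm (u x))\<^sup>2)"

definition L2norm :: "(real^3) set \<Rightarrow> (real^3 \<Rightarrow> 'b::real_normed_vector) \<Rightarrow> real" where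
  "L2norm \<Omega> u = sqrt (integral\<^sup>L (lebesgue_on \<Omega>) (\<lambda>x. (norm (u x))\<^sup>2))"

definition Linfty :: "(real^3) set \<Rightarrow> (real^3 \<Rightarrow> real) \<Rightarrow> bool" where
  "Linfty \<Omega> s \<longleftrightarrow> s \<in> borel_measurable (lebesgue_on \<Omega>) \<and>
                    (\<exists>B. AE x in lebesgue_on \<Omega>. \<bar>s x\<bar> \<le> B)"

definition weak_grad :: "(real^3) set \<Rightarrow> (real^3 \<Rightarrow> real) \<Rightarrow> (real^3 \<Rightarrow> real^3) \<Rightarrow> bool" where
  "weak_grad \<Omega> s g \<longleftrightarrow> L2 \<Omega> s \<and> L2 \<Omega> g \<and>
     (\<forall>\<phi>::real^3 \<Rightarrow> real. test_fun \<Omega> \<phi> \<longrightarrow> (\<forall>j.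
        integral\<^sup>L (lebesgue_on \<Omega>) (\<lambda>x. s x * partial_deriv j \<phi> x) =
        - integral\<^sup>L (lebesgue_on \<Omega>) (\<lambda>x. g x $ j * \<phi> x)))"

definition H1norm :: "(real^3) set \<Rightarrow> (real^3 \<Rightarrow> real) \<Rightarrow> (real^3 \<Rightarrow> real^3) \<Rightarrow> real" where
  "H1norm \<Omega> s g = sqrt ((L2norm \<Omega> s)\<^sup>2 + (L2norm \<Omega> g)\<^sup>2)"

text \<open>Vanishing trace on the boundary (weak Green formula: the boundary term
  int_{dOmega} s phi nu_j vanishes for every phi smooth up to the boundary).\<close>
definition zero_trace :: "(real^3) set \<Rightarrow> (real^3 \<Rightarrow> real) \<Rightarrow> (real^3 \<Rightarrow> real^3) \<Rightarrow> bool" where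
  "zero_trace \<Omega> s g \<longleftrightarrow>
     (\<forall>\<phi>::real^3 \<Rightarrow> real. smooth_on UNIV \<phi> \<longrightarrow> (\<forall>j.
        integral\<^sup>L (lebesgue_on \<Omega>) (\<lambda>x. s x * partial_deriv j \<phi> x + g x $ j * \<phi> x) = 0))"

definition cdot :: "complex^3 \<Rightarrow> complex^3 \<Rightarrow> complex" where
  "cdot a b = (\<Sum>i\<in>UNIV. a $ i * b $ i)"

definition curl :: "(real^3 \<Rightarrow> complex^3) \<Rightarrow> real^3 \<Rightarrow> complex^3" where
  "curl \<phi> x = vector
     [partial_deriv 2 (\<lambda>y. \<phi> y $ 3) x - partial_deriv 3 (\<lambda>y. \<phi> y $ 2) x,
      partial_deriv 3 (\<lambda>y. \<phi> y $ 1) x - partial_deriv 1 (\<lambda>y. \<phi> y $ 3) x,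
      partial_deriv 1 (\<lambda>y. \<phi> y $ 2) x - partial_deriv 2 (\<lambda>y. \<phi> y $ 1) x]"

text \<open>w is the weak curl of u, both in L^2; i.e. (u,w) represents an element of H(Omega;curl).\<close>
definition weak_curl :: "(real^3) set \<Rightarrow> (real^3 \<Rightarrow> complex^3) \<Rightarrow> (real^3 \<Rightarrow> complex^3) \<Rightarrow> bool" where
  "weak_curl \<Omega> u w \<longleftrightarrow> L2 \<Omega> u \<and> L2 \<Omega> w \<and>
     (\<forall>\<phi>. test_fun \<Omega> \<phi> \<longrightarrow>
        integral\<^sup>L (lebesgue_on \<Omega>) (\<lambda>x. cdot (u x) (curl \<phi> x)) =
        integral\<^sup>L (lebesgue_on \<Omega>) (\<lambda>x. cdot (w x) (\<phi> x)))"

text \<open>Tangential trace u x nu, as the functional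
  phi |-> int_Omega (curl u . phi - u . curl phi) on fields smooth up to the boundary.\<close>
definition tan_trace :: "(real^3) set \<Rightarrow> (real^3 \<Rightarrow> complex^3) \<Rightarrow> (real^3 \<Rightarrow> complex^3)
                         \<Rightarrow> (real^3 \<Rightarrow> complex^3) \<Rightarrow> complex" where
  "tan_trace \<Omega> u cu \<phi> =
     integral\<^sup>L (lebesgue_on \<Omega>) (\<lambda>x. cdot (cu x) (\<phi> x) - cdot (u x) (curl \<phi> x))"

definition same_tan_trace :: "(real^3) set \<Rightarrow> (real^3 \<Rightarrow> complex^3) \<Rightarrow> (real^3 \<Rightarrow> complex^3)
                         \<Rightarrow> (real^3 \<Rightarrow> complex^3) \<Rightarrow> (real^3 \<Rightarrow> complex^3) \<Rightarrow> bool" where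
  "same_tan_trace \<Omega> u cu v cv \<longleftrightarrow>
     (\<forall>\<phi>. smooth_on UNIV \<phi> \<longrightarrow> tan_trace \<Omega> u cu \<phi> = tan_trace \<Omega> v cv \<phi>)"

definition zero_tan_trace :: "(real^3) set \<Rightarrow> (real^3 \<Rightarrow> complex^3) \<Rightarrow> (real^3 \<Rightarrow> complex^3) \<Rightarrow> bool" where
  "zero_tan_trace \<Omega> u cu \<longleftrightarrow> (\<forall>\<phi>. smooth_on UNIV \<phi> \<longrightarrow> tan_trace \<Omega> u cu \<phi> = 0)"

text \<open>Norm in TH(dOmega) of the tangential trace of u (u with weak curl cu).\<close>
definition TH_norm :: "(real^3) set \<Rightarrow> (real^3 \<Rightarrow> complex^3) \<Rightarrow> (real^3 \<Rightarrow> complex^3) \<Rightarrow> real" where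
  "TH_norm \<Omega> u cu = Inf {L2norm \<Omega> v + L2norm \<Omega> cv | v cv.
                           weak_curl \<Omega> v cv \<and> same_tan_trace \<Omega> v cv u cu}"

definition maxwell_sol :: "real \<Rightarrow> real \<Rightarrow> real \<Rightarrow> (real^3) set \<Rightarrow> (real^3 \<Rightarrow> complex^3)
                          \<Rightarrow> (real^3 \<Rightarrow> complex^3) \<Rightarrow> (real^3 \<Rightarrow> complex^3) \<Rightarrow> bool" where
  "maxwell_sol \<omega> \<epsilon>\<^sub>0 \<mu>\<^sub>0 \<Omega> f E H \<longleftrightarrow>
     weak_curl \<Omega> E (\<lambda>x. (\<i> * \<omega> * \<mu>\<^sub>0) *s H x) \<and>
     weak_curl \<Omega> H (\<lambda>x. f x - (\<i> * \<omega> * \<epsilon>\<^sub>0) *s E x)"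

text \<open>Problem for (E(;0),H(;0)) with boundary datum g = v x nu (v in H(curl), curl v = cv).\<close>
definition problem0 :: "real \<Rightarrow> real \<Rightarrow> real \<Rightarrow> (real^3) set \<Rightarrow> (real^3 \<Rightarrow> complex^3) \<Rightarrow> (real^3 \<Rightarrow> complex^3)
                       \<Rightarrow> (real^3 \<Rightarrow> complex^3) \<Rightarrow> (real^3 \<Rightarrow> complex^3) \<Rightarrow> bool" where
  "problem0 \<omega> \<epsilon>\<^sub>0 \<mu>\<^sub>0 \<Omega> v cv E0 H0 \<longleftrightarrow>
     maxwell_sol \<omega> \<epsilon>\<^sub>0 \<mu>\<^sub>0 \<Omega> (\<lambda>x. 0) E0 H0 \<and>
     same_tan_trace \<Omega> E0 (\<lambda>x. (\<i> * \<omega> * \<mu>\<^sub>0) *s H0 x) v cv"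

definition problem1 :: "real \<Rightarrow> real \<Rightarrow> real \<Rightarrow> (real^3) set \<Rightarrow> (real^3 \<Rightarrow> real) \<Rightarrow> (real^3 \<Rightarrow> complex^3)
                       \<Rightarrow> (real^3 \<Rightarrow> complex^3) \<Rightarrow> (real^3 \<Rightarrow> complex^3) \<Rightarrow> bool" where
  "problem1 \<omega> \<epsilon>\<^sub>0 \<mu>\<^sub>0 \<Omega> \<sigma> E0 E1 H1 \<longleftrightarrow>
     maxwell_sol \<omega> \<epsilon>\<^sub>0 \<mu>\<^sub>0 \<Omega> (\<lambda>x. complex_of_real (\<sigma> x) *s E0 x) E1 H1 \<and>
     zero_tan_trace \<Omega> E1 (\<lambda>x. (\<i> * \<omega> * \<mu>\<^sub>0) *s H1 x)"

definition uniquely_solvable :: "real \<Rightarrow> real \<Rightarrow> real \<Rightarrow> (real^3) set \<Rightarrow> (real^3 \<Rightarrow> real) \<Rightarrow> bool" where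
  "uniquely_solvable \<omega> \<epsilon>\<^sub>0 \<mu>\<^sub>0 \<Omega> \<sigma> \<longleftrightarrow>
     (\<forall>v cv. weak_curl \<Omega> v cv \<longrightarrow> (\<exists>E0 H0. problem0 \<omega> \<epsilon>\<^sub>0 \<mu>\<^sub>0 \<Omega> v cv E0 H0)) \<and>
     (\<forall>v cv E0 H0. weak_curl \<Omega> v cv \<longrightarrow> problem0 \<omega> \<epsilon>\<^sub>0 \<mu>\<^sub>0 \<Omega> v cv E0 H0 \<longrightarrow>
        (\<exists>E1 H1. problem1 \<omega> \<epsilon>\<^sub>0 \<mu>\<^sub>0 \<Omega> \<sigma> E0 E1 H1)) \<and>
     (\<forall>E H. maxwell_sol \<omega> \<epsilon>\<^sub>0 \<mu>\<^sub>0 \<Omega> (\<lambda>x. 0) E H \<longrightarrow>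
        zero_tan_trace \<Omega> E (\<lambda>x. (\<i> * \<omega> * \<mu>\<^sub>0) *s H x) \<longrightarrow>
        (AE x in lebesgue_on \<Omega>. E x = 0 \<and> H x = 0))"

definition Lambda'_bound :: "real \<Rightarrow> real \<Rightarrow> real \<Rightarrow> (real^3) set \<Rightarrow> (real^3 \<Rightarrow> real) \<Rightarrow> real \<Rightarrow> bool" where
  "Lambda'_bound \<omega> \<epsilon>\<^sub>0 \<mu>\<^sub>0 \<Omega> \<sigma> C \<longleftrightarrow>
     (\<forall>v cv E0 H0 E1 H1. weak_curl \<Omega> v cv \<longrightarrow> problem0 \<omega> \<epsilon>\<^sub>0 \<mu>\<^sub>0 \<Omega> v cv E0 H0 \<longrightarrow>
        problem1 \<omega> \<epsilon>\<^sub>0 \<mu>\<^sub>0 \<Omega> \<sigma> E0 E1 H1 \<longrightarrow>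
        TH_norm \<Omega> H1 (\<lambda>x. complex_of_real (\<sigma> x) *s E0 x - (\<i> * \<omega> * \<epsilon>\<^sub>0) *s E1 x)
          \<le> C * TH_norm \<Omega> v cv)"

definition is_Lambda'_norm :: "real \<Rightarrow> real \<Rightarrow> real \<Rightarrow> (real^3) set \<Rightarrow> (real^3 \<Rightarrow> real) \<Rightarrow> real \<Rightarrow> bool" where
  "is_Lambda'_norm \<omega> \<epsilon>\<^sub>0 \<mu>\<^sub>0 \<Omega> \<sigma> e \<longleftrightarrow>
     Lambda'_bound \<omega> \<epsilon>\<^sub>0 \<mu>\<^sub>0 \<Omega> \<sigma> e \<and>
     (\<forall>C. Lambda'_bound \<omega> \<epsilon>\<^sub>0 \<mu>\<^sub>0 \<Omega> \<sigma> C \<longrightarrow> e \<le> C)"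

definition Vol :: "(real^3) set \<Rightarrow> real" where
  "Vol \<Omega> = measure lebesgue \<Omega>"

definition Vol2 :: "(real^3) set \<Rightarrow> real" where
  "Vol2 \<Omega> = Sup {measure lebesgue ((\<lambda>x. vector [x \<bullet> u, x \<bullet> w] :: real^2) ` \<Omega>) | u w.
                   norm u = 1 \<and> norm w = 1 \<and> u \<bullet> w = 0}"

end

theory Submission
  imports Defs "HOL-Probability.Characteristic_Functions"
begin

text \<open>
  Testing the first-order problem against a Maxwell plane wave \<open>E\<^sup>*\<close> gives
  \<open>\<integral> \<sigma> E(;0) \<cdot> E\<^sup>* = \<langle>\<Lambda>'(E(;0) \<times> \<nu>), E\<^sup>*\<rangle>\<close>, so plane waves with frequencies \<open>\<zeta> + \<zeta>\<^sup>* = \<xi>\<close>,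
  \<open>\<zeta> \<cdot> \<zeta> = \<zeta>\<^sup>* \<cdot> \<zeta>\<^sup>* = k\<^sup>2\<close>, bound the Fourier transform of \<open>\<sigma>\<close> at \<open>\<xi>\<close> by \<open>\<epsilon>\<close>. For
  \<open>|\<xi>| \<le> 2 k\<close> the frequencies are real and the bound is \<open>\<epsilon> k (1 + k) Vol \<Omega>\<close>. For \<open>|\<xi>| > 2 k\<close>
  they have imaginary parts \<open>\<plusminus> t e\<close> with \<open>t\<^sup>2 = |\<xi>|\<^sup>2 / 4 - k\<^sup>2\<close>; slicing \<open>\<Omega>\<close> orthogonally to \<open>e\<close>
  bounds the exponential weights by \<open>Vol2 \<Omega> sinh (t D) / t\<close>, which costs a factor
  \<open>exp \<E> = 1 / \<epsilon>\<close> in the square up to \<open>t = \<E> / (2 D)\<close>. Since \<open>\<sigma>\<close> vanishes on the boundary, its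
  extension by zero lies in \<open>H\<^sup>1\<close> of the whole space, and the remaining frequencies are controlled by
  \<open>M\<^sub>1\<close> through Plancherel's formula.
\<close>

section \<open>Plancherel's formula\<close>

lemma borel_measurable_cis [measurable]: "cis \<in> borel_measurable borel"
  by (intro borel_measurable_continuous_onI continuous_intros)

lemma
  fixes f g :: "'a \<Rightarrow> real"
  assumes [measurable]: "f \<in> borel_measurable M" "g \<in> borel_measurable M"
    and f: "integrable M (\<lambda>x. (f x)\<^sup>2)" and g: "integrable M (\<lambda>x. (g x)\<^sup>2)"
  shows integrable_mult_of_squares: "integrable M (\<lambda>x. f x * g x)"
    and Cauchy_Schwarz_integral:
      "\<bar>LINT x|M. f x * g x\<bar> \<le> sqrt (LINT x|M. (f x)\<^sup>2) * sqrt (LINT x|M. (g x)\<^sup>2)"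
proof -
  show int: "integrable M (\<lambda>x. f x * g x)"
  proof (rule Bochner_Integration.integrable_bound)
    show "integrable M (\<lambda>x. (f x)\<^sup>2 + (g x)\<^sup>2)" using f g by simp
    show "AE x in M. norm (f x * g x) \<le> norm ((f x)\<^sup>2 + (g x)\<^sup>2)"
    proof (rule AE_I2)
      fix x
      have "\<bar>f x * g x\<bar> \<le> 2 * \<bar>f x\<bar> * \<bar>g x\<bar>" by (simp add: abs_mult)
      also have "\<dots> \<le> (f x)\<^sup>2 + (g x)\<^sup>2" using sum_squares_bound[of "\<bar>f x\<bar>" "\<bar>g x\<bar>"] by simp
      finally show "norm (f x * g x) \<le> norm ((f x)\<^sup>2 + (g x)\<^sup>2)" by simp
    qed
  qed simp
  have "ennreal ((LINT x|M. \<bar>f x * g x\<bar>)\<^sup>2) = (\<integral>\<^sup>+x. ennreal \<bar>f x\<bar> * ennreal \<bar>g x\<bar> \<partial>M)\<^sup>2"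
    using int by (simp add: nn_integral_eq_integral[symmetric] ennreal_mult[symmetric]
      ennreal_power[symmetric] abs_mult[symmetric])
  also have "\<dots> \<le> (\<integral>\<^sup>+x. (ennreal \<bar>f x\<bar>)\<^sup>2 \<partial>M) * (\<integral>\<^sup>+x. (ennreal \<bar>g x\<bar>)\<^sup>2 \<partial>M)"
    by (rule Cauchy_Schwarz_nn_integral) auto
  also have "\<dots> = ennreal ((LINT x|M. (f x)\<^sup>2) * (LINT x|M. (g x)\<^sup>2))"
    using f g by (simp add: nn_integral_eq_integral[symmetric] ennreal_mult ennreal_power)
  finally have "(LINT x|M. \<bar>f x * g x\<bar>)\<^sup>2 \<le> (LINT x|M. (f x)\<^sup>2) * (LINT x|M. (g x)\<^sup>2)"
    by (subst (asm) ennreal_le_iff) (auto intro!: mult_nonneg_nonneg)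
  then have "(LINT x|M. \<bar>f x * g x\<bar>) \<le> sqrt (LINT x|M. (f x)\<^sup>2) * sqrt (LINT x|M. (g x)\<^sup>2)"
    unfolding real_sqrt_mult[symmetric] by (rule real_le_rsqrt)
  then show "\<bar>LINT x|M. f x * g x\<bar> \<le> sqrt (LINT x|M. (f x)\<^sup>2) * sqrt (LINT x|M. (g x)\<^sup>2)"
    using integral_norm_bound[of M "\<lambda>x. f x * g x"] by (simp only: real_norm_def)
qed

lemma
  fixes f :: "'a::euclidean_space \<Rightarrow> real \<Rightarrow> 'b::{real_normed_field,banach,second_countable_topology}"
  assumes f: "\<And>b. b \<in> Basis \<Longrightarrow> integrable lborel (f b)"
  shows lborel_integrable_prod: "integrable lborel (\<lambda>x::'a. \<Prod>b\<in>Basis. f b (x \<bullet> b))"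
    and lborel_integral_prod:
      "(LINT x|lborel. (\<Prod>b\<in>Basis. f b (x \<bullet> b))) = (\<Prod>b\<in>Basis. integral\<^sup>L lborel (f b))"
proof -
  interpret product_sigma_finite "\<lambda>_::'a. lborel :: real measure" ..
  have [measurable]: "b \<in> Basis \<Longrightarrow> f b \<in> borel_measurable borel" for b
    using borel_measurable_integrable[OF f[of b]] by simp
  have coordinates: "(\<Prod>b\<in>Basis. f b ((\<Sum>b\<in>Basis. x b *\<^sub>R b) \<bullet> b)) = (\<Prod>b\<in>Basis. f b (x b))"
      for x :: "'a \<Rightarrow> real"
    by (intro prod.cong) (auto simp: inner_sum_left inner_Basis if_distrib cong: if_cong)
  show "integrable lborel (\<lambda>x::'a. \<Prod>b\<in>Basis. f b (x \<bullet> b))"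
    using product_integrable_prod[of Basis f, OF finite_Basis f]
    by (subst lborel_eq, subst integrable_distr_eq) (auto simp: coordinates)
  show "(LINT x|lborel. (\<Prod>b\<in>Basis. f b (x \<bullet> b))) = (\<Prod>b\<in>Basis. integral\<^sup>L lborel (f b))"
    using product_integral_prod[of Basis f, OF finite_Basis f]
    by (subst lborel_eq, subst integral_distr) (auto simp: coordinates)
qed

lemma
  fixes f :: "'a::euclidean_space \<Rightarrow> 'b::{banach,second_countable_topology}"
  assumes c: "c \<noteq> 0" and f: "integrable lborel f"
  shows lborel_integrable_affine: "integrable lborel (\<lambda>x. f (t + c *\<^sub>R x))"
    and lborel_integral_affine:
      "integral\<^sup>L lborel f = \<bar>c\<bar> ^ DIM('a) *\<^sub>R (LINT x|lborel. f (t + c *\<^sub>R x))"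
proof -
  let ?D = "density (distr lborel borel (\<lambda>x. t + c *\<^sub>R x)) (\<lambda>_. ennreal (\<bar>c\<bar> ^ DIM('a)))"
  have affine: "?D = lborel" using lborel_affine[OF c, of t] by simp
  have [measurable]: "f \<in> borel_measurable borel"
    using borel_measurable_integrable[OF f] by simp
  have "integrable ?D f" unfolding affine by (rule f)
  then have "integrable lborel (\<lambda>x. \<bar>c\<bar> ^ DIM('a) *\<^sub>R f (t + c *\<^sub>R x))"
    by (subst (asm) integrable_density; simp add: integrable_distr_eq)
  from integrable_scaleR_right[OF this, of "inverse (\<bar>c\<bar> ^ DIM('a))"]
  show "integrable lborel (\<lambda>x. f (t + c *\<^sub>R x))" using c by simp
  have "integral\<^sup>L ?D f = \<bar>c\<bar> ^ DIM('a) *\<^sub>R (LINT x|lborel. f (t + c *\<^sub>R x))"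
    by (subst integral_density; simp add: integral_distr)
  then show "integral\<^sup>L lborel f = \<bar>c\<bar> ^ DIM('a) *\<^sub>R (LINT x|lborel. f (t + c *\<^sub>R x))"
    unfolding affine .
qed

lemma
  fixes f :: "'a::euclidean_space \<Rightarrow> 'b::{banach,second_countable_topology}"
  assumes f: "integrable lborel f"
  shows lborel_integrable_translate: "integrable lborel (\<lambda>x. f (t + x))"
    and lborel_integral_translate: "(LINT x|lborel. f (t + x)) = integral\<^sup>L lborel f"
  using lborel_integrable_affine[OF _ f, of 1 t] lborel_integral_affine[OF _ f, of 1 t] by simp_all

text \<open>The Lebesgue measure is complete, so that extensions by zero of Lebesgue measurable functions
  are covered; the Fubini arguments need a Borel measurable \<open>f\<close>.\<close>

definition fourier :: "('a::euclidean_space \<Rightarrow> real) \<Rightarrow> 'a \<Rightarrow> complex" where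
  "fourier f \<xi> = (LINT x|lebesgue. complex_of_real (f x) * cis (\<xi> \<bullet> x))"

lemma fourier_lborel:
  assumes [measurable]: "f \<in> borel_measurable borel"
  shows "fourier f \<xi> = (LINT x|lborel. complex_of_real (f x) * cis (\<xi> \<bullet> x))"
  unfolding fourier_def by (rule integral_completion) simp

lemma borel_measurable_fourier [measurable]:
  assumes [measurable]: "f \<in> borel_measurable borel"
  shows "fourier f \<in> borel_measurable borel"
proof -
  have "(\<lambda>\<xi>. LINT x|lborel. complex_of_real (f x) * cis (\<xi> \<bullet> x)) \<in> borel_measurable lborel"
    by (rule lborel.borel_measurable_lebesgue_integral) simp
  moreover have "fourier f = (\<lambda>\<xi>. LINT x|lborel. complex_of_real (f x) * cis (\<xi> \<bullet> x))"
    by (rule ext) (simp add: fourier_lborel)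
  ultimately show ?thesis by simp
qed

lemma norm_fourier_le:
  assumes "f \<in> borel_measurable borel"
  shows "norm (fourier f \<xi>) \<le> (LINT x|lborel. \<bar>f x\<bar>)"
  unfolding fourier_lborel[OF assms]
  by (rule order_trans[OF integral_norm_bound]) (simp add: norm_mult)

lemma integrable_mult_cis:
  fixes f :: "'a::euclidean_space \<Rightarrow> real"
  assumes f: "integrable lborel f"
  shows "integrable lborel (\<lambda>x. complex_of_real (f x) * cis (\<xi> \<bullet> x))"
proof -
  have [measurable]: "f \<in> borel_measurable borel" using borel_measurable_integrable[OF f] by simp
  show ?thesis
    by (rule Bochner_Integration.integrable_bound[OF f]) (auto simp: norm_mult)
qed

lemma integrable_lborel_pair_mult:
  fixes f :: "'a::euclidean_space \<Rightarrow> real" and g :: "'b::euclidean_space \<Rightarrow> real"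
  assumes f: "integrable lborel f" and g: "integrable lborel g"
  shows "integrable (lborel \<Otimes>\<^sub>M lborel) (\<lambda>(x, y). f x * g y)"
proof -
  have [measurable]: "f \<in> borel_measurable borel" "g \<in> borel_measurable borel"
    using borel_measurable_integrable[OF f] borel_measurable_integrable[OF g] by auto
  show ?thesis
    by (rule lborel_pair.Fubini_integrable)
      (auto intro!: integrable_abs f g simp: split_beta' abs_mult)
qed

lemma fourier_multiplication_formula:
  fixes f g :: "'a::euclidean_space \<Rightarrow> real"
  assumes f: "integrable lborel f" and g: "integrable lborel g"
  shows "(LINT \<xi>|lborel. complex_of_real (g \<xi>) * fourier f \<xi>)
       = (LINT x|lborel. complex_of_real (f x) * fourier g x)"
proof -
  have [measurable]: "f \<in> borel_measurable borel" "g \<in> borel_measurable borel"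
    using borel_measurable_integrable[OF f] borel_measurable_integrable[OF g] by auto
  let ?F = "\<lambda>\<xi> x. complex_of_real (g \<xi>) * (complex_of_real (f x) * cis (\<xi> \<bullet> x))"
  have int: "integrable (lborel \<Otimes>\<^sub>M lborel) (\<lambda>(\<xi>, x). ?F \<xi> x)"
    by (rule Bochner_Integration.integrable_bound[OF integrable_lborel_pair_mult[OF g f]])
       (auto simp: norm_mult)
  have "(LINT \<xi>|lborel. complex_of_real (g \<xi>) * fourier f \<xi>)
      = (LINT \<xi>|lborel. LINT x|lborel. ?F \<xi> x)"
    by (simp add: fourier_lborel)
  also have "\<dots> = (LINT x|lborel. LINT \<xi>|lborel. ?F \<xi> x)"
    by (rule lborel_pair.Fubini_integral[OF int, symmetric])
  also have "\<dots> = (LINT x|lborel. LINT \<xi>|lborel.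
      complex_of_real (f x) * (complex_of_real (g \<xi>) * cis (x \<bullet> \<xi>)))"
    by (simp add: mult_ac inner_commute)
  finally show ?thesis by (simp add: fourier_lborel)
qed

subsection \<open>Gaussians\<close>

definition gauss :: "'a::euclidean_space \<Rightarrow> real" where
  "gauss x = exp (- ((norm x)\<^sup>2 / 2))"

lemma borel_measurable_gauss [measurable]: "gauss \<in> borel_measurable borel"
  unfolding gauss_def[abs_def] by simp

lemma gauss_zero [simp]: "gauss 0 = 1" and gauss_nonneg [simp]: "0 \<le> gauss x"
  by (simp_all add: gauss_def)

lemma gauss_mono: "norm y \<le> norm x \<Longrightarrow> gauss x \<le> gauss y"
  by (simp add: gauss_def power_mono)

lemma gauss_eq_prod: "gauss x = (\<Prod>b\<in>Basis. exp (- ((x \<bullet> b)\<^sup>2 / 2)))"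
proof -
  have "(norm x)\<^sup>2 = (\<Sum>b\<in>Basis. (x \<bullet> b)\<^sup>2)"
    unfolding power2_norm_eq_inner by (subst euclidean_inner) (simp add: power2_eq_square)
  then show ?thesis
    by (simp add: gauss_def exp_sum[symmetric] sum_divide_distrib sum_negf)
qed

lemma cis_inner_eq_prod: "cis (z \<bullet> x) = (\<Prod>b\<in>Basis. cis ((z \<bullet> b) * (x \<bullet> b)))"
  by (subst euclidean_inner) (simp add: cis_conv_exp sum_distrib_left exp_sum)

lemma
  shows integrable_exp_neg_square: "integrable lborel (\<lambda>x::real. exp (- (x\<^sup>2 / 2)))"
    and fourier_exp_neg_square: "fourier (\<lambda>x::real. exp (- (x\<^sup>2 / 2))) t
        = sqrt (2 * pi) * exp (- (t\<^sup>2 / 2))"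
proof -
  have density: "exp (- (x\<^sup>2 / 2)) = sqrt (2 * pi) * std_normal_density x" for x
    by (simp add: std_normal_density_def)
  show "integrable lborel (\<lambda>x::real. exp (- (x\<^sup>2 / 2)))"
    unfolding density by (intro integrable_mult_right integrable_normal_density) simp
  have "char std_normal_distribution t = (LINT x|lborel. std_normal_density x *\<^sub>R cis (t * x))"
    unfolding char_def by (subst integral_density) (auto simp: cis_conv_exp)
  then have "(LINT x|lborel. std_normal_density x *\<^sub>R cis (t * x)) = exp (- (t\<^sup>2 / 2))"
    by (simp add: char_std_normal_distribution)
  moreover have "fourier (\<lambda>x::real. exp (- (x\<^sup>2 / 2))) t
     = (LINT x|lborel. sqrt (2 * pi) *\<^sub>R (std_normal_density x *\<^sub>R cis (t * x)))"
    unfolding density by (simp add: fourier_lborel scaleR_conv_of_real mult.assoc)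
  ultimately show "fourier (\<lambda>x::real. exp (- (x\<^sup>2 / 2))) t = sqrt (2 * pi) * exp (- (t\<^sup>2 / 2))"
    by (simp add: scaleR_conv_of_real)
qed

lemma integrable_gauss: "integrable lborel (gauss :: 'a::euclidean_space \<Rightarrow> real)"
  using lborel_integrable_prod[OF integrable_exp_neg_square, where 'a='a]
  by (simp add: gauss_eq_prod[abs_def])

lemma integrable_gauss_scaleR: "s \<noteq> 0 \<Longrightarrow> integrable lborel (\<lambda>x::'a::euclidean_space. gauss (s *\<^sub>R x))"
  using lborel_integrable_affine[OF _ integrable_gauss, of s "0::'a"] by simp

lemma fourier_gauss:
  fixes z :: "'a::euclidean_space"
  shows "fourier gauss z = sqrt (2 * pi) ^ DIM('a) * gauss z"
proof -
  let ?g = "\<lambda>x::real. exp (- (x\<^sup>2 / 2))"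
  have "fourier gauss z
      = (LINT x|lborel. (\<Prod>b\<in>Basis. complex_of_real (?g (x \<bullet> b)) * cis ((z \<bullet> b) * (x \<bullet> b))))"
    by (simp add: fourier_lborel gauss_eq_prod cis_inner_eq_prod prod.distrib)
  also have "\<dots> = (\<Prod>b\<in>Basis. fourier ?g (z \<bullet> b))"
    by (subst lborel_integral_prod)
       (use integrable_mult_cis[OF integrable_exp_neg_square] in \<open>auto simp: fourier_lborel\<close>)
  finally show ?thesis
    by (simp add: fourier_exp_neg_square gauss_eq_prod prod.distrib del: of_real_exp)
qed

lemma integral_gauss: "integral\<^sup>L lborel (gauss :: 'a::euclidean_space \<Rightarrow> real)
    = sqrt (2 * pi) ^ DIM('a)"
proof -
  have "complex_of_real (integral\<^sup>L lborel (gauss :: 'a \<Rightarrow> real))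
      = complex_of_real (sqrt (2 * pi) ^ DIM('a))"
    using fourier_gauss[of "0::'a"] by (simp add: fourier_lborel)
  then show ?thesis using of_real_eq_iff by blast
qed

lemma fourier_scaleR:
  fixes f :: "'a::euclidean_space \<Rightarrow> real"
  assumes f: "integrable lborel f" and s: "s > 0"
  shows "fourier (\<lambda>x. f (s *\<^sub>R x)) z = fourier f (z /\<^sub>R s) /\<^sub>R s ^ DIM('a)"
proof -
  have [measurable]: "f \<in> borel_measurable borel" using borel_measurable_integrable[OF f] by simp
  have "fourier f (z /\<^sub>R s) = \<bar>s\<bar> ^ DIM('a) *\<^sub>R
      (LINT x|lborel. complex_of_real (f (0 + s *\<^sub>R x)) * cis ((z /\<^sub>R s) \<bullet> (0 + s *\<^sub>R x)))"
    unfolding fourier_lborel[OF \<open>f \<in> borel_measurable borel\<close>]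
    by (intro lborel_integral_affine integrable_mult_cis f) (use s in auto)
  also have "\<dots> = s ^ DIM('a) *\<^sub>R fourier (\<lambda>x. f (s *\<^sub>R x)) z"
    using s by (simp add: fourier_lborel mult.assoc[symmetric])
  finally show ?thesis using s by simp
qed

subsection \<open>Continuity of translations in the mean square\<close>

lemma integrable_square_bounded_support:
  fixes f :: "'a::euclidean_space \<Rightarrow> real"
  assumes [measurable]: "f \<in> borel_measurable borel"
    and bounded: "\<And>x. \<bar>f x\<bar> \<le> B" and support: "\<And>x. R < norm x \<Longrightarrow> f x = 0"
  shows "integrable lborel (\<lambda>x. (f x)\<^sup>2)"
proof (rule Bochner_Integration.integrable_bound)
  show "integrable lborel (\<lambda>x::'a. B\<^sup>2 * indicator (cball 0 R) x)"
    by (intro integrable_mult_right integrable_real_indicator emeasure_lborel_cball_finite) simp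
  show "AE x in lborel. norm ((f x)\<^sup>2) \<le> norm (B\<^sup>2 * indicator (cball 0 R) x)"
    using power_mono[OF bounded abs_ge_zero, of _ 2] support
    by (intro AE_I2) (auto simp: indicator_def not_le)
qed simp

lemma integrable_square_diff:
  fixes f g :: "'a \<Rightarrow> real"
  assumes [measurable]: "f \<in> borel_measurable M" "g \<in> borel_measurable M"
    and "integrable M (\<lambda>x. (f x)\<^sup>2)" "integrable M (\<lambda>x. (g x)\<^sup>2)"
  shows "integrable M (\<lambda>x. (f x - g x)\<^sup>2)"
  using assms integrable_mult_of_squares[OF assms]
  by (simp add: power2_diff mult.assoc)

lemma integral_square_diff_triangle:
  fixes f g h :: "'a \<Rightarrow> real"
  assumes [measurable]: "f \<in> borel_measurable M" "g \<in> borel_measurable M" "h \<in> borel_measurable M"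
    and f: "integrable M (\<lambda>x. (f x)\<^sup>2)" and g: "integrable M (\<lambda>x. (g x)\<^sup>2)"
    and h: "integrable M (\<lambda>x. (h x)\<^sup>2)"
  shows "(LINT x|M. (f x - h x)\<^sup>2) \<le> 2 * (LINT x|M. (f x - g x)\<^sup>2) + 2 * (LINT x|M. (g x - h x)\<^sup>2)"
proof -
  have int: "integrable M (\<lambda>x. (f x - g x)\<^sup>2)" "integrable M (\<lambda>x. (g x - h x)\<^sup>2)"
    "integrable M (\<lambda>x. (f x - h x)\<^sup>2)"
    by (intro integrable_square_diff f g h; simp)+
  have "(LINT x|M. (f x - h x)\<^sup>2) \<le> (LINT x|M. 2 * (f x - g x)\<^sup>2 + 2 * (g x - h x)\<^sup>2)"
  proof (rule Bochner_Integration.integral_mono)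
    show "(f x - h x)\<^sup>2 \<le> 2 * (f x - g x)\<^sup>2 + 2 * (g x - h x)\<^sup>2" for x
      using sum_squares_bound[of "f x - g x" "g x - h x"]
      by (simp add: power2_eq_square algebra_simps)
  qed (use int in simp_all)
  then show ?thesis using int by simp
qed

definition truncate :: "real \<Rightarrow> ('a::euclidean_space \<Rightarrow> real) \<Rightarrow> 'a \<Rightarrow> real" where
  "truncate m f x = max (- m) (min m (f x)) * max 0 (min 1 (m + 1 - norm x))"

lemma borel_measurable_truncate [measurable]:
  "f \<in> borel_measurable borel \<Longrightarrow> truncate m f \<in> borel_measurable borel"
  unfolding truncate_def[abs_def] by simp

lemma continuous_on_truncate: "continuous_on S f \<Longrightarrow> continuous_on S (truncate m f)"
  unfolding truncate_def[abs_def] by (intro continuous_intros)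

lemma truncate_eq_0: "m + 1 < norm x \<Longrightarrow> truncate m f x = 0"
  by (simp add: truncate_def)

lemma abs_truncate_le:
  assumes "0 \<le> m"
  shows "\<bar>truncate m f x\<bar> \<le> m" and "\<bar>f x - truncate m f x\<bar> \<le> \<bar>f x\<bar>"
proof -
  define c where "c = max 0 (min 1 (m + 1 - norm x))"
  have c: "0 \<le> c" "c \<le> 1" by (auto simp: c_def)
  have "\<bar>max (- m) (min m (f x))\<bar> * c \<le> m * 1"
    using assms c by (intro mult_mono) auto
  then show "\<bar>truncate m f x\<bar> \<le> m"
    using c by (simp add: truncate_def c_def[symmetric] abs_mult)
  show "\<bar>f x - truncate m f x\<bar> \<le> \<bar>f x\<bar>"
  proof (cases "0 \<le> f x")
    case True
    then have "0 \<le> max (- m) (min m (f x))" "max (- m) (min m (f x)) \<le> f x" using assms by auto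
    then show ?thesis using c mult_mono[of "max (- m) (min m (f x))" "f x" c 1] True
      by (simp add: truncate_def c_def[symmetric])
  next
    case False
    then have "max (- m) (min m (f x)) \<le> 0" "f x \<le> max (- m) (min m (f x))" using assms by auto
    then show ?thesis using c mult_mono[of "- max (- m) (min m (f x))" "- f x" c 1] False
        mult_nonpos_nonneg[of "max (- m) (min m (f x))" c]
      by (simp add: truncate_def c_def[symmetric])
  qed
qed

lemma truncate_eq:
  assumes "\<bar>f x\<bar> \<le> m" "norm x \<le> m"
  shows "truncate m f x = f x"
  using assms by (simp add: truncate_def max_def min_def abs_le_iff)

lemma integral_square_diff_truncate_tendsto_0:
  fixes f :: "'a::euclidean_space \<Rightarrow> real"
  assumes [measurable]: "f \<in> borel_measurable borel" and f2: "integrable lborel (\<lambda>x. (f x)\<^sup>2)"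
  shows "(\<lambda>m. LINT x|lborel. (f x - truncate (real m) f x)\<^sup>2) \<longlonglongrightarrow> 0"
proof -
  have "(\<lambda>m. LINT x|lborel. (f x - truncate (real m) f x)\<^sup>2) \<longlonglongrightarrow> (LINT x::'a|lborel. 0)"
  proof (rule integral_dominated_convergence[OF _ _ f2])
    have "(\<lambda>m. (f x - truncate (real m) f x)\<^sup>2) \<longlonglongrightarrow> 0" for x
    proof (rule tendsto_eventually)
      obtain m\<^sub>0 :: nat where "max \<bar>f x\<bar> (norm x) \<le> m\<^sub>0" using real_arch_simple by blast
      then have "(f x - truncate (real m) f x)\<^sup>2 = 0" if "m\<^sub>0 \<le> m" for m
        using that by (simp add: truncate_eq)
      then show "\<forall>\<^sub>F m in sequentially. (f x - truncate (real m) f x)\<^sup>2 = 0"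
        by (rule eventually_sequentiallyI)
    qed
    then show "AE x in lborel. (\<lambda>m. (f x - truncate (real m) f x)\<^sup>2) \<longlonglongrightarrow> 0" by simp
    show "AE x in lborel. norm ((f x - truncate (real m) f x)\<^sup>2) \<le> (f x)\<^sup>2" for m
      using abs_truncate_le(2)[of "real m" f] by (simp add: abs_le_square_iff)
  qed simp_all
  then show ?thesis by simp
qed

lemma integral_square_diff_truncate_approx_tendsto_0:
  fixes f :: "'a::euclidean_space \<Rightarrow> real"
  assumes [measurable]: "f \<in> borel_measurable borel" "\<And>n. h n \<in> borel_measurable borel"
    and lim: "AE x in lborel. (\<lambda>n. h n x) \<longlonglongrightarrow> f x" and m: "0 \<le> m"
  shows "(\<lambda>n. LINT x|lborel. (truncate m f x - truncate m (h n) x)\<^sup>2) \<longlonglongrightarrow> 0"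
proof -
  have "(\<lambda>n. LINT x|lborel. (truncate m f x - truncate m (h n) x)\<^sup>2) \<longlonglongrightarrow> (LINT x::'a|lborel. 0)"
  proof (rule integral_dominated_convergence)
    show "integrable lborel (\<lambda>x::'a. (2 * m)\<^sup>2 * indicator (cball 0 (m + 1)) x)"
      by (intro integrable_mult_right integrable_real_indicator emeasure_lborel_cball_finite) simp
    show "AE x in lborel. (\<lambda>n. (truncate m f x - truncate m (h n) x)\<^sup>2) \<longlonglongrightarrow> 0"
      using lim
    proof eventually_elim
      case (elim x)
      then have "(\<lambda>n. (truncate m f x - truncate m (h n) x)\<^sup>2) \<longlonglongrightarrow> (truncate m f x - truncate m f x)\<^sup>2"
        unfolding truncate_def by (intro tendsto_intros)
      then show ?case by simp
    qed
    have "(truncate m f x - truncate m (h n) x)\<^sup>2 \<le> (2 * m)\<^sup>2 * indicator (cball 0 (m + 1)) x" for n x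
    proof (cases "norm x \<le> m + 1")
      case True
      have "\<bar>truncate m f x - truncate m (h n) x\<bar> \<le> \<bar>2 * m\<bar>"
        using abs_truncate_le(1)[OF m, of f x] abs_truncate_le(1)[OF m, of "h n" x] m by linarith
      then show ?thesis using True by (simp add: abs_le_square_iff)
    qed (simp add: truncate_eq_0)
    then show "AE x in lborel. norm ((truncate m f x - truncate m (h n) x)\<^sup>2)
        \<le> (2 * m)\<^sup>2 * indicator (cball 0 (m + 1)) x" for n
      by simp
  qed simp_all
  then show ?thesis by simp
qed

lemma mean_square_continuous_approximation:
  fixes f :: "'a::euclidean_space \<Rightarrow> real"
  assumes [measurable]: "f \<in> borel_measurable borel" and f2: "integrable lborel (\<lambda>x. (f x)\<^sup>2)"
    and e: "0 < e"
  obtains g m where "continuous_on UNIV g" "\<And>x. \<bar>g x\<bar> \<le> m" "\<And>x. m + 1 < norm x \<Longrightarrow> g x = 0"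
    "(LINT x|lborel. (f x - g x)\<^sup>2) < e"
proof -
  have "f measurable_on UNIV"
    by (rule lebesgue_measurable_imp_measurable_on) (auto intro: measurable_completion)
  then obtain N h where negligible: "negligible N" and cont: "\<And>n. continuous_on UNIV (h n)"
    and lim: "\<And>x. x \<notin> N \<Longrightarrow> (\<lambda>n. h n x) \<longlonglongrightarrow> f x"
    unfolding measurable_on_def by auto
  have [measurable]: "h n \<in> borel_measurable borel" for n
    using cont by (rule borel_measurable_continuous_onI)
  have "AE x in lebesgue. x \<notin> N" using negligible
    by (intro AE_not_in) (simp add: negligible_iff_null_sets)
  then have lim': "AE x in lborel. (\<lambda>n. h n x) \<longlonglongrightarrow> f x"
    unfolding AE_completion_iff by eventually_elim (rule lim)
  have "\<forall>\<^sub>F m in sequentially. (LINT x|lborel. (f x - truncate (real m) f x)\<^sup>2) < e / 4"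
    using e
    by (intro order_tendstoD(2)[OF integral_square_diff_truncate_tendsto_0[OF _ f2]]) simp_all
  then obtain m where truncation: "(LINT x|lborel. (f x - truncate (real m) f x)\<^sup>2) < e / 4"
    by (auto simp: eventually_sequentially)
  have "\<forall>\<^sub>F n in sequentially.
      (LINT x|lborel. (truncate (real m) f x - truncate (real m) (h n) x)\<^sup>2) < e / 4"
    using e
    by (intro order_tendstoD(2)[OF integral_square_diff_truncate_approx_tendsto_0[OF _ _ lim']])
      simp_all
  then obtain n where approximation:
      "(LINT x|lborel. (truncate (real m) f x - truncate (real m) (h n) x)\<^sup>2) < e / 4"
    by (auto simp: eventually_sequentially)
  have truncate2: "integrable lborel (\<lambda>x. (truncate (real m) u x)\<^sup>2)"
    if [measurable]: "u \<in> borel_measurable borel" for u :: "'a \<Rightarrow> real"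
    by (rule integrable_square_bounded_support[OF _ abs_truncate_le(1) truncate_eq_0]) simp_all
  have "(LINT x|lborel. (f x - truncate (real m) (h n) x)\<^sup>2) < e"
    using integral_square_diff_triangle[OF _ _ _ f2 truncate2 truncate2, of f "h n"] truncation
      approximation by simp
  then show thesis
    using continuous_on_truncate[OF cont] abs_truncate_le(1)[of "real m"] truncate_eq_0[of "real m"]
    by (intro that[of "truncate (real m) (h n)" "real m"]) auto
qed

lemma mean_square_translation_tendsto_0_continuous:
  fixes g :: "'a::euclidean_space \<Rightarrow> real"
  assumes cont: "continuous_on UNIV g" and bounded: "\<And>x. \<bar>g x\<bar> \<le> B"
    and support: "\<And>x. R < norm x \<Longrightarrow> g x = 0" and w: "w \<longlonglongrightarrow> 0"
  shows "(\<lambda>n. LINT x|lborel. (g (w n + x) - g x)\<^sup>2) \<longlonglongrightarrow> 0"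
proof -
  have [measurable]: "g \<in> borel_measurable borel"
    using cont by (rule borel_measurable_continuous_onI)
  obtain K where K: "\<And>n. norm (w n) \<le> K"
    using Bseq_def convergent_imp_Bseq[OF convergentI[OF w]] by metis
  have "(\<lambda>n. LINT x|lborel. (g (w n + x) - g x)\<^sup>2) \<longlonglongrightarrow> (LINT x::'a|lborel. 0)"
  proof (rule integral_dominated_convergence)
    show "integrable lborel (\<lambda>x::'a. (2 * B)\<^sup>2 * indicator (cball 0 (R + K)) x)"
      by (intro integrable_mult_right integrable_real_indicator emeasure_lborel_cball_finite) simp
    have "(\<lambda>n. (g (w n + x) - g x)\<^sup>2) \<longlonglongrightarrow> (g (0 + x) - g x)\<^sup>2" for x
      by (intro tendsto_intros continuous_on_tendsto_compose[OF cont] w) auto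
    then show "AE x in lborel. (\<lambda>n. (g (w n + x) - g x)\<^sup>2) \<longlonglongrightarrow> 0" by simp
    have "(g (w n + x) - g x)\<^sup>2 \<le> (2 * B)\<^sup>2 * indicator (cball 0 (R + K)) x" for n x
    proof (cases "norm x \<le> R + K")
      case True
      have "\<bar>g (w n + x) - g x\<bar> \<le> \<bar>2 * B\<bar>" using bounded[of "w n + x"] bounded[of x] by linarith
      then show ?thesis using True by (simp add: abs_le_square_iff)
    next
      case False
      then have "R < norm x" "R < norm (w n + x)"
        using K[of n] norm_ge_zero[of "w n"] norm_diff_ineq[of x "w n"]
        unfolding add.commute[of "w n"] by linarith+
      then show ?thesis by (simp add: support)
    qed
    then show "AE x in lborel. norm ((g (w n + x) - g x)\<^sup>2)
        \<le> (2 * B)\<^sup>2 * indicator (cball 0 (R + K)) x" for n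
      by simp
  qed simp_all
  then show ?thesis by simp
qed

lemma mean_square_translation_tendsto_0:
  fixes f :: "'a::euclidean_space \<Rightarrow> real"
  assumes [measurable]: "f \<in> borel_measurable borel" and f2: "integrable lborel (\<lambda>x. (f x)\<^sup>2)"
    and w: "w \<longlonglongrightarrow> 0"
  shows "(\<lambda>n. LINT x|lborel. (f (w n + x) - f x)\<^sup>2) \<longlonglongrightarrow> 0"
proof (rule LIMSEQ_I)
  fix e :: real assume e: "0 < e"
  obtain g m where cont: "continuous_on UNIV g" and bounded: "\<And>x. \<bar>g x\<bar> \<le> m"
    and support: "\<And>x. m + 1 < norm x \<Longrightarrow> g x = 0" and approx: "(LINT x|lborel. (f x - g x)\<^sup>2) < e / 10"
    using mean_square_continuous_approximation[OF _ f2, of "e / 10"] e by auto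
  have [measurable]: "g \<in> borel_measurable borel"
    using cont by (rule borel_measurable_continuous_onI)
  have g2: "integrable lborel (\<lambda>x. (g x)\<^sup>2)"
    by (rule integrable_square_bounded_support[OF _ bounded support]) simp_all
  have "\<forall>\<^sub>F n in sequentially. (LINT x|lborel. (g (w n + x) - g x)\<^sup>2) < e / 10"
    using e
    by (intro order_tendstoD(2)[OF
          mean_square_translation_tendsto_0_continuous[OF cont bounded support w]]) auto
  then obtain N where N: "\<And>n. N \<le> n \<Longrightarrow> (LINT x|lborel. (g (w n + x) - g x)\<^sup>2) < e / 10"
    by (auto simp: eventually_sequentially)
  have "(LINT x|lborel. (f (w n + x) - f x)\<^sup>2) < e" if n: "N \<le> n" for n
  proof -
    note translate2 = lborel_integrable_translate[OF f2, of "w n"]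
      lborel_integrable_translate[OF g2, of "w n"]
    have "(LINT x|lborel. (f (w n + x) - f x)\<^sup>2)
        \<le> 2 * (LINT x|lborel. (f (w n + x) - g (w n + x))\<^sup>2)
            + 2 * (LINT x|lborel. (g (w n + x) - f x)\<^sup>2)"
      by (intro integral_square_diff_triangle translate2 f2) simp_all
    moreover have "(LINT x|lborel. (g (w n + x) - f x)\<^sup>2)
        \<le> 2 * (LINT x|lborel. (g (w n + x) - g x)\<^sup>2) + 2 * (LINT x|lborel. (g x - f x)\<^sup>2)"
      by (intro integral_square_diff_triangle translate2 f2 g2) simp_all
    moreover have "(LINT x|lborel. (f (w n + x) - g (w n + x))\<^sup>2) = (LINT x|lborel. (f x - g x)\<^sup>2)"
      by (intro lborel_integral_translate integrable_square_diff f2 g2) simp_all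
    ultimately show ?thesis using approx N[OF n] by (simp add: power2_commute[of "g _" "f _"])
  qed
  then show "\<exists>N. \<forall>n\<ge>N. norm ((LINT x|lborel. (f (w n + x) - f x)\<^sup>2) - 0) < e" by auto
qed

subsection \<open>Autocorrelation\<close>

definition autocorrelation :: "('a::euclidean_space \<Rightarrow> real) \<Rightarrow> 'a \<Rightarrow> real" where
  "autocorrelation f w = (LINT x|lborel. f x * f (w + x))"

lemma borel_measurable_autocorrelation [measurable]:
  assumes [measurable]: "f \<in> borel_measurable borel"
  shows "autocorrelation f \<in> borel_measurable borel"
proof -
  have "(\<lambda>w. LINT x|lborel. f x * f (w + x)) \<in> borel_measurable lborel"
    by (rule lborel.borel_measurable_lebesgue_integral) simp
  then show ?thesis by (simp add: autocorrelation_def[abs_def])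
qed

lemma integrable_mult_translate:
  fixes f :: "'a::euclidean_space \<Rightarrow> real"
  assumes f: "integrable lborel f"
  shows "integrable (lborel \<Otimes>\<^sub>M lborel) (\<lambda>(x, w). f x * f (w + x))"
proof -
  have [measurable]: "f \<in> borel_measurable borel" using borel_measurable_integrable[OF f] by simp
  have translate: "integrable lborel (\<lambda>w. f (w + x))"
    "(LINT w|lborel. \<bar>f (w + x)\<bar>) = (LINT w|lborel. \<bar>f w\<bar>)" for x
    using lborel_integrable_translate[OF f, of x]
      lborel_integral_translate[OF integrable_abs[OF f], of x]
    by (simp_all add: add.commute)
  show ?thesis
    by (rule lborel_pair.Fubini_integrable)
      (auto intro!: integrable_abs f simp: split_beta' abs_mult translate)
qed

lemma integrable_autocorrelation:
  assumes f: "integrable lborel f"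
  shows "integrable lborel (autocorrelation f)"
  using lborel_pair.integrable_snd[OF integrable_mult_translate[OF f]]
  by (simp add: autocorrelation_def[abs_def])

lemma fourier_autocorrelation:
  fixes f :: "'a::euclidean_space \<Rightarrow> real"
  assumes f: "integrable lborel f"
  shows "fourier (autocorrelation f) \<xi> = complex_of_real ((cmod (fourier f \<xi>))\<^sup>2)"
proof -
  have [measurable]: "f \<in> borel_measurable borel" using borel_measurable_integrable[OF f] by simp
  let ?F = "\<lambda>x w. complex_of_real (f x * f (w + x)) * cis (\<xi> \<bullet> w)"
  have int: "integrable (lborel \<Otimes>\<^sub>M lborel) (\<lambda>(x, w). ?F x w)"
    by (rule Bochner_Integration.integrable_bound[OF integrable_mult_translate[OF f]])
      (auto simp: norm_mult)
  have shift: "(LINT w|lborel. complex_of_real (f (w + x)) * cis (\<xi> \<bullet> (w + x))) = fourier f \<xi>" for x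
    using lborel_integral_translate[OF integrable_mult_cis[OF f, of \<xi>], of x]
    by (simp add: fourier_lborel add.commute)
  have "fourier (autocorrelation f) \<xi> = (LINT w|lborel. LINT x|lborel. ?F x w)"
    by (simp add: fourier_lborel autocorrelation_def flip: integral_complex_of_real)
  also have "\<dots> = (LINT x|lborel. LINT w|lborel. ?F x w)"
    by (rule lborel_pair.Fubini_integral[OF int])
  also have "\<dots> = (LINT x|lborel. cnj (complex_of_real (f x) * cis (\<xi> \<bullet> x)) *
      (LINT w|lborel. complex_of_real (f (w + x)) * cis (\<xi> \<bullet> (w + x))))"
  proof -
    have "?F x w = cnj (complex_of_real (f x) * cis (\<xi> \<bullet> x))
        * (complex_of_real (f (w + x)) * cis (\<xi> \<bullet> (w + x)))"
      for x w
      by (simp add: inner_add_right cis_cnj cis_mult mult_ac)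
    then show ?thesis by (simp only: integral_mult_right_zero)
  qed
  also have "\<dots> = cnj (fourier f \<xi>) * fourier f \<xi>"
    by (simp add: shift fourier_lborel flip: Bochner_Integration.integral_cnj)
  finally show ?thesis by (simp add: complex_norm_square mult.commute del: of_real_power)
qed

lemma abs_autocorrelation_le:
  assumes [measurable]: "f \<in> borel_measurable borel" and f2: "integrable lborel (\<lambda>x. (f x)\<^sup>2)"
  shows "\<bar>autocorrelation f w\<bar> \<le> (LINT x|lborel. (f x)\<^sup>2)"
  using Cauchy_Schwarz_integral[OF _ _ f2 lborel_integrable_translate[OF f2, of w]]
    lborel_integral_translate[OF f2, of w]
  by (simp add: autocorrelation_def)

lemma autocorrelation_tendsto:
  fixes f :: "'a::euclidean_space \<Rightarrow> real"
  assumes [measurable]: "f \<in> borel_measurable borel" and f2: "integrable lborel (\<lambda>x. (f x)\<^sup>2)"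
    and w: "w \<longlonglongrightarrow> 0"
  shows "(\<lambda>n. autocorrelation f (w n)) \<longlonglongrightarrow> (LINT x|lborel. (f x)\<^sup>2)"
proof (rule LIM_zero_cancel, rule Lim_null_comparison)
  let ?d = "\<lambda>n x. f (w n + x) - f x"
  have translate: "integrable lborel (\<lambda>x. (f (w n + x))\<^sup>2)" for n
    by (rule lborel_integrable_translate[OF f2])
  have d2: "integrable lborel (\<lambda>x. (?d n x)\<^sup>2)" for n
    by (intro integrable_square_diff f2 translate) simp_all
  have "\<bar>autocorrelation f (w n) - (LINT x|lborel. (f x)\<^sup>2)\<bar>
      \<le> sqrt (LINT x|lborel. (f x)\<^sup>2) * sqrt (LINT x|lborel. (?d n x)\<^sup>2)" for n
  proof -
    have "autocorrelation f (w n) - (LINT x|lborel. (f x)\<^sup>2) = (LINT x|lborel. f x * ?d n x)"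
      using integrable_mult_of_squares[OF _ _ f2 translate] f2
      by (simp add: autocorrelation_def right_diff_distrib power2_eq_square)
    then show ?thesis using Cauchy_Schwarz_integral[OF _ _ f2 d2] by simp
  qed
  then show "\<forall>\<^sub>F n in sequentially. norm (autocorrelation f (w n) - (LINT x|lborel. (f x)\<^sup>2))
      \<le> sqrt (LINT x|lborel. (f x)\<^sup>2) * sqrt (LINT x|lborel. (?d n x)\<^sup>2)" by simp
  show "(\<lambda>n. sqrt (LINT x|lborel. (f x)\<^sup>2) * sqrt (LINT x|lborel. (?d n x)\<^sup>2)) \<longlonglongrightarrow> 0"
    using tendsto_mult_left[OF tendsto_real_sqrt[OF mean_square_translation_tendsto_0[OF _ f2 w]]]
    by simp
qed

text \<open>Plancherel's formula results from rescaling the Gaussian: the weight tends to \<open>1\<close> on the left,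
  and on the right the autocorrelation is continuous at \<open>0\<close> with value \<open>\<integral> f\<^sup>2\<close>.\<close>

lemma gauss_weighted_energy:
  fixes f :: "'a::euclidean_space \<Rightarrow> real"
  assumes f: "integrable lborel f" and s: "s > 0"
  shows "(LINT \<xi>|lborel. gauss (s *\<^sub>R \<xi>) * (cmod (fourier f \<xi>))\<^sup>2)
    = sqrt (2 * pi) ^ DIM('a) * (LINT z|lborel. autocorrelation f (s *\<^sub>R z) * gauss z)"
proof -
  have [measurable]: "f \<in> borel_measurable borel" using borel_measurable_integrable[OF f] by simp
  note R = integrable_autocorrelation[OF f]
  have "complex_of_real (LINT \<xi>|lborel. gauss (s *\<^sub>R \<xi>) * (cmod (fourier f \<xi>))\<^sup>2)
      = (LINT \<xi>|lborel. complex_of_real (gauss (s *\<^sub>R \<xi>)) * fourier (autocorrelation f) \<xi>)"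
    unfolding fourier_autocorrelation[OF f] by (simp flip: integral_complex_of_real)
  also have "\<dots>
      = (LINT x|lborel. complex_of_real (autocorrelation f x) * fourier (\<lambda>\<xi>. gauss (s *\<^sub>R \<xi>)) x)"
    using s by (intro fourier_multiplication_formula R integrable_gauss_scaleR) simp
  also have "\<dots> = complex_of_real (sqrt (2 * pi) ^ DIM('a) / s ^ DIM('a) *
      (LINT x|lborel. autocorrelation f x * gauss (x /\<^sub>R s)))"
  proof -
    have "fourier (\<lambda>\<xi>. gauss (s *\<^sub>R \<xi>)) x
        = complex_of_real (sqrt (2 * pi) ^ DIM('a) / s ^ DIM('a) * gauss (x /\<^sub>R s))"
      for x :: 'a
      unfolding fourier_scaleR[OF integrable_gauss s] fourier_gauss
      by (simp add: scaleR_conv_of_real divide_inverse)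
    then show ?thesis
      unfolding integral_complex_of_real[symmetric] integral_mult_right_zero[symmetric]
      by (simp only: of_real_mult[symmetric] mult_ac)
  qed
  also have "(LINT x|lborel. autocorrelation f x * gauss (x /\<^sub>R s))
      = s ^ DIM('a) * (LINT z|lborel. autocorrelation f (s *\<^sub>R z) * gauss z)"
  proof -
    have "integrable lborel (\<lambda>x. autocorrelation f x * gauss (x /\<^sub>R s))"
      by (rule Bochner_Integration.integrable_bound[OF R])
         (use gauss_mono[of 0] in \<open>auto simp: abs_mult intro!: AE_I2 mult_left_le\<close>)
    from lborel_integral_affine[OF _ this, of s 0] show ?thesis using s by simp
  qed
  finally show ?thesis unfolding of_real_eq_iff using s by simp
qed

lemma gauss_weighted_energy_tendsto:
  fixes f :: "'a::euclidean_space \<Rightarrow> real"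
  assumes f: "integrable lborel f" and f2: "integrable lborel (\<lambda>x. (f x)\<^sup>2)"
    and s: "\<And>n. 0 < s n" "s \<longlonglongrightarrow> 0"
  shows "(\<lambda>n. LINT \<xi>|lborel. gauss (s n *\<^sub>R \<xi>) * (cmod (fourier f \<xi>))\<^sup>2)
    \<longlonglongrightarrow> (2 * pi) ^ DIM('a) * (LINT x|lborel. (f x)\<^sup>2)"
proof -
  have [measurable]: "f \<in> borel_measurable borel" using borel_measurable_integrable[OF f] by simp
  let ?E = "LINT x|lborel. (f x)\<^sup>2"
  have "(\<lambda>n. LINT z|lborel. autocorrelation f (s n *\<^sub>R z) * gauss z)
      \<longlonglongrightarrow> (LINT z::'a|lborel. ?E * gauss z)"
  proof (rule integral_dominated_convergence)
    show "integrable lborel (\<lambda>z::'a. ?E * gauss z)"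
      by (intro integrable_mult_right integrable_gauss)
    have "(\<lambda>n. s n *\<^sub>R z) \<longlonglongrightarrow> 0" for z :: 'a using tendsto_scaleR[OF s(2) tendsto_const] by simp
    then show "AE z in lborel. (\<lambda>n. autocorrelation f (s n *\<^sub>R z) * gauss z) \<longlonglongrightarrow> ?E * gauss z"
      by (intro AE_I2 tendsto_mult_right autocorrelation_tendsto[OF _ f2]) simp_all
    show "AE z in lborel. norm (autocorrelation f (s n *\<^sub>R z) * gauss z) \<le> ?E * gauss z" for n
      by (simp add: abs_mult mult_right_mono abs_autocorrelation_le[OF _ f2])
  qed simp_all
  then have "(\<lambda>n. LINT \<xi>|lborel. gauss (s n *\<^sub>R \<xi>) * (cmod (fourier f \<xi>))\<^sup>2)
      \<longlonglongrightarrow> sqrt (2 * pi) ^ DIM('a) * (?E * sqrt (2 * pi) ^ DIM('a))"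
    unfolding gauss_weighted_energy[OF f s(1)]
    by (intro tendsto_mult_left) (simp add: integral_gauss)
  also have "sqrt (2 * pi) ^ DIM('a) * (?E * sqrt (2 * pi) ^ DIM('a))
      = (sqrt (2 * pi) * sqrt (2 * pi)) ^ DIM('a) * ?E"
    unfolding power_mult_distrib by (simp only: mult_ac)
  also have "sqrt (2 * pi) * sqrt (2 * pi) = 2 * pi" by simp
  finally show ?thesis .
qed

lemma
  fixes f :: "'a::euclidean_space \<Rightarrow> real"
  assumes f: "integrable lborel f" and f2: "integrable lborel (\<lambda>x. (f x)\<^sup>2)"
  shows plancherel_lborel_integrable: "integrable lborel (\<lambda>\<xi>. (cmod (fourier f \<xi>))\<^sup>2)"
    and plancherel_lborel: "(LINT \<xi>|lborel. (cmod (fourier f \<xi>))\<^sup>2)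
        = (2 * pi) ^ DIM('a) * (LINT x|lborel. (f x)\<^sup>2)"
proof -
  have [measurable]: "f \<in> borel_measurable borel" using borel_measurable_integrable[OF f] by simp
  define s where "s n = 1 / real (Suc n)" for n
  have s: "0 < s n" for n by (simp add: s_def)
  have s_antimono: "s n \<le> s m" if "m \<le> n" for m n using that by (simp add: s_def frac_le)
  have s_lim: "s \<longlonglongrightarrow> 0" unfolding s_def by (rule LIMSEQ_Suc[OF lim_1_over_n])
  let ?W = "\<lambda>n \<xi>. gauss (s n *\<^sub>R \<xi>) * (cmod (fourier f \<xi>))\<^sup>2"
  have int: "integrable lborel (?W n)" for n
  proof (rule Bochner_Integration.integrable_bound)
    show "integrable lborel (\<lambda>\<xi>::'a. gauss (s n *\<^sub>R \<xi>) * (LINT x|lborel. \<bar>f x\<bar>)\<^sup>2)"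
      using s[of n] by (intro integrable_mult_left integrable_gauss_scaleR) simp
    show "AE \<xi> in lborel. norm (?W n \<xi>) \<le> norm (gauss (s n *\<^sub>R \<xi>) * (LINT x|lborel. \<bar>f x\<bar>)\<^sup>2)"
      by (intro AE_I2) (simp add: abs_mult mult_left_mono power_mono norm_fourier_le)
  qed simp
  have mono: "mono (\<lambda>n. ?W n \<xi>)" for \<xi>
    using s s_antimono
    by (intro monoI mult_right_mono gauss_mono) (simp_all add: less_imp_le mult_right_mono)
  have lim: "(\<lambda>n. ?W n \<xi>) \<longlonglongrightarrow> (cmod (fourier f \<xi>))\<^sup>2" for \<xi>
  proof -
    have "(\<lambda>n. ?W n \<xi>) \<longlonglongrightarrow> exp (- ((norm (0 *\<^sub>R \<xi>))\<^sup>2 / 2)) * (cmod (fourier f \<xi>))\<^sup>2"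
      unfolding gauss_def by (intro tendsto_intros s_lim) simp
    then show ?thesis by simp
  qed
  note convergence = int AE_I2[OF mono] AE_I2[OF lim] gauss_weighted_energy_tendsto[OF f f2 s s_lim]
  show "integrable lborel (\<lambda>\<xi>. (cmod (fourier f \<xi>))\<^sup>2)"
    by (rule integrable_monotone_convergence[OF convergence]) simp
  show "(LINT \<xi>|lborel. (cmod (fourier f \<xi>))\<^sup>2) = (2 * pi) ^ DIM('a) * (LINT x|lborel. (f x)\<^sup>2)"
    by (rule integral_monotone_convergence[OF convergence]) simp
qed

theorem
  fixes f :: "'a::euclidean_space \<Rightarrow> real"
  assumes f: "integrable lebesgue f" and f2: "integrable lebesgue (\<lambda>x. (f x)\<^sup>2)"
  shows plancherel_integrable: "integrable lborel (\<lambda>\<xi>. (cmod (fourier f \<xi>))\<^sup>2)"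
    and plancherel: "(LINT \<xi>|lborel. (cmod (fourier f \<xi>))\<^sup>2)
        = (2 * pi) ^ DIM('a) * (LINT x|lebesgue. (f x)\<^sup>2)"
proof -
  obtain f' where [measurable]: "f' \<in> borel_measurable borel" and ae: "AE x in lborel. f x = f' x"
    using completion_ex_borel_measurable_real[OF borel_measurable_integrable[OF f]] by auto
  note [measurable] = borel_measurable_integrable[OF f]
  have meas: "f' \<in> borel_measurable lebesgue" by (intro measurable_completion) simp
  have meas_cis: "(\<lambda>x. cis (\<xi> \<bullet> x)) \<in> borel_measurable lebesgue" for \<xi> :: 'a
    by (intro measurable_completion) simp
  have ae': "AE x in lebesgue. f x = f' x" by (rule AE_completion[OF ae])
  have "integrable lebesgue f'" "integrable lebesgue (\<lambda>x. (f' x)\<^sup>2)"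
    using f f2 ae' meas by (auto intro: integrable_cong_AE_imp)
  then have f': "integrable lborel f'" "integrable lborel (\<lambda>x. (f' x)\<^sup>2)"
    by (simp_all add: integrable_completion)
  have "fourier f \<xi> = fourier f' \<xi>" for \<xi>
    unfolding fourier_def using ae' meas meas_cis by (intro integral_cong_AE) auto
  moreover have "(LINT x|lebesgue. (f x)\<^sup>2) = (LINT x|lborel. (f' x)\<^sup>2)"
    using ae' meas by (subst integral_completion[symmetric]) (auto intro!: integral_cong_AE)
  ultimately show "integrable lborel (\<lambda>\<xi>. (cmod (fourier f \<xi>))\<^sup>2)"
    "(LINT \<xi>|lborel. (cmod (fourier f \<xi>))\<^sup>2) = (2 * pi) ^ DIM('a) * (LINT x|lebesgue. (f x)\<^sup>2)"
    using plancherel_lborel_integrable[OF f'] plancherel_lborel[OF f'] by simp_all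
qed

section \<open>Exponential weights on thin domains\<close>

lemma orthonormal_complement:
  fixes p :: "real^3"
  obtains e f where "norm e = 1" "norm f = 1" "e \<bullet> f = 0" "p \<bullet> e = 0" "p \<bullet> f = 0"
proof -
  have unit: "\<exists>u. norm u = 1 \<and> p \<bullet> u = 0 \<and> q \<bullet> u = 0" for q :: "real^3"
  proof -
    have "dim {p, q} \<le> card {p, q}" by (rule dim_le_card[OF span_superset]) simp
    also have "\<dots> \<le> 2" by (simp add: card_insert_if)
    finally have "dim {p, q} < DIM(real^3)" by simp
    then obtain x where "x \<noteq> 0" and x: "\<And>y. y \<in> span {p, q} \<Longrightarrow> orthogonal x y"
      using orthogonal_to_subspace_exists[of "{p, q}"] by auto
    then have "norm (x /\<^sub>R norm x) = 1" by simp
    moreover have "p \<bullet> x = 0" "q \<bullet> x = 0"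
      using x[of p] x[of q] by (auto simp: orthogonal_def span_base inner_commute)
    ultimately show ?thesis by (intro exI[of _ "x /\<^sub>R norm x"]) simp
  qed
  obtain e where e: "norm e = 1" "p \<bullet> e = 0" using unit[of 0] by blast
  obtain f where "norm f = 1" "p \<bullet> f = 0" "e \<bullet> f = 0" using unit[of e] by blast
  with e that show thesis by blast
qed

lemma lborel_distr_orthogonal:
  fixes Q :: "real^'n::{finite,wellorder} \<Rightarrow> real^'n::_"
  assumes Q: "orthogonal_transformation Q"
  shows "distr lborel borel Q = lborel"
proof (rule lborel_eqI[symmetric])
  obtain P where inverse: "orthogonal_transformation P" "\<And>x. P (Q x) = x" "\<And>x. Q (P x) = x"
    using orthogonal_transformation_inv[OF Q] orthogonal_transformation_bij[OF Q]
    by (metis bij_inv_eq_iff)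
  have [measurable]: "Q \<in> borel_measurable borel"
    by (intro borel_measurable_continuous_onI linear_continuous_on
        linear_conv_bounded_linear[THEN iffD1] orthogonal_transformation_linear Q)
  fix l u :: "real^'n::_" assume le: "\<And>b. b \<in> Basis \<Longrightarrow> l \<bullet> b \<le> u \<bullet> b"
  have "Q -` box l u = P ` box l u" by (auto simp: inverse(3)) (metis inverse(2) imageI)
  moreover have "measure lebesgue (P ` box l u) = measure lebesgue (box l u)"
    by (rule measure_orthogonal_image[OF inverse(1)]) simp
  moreover have "P ` box l u \<in> lmeasurable"
    by (rule measurable_orthogonal_image[OF inverse(1)]) simp
  ultimately have "emeasure lebesgue (Q -` box l u) = emeasure lebesgue (box l u)"
    by (metis emeasure_eq_ennreal_measure fmeasurableD2 lmeasurable_box infinity_ennreal_def)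
  moreover have "Q -` box l u \<in> sets borel"
    using measurable_sets[OF \<open>Q \<in> borel_measurable borel\<close>, of "box l u"] by simp
  ultimately have "emeasure lborel (Q -` box l u) = emeasure lborel (box l u)" by simp
  then show "emeasure (distr lborel borel Q) (box l u) = ennreal (\<Prod>b\<in>Basis. (u - l) \<bullet> b)"
    using le by (simp add: emeasure_distr)
qed simp

lemma prod_Basis_cart: "(\<Prod>b\<in>(Basis :: (real^'n) set). f b) = (\<Prod>i\<in>UNIV. f (axis i 1))"
proof -
  have B: "(Basis :: (real^'n) set) = range (\<lambda>i. axis i 1)" by (auto simp: Basis_vec_def)
  have inj: "inj (\<lambda>i::'n. axis i (1::real))" by (auto simp: inj_def axis_eq_axis)
  show ?thesis unfolding B by (subst prod.reindex[OF inj]) simp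
qed

lemma emeasure_lborel_box_cart:
  fixes l u :: "real^'n"
  assumes "\<And>i. l $ i \<le> u $ i"
  shows "emeasure lborel (box l u) = ennreal (\<Prod>i\<in>UNIV. u $ i - l $ i)"
proof -
  have "l \<bullet> b \<le> u \<bullet> b" if "b \<in> Basis" for b
    using that assms by (auto simp: Basis_vec_def inner_axis)
  then show ?thesis by (simp add: prod_Basis_cart inner_axis)
qed

definition append_coord :: "(real^2) \<times> real \<Rightarrow> real^3" where
  "append_coord z = vector [fst z $ 1, fst z $ 2, snd z]"

lemma append_coord_nth [simp]:
  "append_coord z $ 1 = fst z $ 1" "append_coord z $ 2 = fst z $ 2" "append_coord z $ 3 = snd z"
  by (simp_all add: append_coord_def)

lemma borel_measurable_append_coord [measurable]: "append_coord \<in> borel_measurable borel"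
proof -
  have "continuous_on UNIV (\<lambda>z. append_coord z $ i)" for i
    using exhaust_3[of i] by (elim disjE; simp; intro continuous_intros)
  then have "continuous_on UNIV (\<lambda>z. \<chi> i. append_coord z $ i)"
    by (intro continuous_on_vec_lambda)
  then show ?thesis by (intro borel_measurable_continuous_onI) simp
qed

lemma lborel_distr_append_coord: "distr lborel borel append_coord = lborel"
proof (rule lborel_eqI[symmetric])
  fix l u :: "real^3" assume le_Basis: "\<And>b. b \<in> Basis \<Longrightarrow> l \<bullet> b \<le> u \<bullet> b"
  have le: "l $ i \<le> u $ i" for i
    using le_Basis[of "axis i 1"] by (simp add: inner_axis)
  let ?l = "vector [l$1, l$2] :: real^2" and ?u = "vector [u$1, u$2] :: real^2"
  have "append_coord -` box l u = box ?l ?u \<times> {l$3<..<u$3}"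
    by (auto simp: mem_box_cart forall_3 forall_2)
  then have "emeasure lborel (append_coord -` box l u)
      = emeasure (lborel \<Otimes>\<^sub>M lborel) (box ?l ?u \<times> {l$3<..<u$3})"
    by (simp only: lborel_prod)
  also have "\<dots> = emeasure lborel (box ?l ?u) * emeasure lborel {l$3<..<u$3}"
    by (rule lborel.emeasure_pair_measure_Times) auto
  also have "emeasure lborel (box ?l ?u) = ennreal ((u$1 - l$1) * (u$2 - l$2))"
  proof -
    have "?l $ i \<le> ?u $ i" for i using le exhaust_2[of i] by auto
    then show ?thesis by (subst emeasure_lborel_box_cart) (simp_all only: UNIV_2, simp)
  qed
  finally have "emeasure lborel (append_coord -` box l u)
      = ennreal ((u$1 - l$1) * (u$2 - l$2) * (u$3 - l$3))"
    using le by (simp add: ennreal_mult[symmetric])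
  moreover have "(\<Prod>b\<in>Basis. (u - l) \<bullet> b) = (u$1 - l$1) * (u$2 - l$2) * (u$3 - l$3)"
    unfolding prod_Basis_cart UNIV_3 by (simp add: inner_axis)
  ultimately show "emeasure (distr lborel borel append_coord) (box l u)
      = ennreal (\<Prod>b\<in>Basis. (u - l) \<bullet> b)"
    by (simp add: emeasure_distr)
qed simp

lemma nn_integral_orthonormal_frame:
  fixes u w e :: "real^3"
  assumes unit: "norm u = 1" "norm w = 1" "norm e = 1" and orth: "u \<bullet> w = 0" "e \<bullet> u = 0" "e \<bullet> w = 0"
    and [measurable]: "G \<in> borel_measurable borel"
  shows "(\<integral>\<^sup>+x. G x \<partial>lborel)
    = (\<integral>\<^sup>+t. \<integral>\<^sup>+y. G (y $ 1 *\<^sub>R u + y $ 2 *\<^sub>R w + t *\<^sub>R e) \<partial>(lborel :: (real^2) measure) \<partial>lborel)"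
proof -
  define Q where "Q v = v $ 1 *\<^sub>R u + v $ 2 *\<^sub>R w + v $ 3 *\<^sub>R e" for v :: "real^3"
  have "linear Q" unfolding Q_def by (rule linearI) (simp_all add: algebra_simps)
  moreover have "Q v \<bullet> Q v' = v \<bullet> v'" for v v'
  proof -
    have "u \<bullet> u = 1" "w \<bullet> w = 1" "e \<bullet> e = 1" "w \<bullet> u = 0" "u \<bullet> e = 0" "w \<bullet> e = 0"
      using unit orth by (simp_all add: norm_eq_1 inner_commute)
    then show ?thesis
      by (simp add: Q_def inner_add_left inner_add_right orth inner_vec_def[of v] sum_3)
  qed
  ultimately have Q: "orthogonal_transformation Q" by (simp add: orthogonal_transformation_def)
  have [measurable]: "Q \<in> borel_measurable borel"
    unfolding Q_def by (intro borel_measurable_continuous_onI continuous_intros)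
  have "(\<integral>\<^sup>+x. G x \<partial>lborel) = (\<integral>\<^sup>+x. G x \<partial>distr (distr lborel borel append_coord) borel Q)"
    by (simp add: lborel_distr_append_coord lborel_distr_orthogonal[OF Q])
  also have "\<dots> = (\<integral>\<^sup>+z. G (Q (append_coord z)) \<partial>(lborel \<Otimes>\<^sub>M lborel))"
    unfolding lborel_prod by (simp add: nn_integral_distr)
  also have "\<dots> = (\<integral>\<^sup>+t. \<integral>\<^sup>+y. G (Q (append_coord (y, t))) \<partial>lborel \<partial>lborel)"
    by (rule lborel_pair.nn_integral_snd[symmetric]) (unfold lborel_prod, measurable)
  finally show ?thesis by (simp add: Q_def)
qed

lemma lmeasurable_plane_projection:
  fixes \<Omega> :: "(real^3) set"
  assumes \<Omega>: "open \<Omega>" "bounded \<Omega>" and uw: "norm u = 1" "norm w = 1" "u \<bullet> w = 0"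
  shows "(\<lambda>x. vector [x \<bullet> u, x \<bullet> w] :: real^2) ` \<Omega> \<in> lmeasurable"
proof -
  let ?p = "\<lambda>x. vector [x \<bullet> u, x \<bullet> w] :: real^2"
  have lin: "linear ?p"
    by (rule linearI) (simp_all add: vec_eq_iff forall_2 inner_add_left)
  have "?p (y$1 *\<^sub>R u + y$2 *\<^sub>R w) = y" for y
    using uw by (simp add: vec_eq_iff forall_2 inner_add_left inner_commute[of w u] norm_eq_1)
  then have "surj ?p" by (rule surjI)
  then have "open (?p ` \<Omega>)" by (rule open_surjective_linear_image[OF \<Omega>(1) lin])
  moreover have "bounded (?p ` \<Omega>)"
    by (rule bounded_linear_image[OF \<Omega>(2) linear_conv_bounded_linear[THEN iffD1, OF lin]])
  ultimately show ?thesis by (simp add: lmeasurable_open)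
qed

lemma measure_plane_projection_le_Vol2:
  fixes \<Omega> :: "(real^3) set"
  assumes \<Omega>: "open \<Omega>" "bounded \<Omega>" and uw: "norm u = 1" "norm w = 1" "u \<bullet> w = 0"
  shows "measure lebesgue ((\<lambda>x. vector [x \<bullet> u, x \<bullet> w] :: real^2) ` \<Omega>) \<le> Vol2 \<Omega>"
  unfolding Vol2_def
proof (rule cSup_upper)
  let ?p = "\<lambda>u w x. vector [x \<bullet> u, x \<bullet> w] :: real^2"
  obtain R where norm_le: "\<And>x. x \<in> \<Omega> \<Longrightarrow> norm x \<le> R" using \<Omega>(2) bounded_iff by blast
  have projection_subset: "?p u w ` \<Omega> \<subseteq> cball 0 (2 * R)"
    if "norm u = 1" "norm w = 1" for u w :: "real^3"
  proof clarsimp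
    fix x assume x: "x \<in> \<Omega>"
    have "norm (?p u w x) \<le> (\<Sum>i\<in>UNIV. \<bar>?p u w x $ i\<bar>)" by (rule norm_le_l1_cart)
    also have "\<dots> = \<bar>x \<bullet> u\<bar> + \<bar>x \<bullet> w\<bar>" by (simp add: sum_2)
    also have "\<dots> \<le> norm x * norm u + norm x * norm w"
      by (intro add_mono Cauchy_Schwarz_ineq2)
    finally show "norm (?p u w x) \<le> 2 * R" using norm_le[OF x] that by simp
  qed
  show "bdd_above {measure lebesgue (?p u w ` \<Omega>) |u w. norm u = 1 \<and> norm w = 1 \<and> u \<bullet> w = 0}"
  proof (rule bdd_aboveI, clarify)
    fix u w :: "real^3" assume uw: "norm u = 1" "norm w = 1" "u \<bullet> w = 0"
    show "measure lebesgue (?p u w ` \<Omega>) \<le> measure lebesgue (cball (0::real^2) (2 * R))"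
      by (intro measure_mono_fmeasurable projection_subset uw fmeasurableD
        lmeasurable_plane_projection \<Omega>) simp
  qed
qed (use uw in blast)

lemma Vol2_nonneg:
  assumes "open \<Omega>" "bounded \<Omega>"
  shows "0 \<le> Vol2 \<Omega>"
proof -
  have "norm (axis 1 1 :: real^3) = 1" "norm (axis 2 1 :: real^3) = 1"
    "(axis 1 1 :: real^3) \<bullet> axis 2 1 = 0" by (simp_all add: inner_axis_axis)
  from measure_plane_projection_le_Vol2[OF assms this] show ?thesis
    by (rule order_trans[OF measure_nonneg])
qed

lemma nn_integral_slice_le_Vol2:
  fixes u w e :: "real^3"
  assumes \<Omega>: "open \<Omega>" "bounded \<Omega>"
    and unit: "norm u = 1" "norm w = 1" and orth: "u \<bullet> w = 0" "e \<bullet> u = 0" "e \<bullet> w = 0"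
  shows "(\<integral>\<^sup>+y. indicator \<Omega> (y $ 1 *\<^sub>R u + y $ 2 *\<^sub>R w + t *\<^sub>R e) \<partial>(lborel :: (real^2) measure))
      \<le> ennreal (Vol2 \<Omega>)"
proof -
  let ?p = "\<lambda>x. vector [x \<bullet> u, x \<bullet> w] :: real^2"
  have proj: "?p (y $ 1 *\<^sub>R u + y $ 2 *\<^sub>R w + t *\<^sub>R e) = y" for y
    using unit orth
    by (simp add: vec_eq_iff forall_2 inner_add_left inner_commute[of w u] norm_eq_1)
  have in_image: "y \<in> ?p ` \<Omega>" if "y $ 1 *\<^sub>R u + y $ 2 *\<^sub>R w + t *\<^sub>R e \<in> \<Omega>" for y
    using imageI[OF that, of ?p] by (simp only: proj)
  have meas: "?p ` \<Omega> \<in> lmeasurable" by (rule lmeasurable_plane_projection[OF \<Omega> unit orth(1)])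
  have "(\<integral>\<^sup>+y. indicator \<Omega> (y $ 1 *\<^sub>R u + y $ 2 *\<^sub>R w + t *\<^sub>R e) \<partial>(lborel :: (real^2) measure))
      \<le> (\<integral>\<^sup>+y. indicator (?p ` \<Omega>) y \<partial>lebesgue)"
    unfolding nn_integral_completion
    by (intro nn_integral_mono) (simp add: indicator_def in_image)
  also have "\<dots> = ennreal (measure lebesgue (?p ` \<Omega>))"
    using meas by (simp add: fmeasurableD emeasure_eq_measure2)
  also have "\<dots> \<le> ennreal (Vol2 \<Omega>)"
    by (intro ennreal_leI measure_plane_projection_le_Vol2 \<Omega> unit orth)
  finally show ?thesis .
qed

lemma nn_integral_inner_le_Vol2:
  fixes \<Omega> :: "(real^3) set" and e :: "real^3"
  assumes \<Omega>: "open \<Omega>" "bounded \<Omega>" and e: "norm e = 1"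
    and slab: "\<And>x. x \<in> \<Omega> \<Longrightarrow> e \<bullet> x \<in> S" and [measurable]: "F \<in> borel_measurable borel"
      "S \<in> sets borel"
  shows "(\<integral>\<^sup>+x. F (e \<bullet> x) * indicator \<Omega> x \<partial>lborel)
      \<le> (\<integral>\<^sup>+t. F t * indicator S t \<partial>lborel) * ennreal (Vol2 \<Omega>)"
proof -
  have [measurable]: "\<Omega> \<in> sets borel" using \<Omega>(1) by simp
  obtain u w where unit: "norm u = 1" "norm w = 1" and orth: "u \<bullet> w = 0" "e \<bullet> u = 0" "e \<bullet> w = 0"
    by (rule orthonormal_complement)
  let ?x = "\<lambda>t y. y $ 1 *\<^sub>R u + (y :: real^2) $ 2 *\<^sub>R w + t *\<^sub>R e"
  have inner: "e \<bullet> ?x t y = t" for t y using e orth by (simp add: inner_add_right norm_eq_1)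
  have in_S: "t \<in> S" if "?x t y \<in> \<Omega>" for t y using slab[OF that] by (simp only: inner)
  have [measurable]: "(\<lambda>y. ?x t y) \<in> borel_measurable borel" for t
    by (intro borel_measurable_continuous_onI continuous_intros)
  have "(\<integral>\<^sup>+x. F (e \<bullet> x) * indicator \<Omega> x \<partial>lborel)
      = (\<integral>\<^sup>+t. \<integral>\<^sup>+y. F t * indicator \<Omega> (?x t y) \<partial>lborel \<partial>lborel)"
    by (subst nn_integral_orthonormal_frame[OF unit e orth]) (simp_all only: inner, measurable)
  also have "\<dots> = (\<integral>\<^sup>+t. \<integral>\<^sup>+y. (F t * indicator S t) * indicator \<Omega> (?x t y) \<partial>lborel \<partial>lborel)"
    by (intro nn_integral_cong) (simp add: indicator_def in_S)
  also have "\<dots> = (\<integral>\<^sup>+t. (F t * indicator S t) * (\<integral>\<^sup>+y. indicator \<Omega> (?x t y) \<partial>lborel) \<partial>lborel)"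
    by (subst nn_integral_cmult) simp_all
  also have "\<dots> \<le> (\<integral>\<^sup>+t. (F t * indicator S t) * ennreal (Vol2 \<Omega>) \<partial>lborel)"
    by (intro nn_integral_mono mult_left_mono nn_integral_slice_le_Vol2 \<Omega> unit orth) simp
  also have "\<dots> = (\<integral>\<^sup>+t. F t * indicator S t \<partial>lborel) * ennreal (Vol2 \<Omega>)"
    by (rule nn_integral_multc) simp
  finally show ?thesis .
qed

lemma borel_measurable_lebesgue_on:
  "f \<in> borel_measurable borel \<Longrightarrow> f \<in> borel_measurable (lebesgue_on \<Omega>)"
  by (intro measurable_restrict_space1 measurable_completion) simp

lemma integral_exp_inner_le:
  fixes \<Omega> :: "(real^3) set" and e :: "real^3"
  assumes \<Omega>: "open \<Omega>" "bounded \<Omega>" and e: "norm e = 1" and c: "c \<noteq> 0" and h: "0 \<le> h"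
    and slab: "\<And>x. x \<in> \<Omega> \<Longrightarrow> \<bar>e \<bullet> x - m\<bar> \<le> h"
  shows "(LINT x|lebesgue_on \<Omega>. exp (c * (e \<bullet> x))) \<le> Vol2 \<Omega> * (2 * exp (c * m) * sinh (c * h) / c)"
proof -
  have Vol2: "0 \<le> Vol2 \<Omega>" by (rule Vol2_nonneg[OF \<Omega>])
  let ?I = "exp (c * (m + h)) / c - exp (c * (m - h)) / c"
  have slab': "e \<bullet> x \<in> {m - h..m + h}" if "x \<in> \<Omega>" for x using slab[OF that]
    by (auto simp: abs_le_iff)
  have exp_integral: "(\<integral>\<^sup>+t. ennreal (exp (c * t)) * indicator {m - h..m + h} t \<partial>lborel)
      = ennreal ?I"
    by (rule nn_integral_FTC_Icc) (use c h in \<open>auto intro!: derivative_eq_intros\<close>)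
  have exp_integral_nonneg: "0 \<le> ?I"
  proof (cases "0 < c")
    case True
    then show ?thesis using h by (simp add: divide_right_mono mult_left_mono)
  next
    case False
    then show ?thesis using h c by (simp add: divide_right_mono_neg mult_left_mono_neg)
  qed
  have "(\<integral>\<^sup>+x. ennreal (exp (c * (e \<bullet> x))) \<partial>lebesgue_on \<Omega>)
     = (\<integral>\<^sup>+x. ennreal (exp (c * (e \<bullet> x))) * indicator \<Omega> x \<partial>lborel)"
    using \<Omega>(1) by (simp add: nn_integral_restrict_space nn_integral_completion)
  also have "\<dots> \<le> ennreal ?I * ennreal (Vol2 \<Omega>)"
    unfolding exp_integral[symmetric]
    by (rule nn_integral_inner_le_Vol2[OF \<Omega> e slab', where F = "\<lambda>t. ennreal (exp (c * t))"]) auto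
  finally have "(\<integral>\<^sup>+x. ennreal (exp (c * (e \<bullet> x))) \<partial>lebesgue_on \<Omega>) \<le> ennreal (Vol2 \<Omega> * ?I)"
    by (simp only: ennreal_mult'[OF Vol2] mult.commute)
  moreover have "(LINT x|lebesgue_on \<Omega>. exp (c * (e \<bullet> x)))
      = enn2real (\<integral>\<^sup>+x. ennreal (exp (c * (e \<bullet> x))) \<partial>lebesgue_on \<Omega>)"
    by (rule integral_eq_nn_integral) (auto intro!: borel_measurable_lebesgue_on)
  ultimately have "(LINT x|lebesgue_on \<Omega>. exp (c * (e \<bullet> x))) \<le> Vol2 \<Omega> * ?I"
    using mult_nonneg_nonneg[OF Vol2 exp_integral_nonneg] by (simp only: enn2real_leI)
  also have "?I = 2 * exp (c * m) * sinh (c * h) / c"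
    by (simp add: sinh_def algebra_simps mult_exp_exp diff_divide_distrib)
  finally show ?thesis .
qed

lemma bounded_subset_slab:
  fixes e :: "'a::euclidean_space"
  assumes \<Omega>: "bounded \<Omega>" and e: "norm e = 1"
  obtains m where "\<And>x. x \<in> \<Omega> \<Longrightarrow> \<bar>e \<bullet> x - m\<bar> \<le> diameter \<Omega> / 2"
proof (cases "\<Omega> = {}")
  case False
  let ?S = "(\<lambda>x. e \<bullet> x) ` \<Omega>"
  have diff: "e \<bullet> x - e \<bullet> y \<le> diameter \<Omega>" if "x \<in> \<Omega>" "y \<in> \<Omega>" for x y
    using Cauchy_Schwarz_ineq2[of e "x - y"] diameter_bounded_bound[OF \<Omega> that] e
    by (simp add: inner_diff_right dist_norm)
  have "bounded ?S" using \<Omega> by (intro bounded_linear_image bounded_linear_inner_right)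
  then have bdd: "bdd_below ?S" "bdd_above ?S"
    by (simp_all add: bounded_imp_bdd_below bounded_imp_bdd_above)
  have le: "Inf ?S \<le> e \<bullet> x" "e \<bullet> x \<le> Sup ?S" if "x \<in> \<Omega>" for x
    using that bdd by (auto intro: cInf_lower cSup_upper)
  have "Sup ?S \<le> Inf ?S + diameter \<Omega>"
  proof (rule cSup_least, use False in blast, clarify)
    fix x assume x: "x \<in> \<Omega>"
    have "e \<bullet> x - diameter \<Omega> \<le> Inf ?S"
      using False diff[OF x] by (intro cInf_greatest) (auto simp: algebra_simps)
    then show "e \<bullet> x \<le> Inf ?S + diameter \<Omega>" by simp
  qed
  then have "\<bar>e \<bullet> x - (Inf ?S + Sup ?S) / 2\<bar> \<le> diameter \<Omega> / 2" if "x \<in> \<Omega>" for x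
    using le[OF that] by (simp add: abs_le_iff field_simps)
  then show thesis by (rule that)
qed (use that in auto)

lemma integral_exp_inner_product_le:
  fixes \<Omega> :: "(real^3) set" and e :: "real^3"
  assumes \<Omega>: "open \<Omega>" "bounded \<Omega>" and e: "norm e = 1" and t: "0 < t"
  shows "(LINT x|lebesgue_on \<Omega>. exp (- 2 * t * (e \<bullet> x)))
      * (LINT x|lebesgue_on \<Omega>. exp (2 * t * (e \<bullet> x)))
    \<le> (Vol2 \<Omega> * (sinh (t * diameter \<Omega>) / t))\<^sup>2"
proof -
  obtain m where slab: "\<And>x. x \<in> \<Omega> \<Longrightarrow> \<bar>e \<bullet> x - m\<bar> \<le> diameter \<Omega> / 2"
    by (rule bounded_subset_slab[OF \<Omega>(2) e]) blast
  let ?s = "sinh (t * diameter \<Omega>) / t"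
  have weight: "(LINT x|lebesgue_on \<Omega>. exp (c * (e \<bullet> x))) \<le> Vol2 \<Omega> * (exp (c * m) * ?s)"
    if c: "c = 2 * t \<or> c = - 2 * t" for c
    using integral_exp_inner_le[OF \<Omega> e _ _ slab, of c] diameter_ge_0[OF \<Omega>(2)] c t by auto
  have "(LINT x|lebesgue_on \<Omega>. exp (- 2 * t * (e \<bullet> x)))
      * (LINT x|lebesgue_on \<Omega>. exp (2 * t * (e \<bullet> x)))
     \<le> (Vol2 \<Omega> * (exp (- 2 * t * m) * ?s)) * (Vol2 \<Omega> * (exp (2 * t * m) * ?s))"
    using Vol2_nonneg[OF \<Omega>] diameter_ge_0[OF \<Omega>(2)] t by (intro mult_mono weight) auto
  also have "\<dots> = (exp (- 2 * t * m) * exp (2 * t * m)) * (Vol2 \<Omega> * ?s)\<^sup>2"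
    by (simp only: power2_eq_square mult_ac)
  also have "exp (- 2 * t * m) * exp (2 * t * m) = 1" by (simp flip: exp_add)
  finally show ?thesis by simp
qed

section \<open>Smooth fields\<close>

lemma partial_deriv_eqI:
  "((\<lambda>t. f (x + t *\<^sub>R axis j 1)) has_vector_derivative D) (at 0) \<Longrightarrow> partial_deriv j f x = D"
  unfolding partial_deriv_def by (rule vector_derivative_at)

lemma has_vector_derivative_partial_deriv:
  "(\<lambda>t. f (x + t *\<^sub>R axis j 1)) differentiable (at 0) \<Longrightarrow>
    ((\<lambda>t. f (x + t *\<^sub>R axis j 1)) has_vector_derivative partial_deriv j f x) (at 0)"
  unfolding partial_deriv_def by (rule vector_derivative_works[THEN iffD1])

lemma partial_deriv_bounded_linear:
  assumes "bounded_linear L" and "\<And>x. (\<lambda>t. f (x + t *\<^sub>R axis j 1)) differentiable (at 0)"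
  shows "partial_deriv j (\<lambda>x. L (f x)) = (\<lambda>x. L (partial_deriv j f x))"
  by (rule ext, rule partial_deriv_eqI)
     (rule bounded_linear.has_vector_derivative[OF assms(1)
       has_vector_derivative_partial_deriv[OF assms(2)]])

lemma Ck_on_bounded_linear:
  assumes "bounded_linear L" and "Ck_on k UNIV f"
  shows "Ck_on k UNIV (\<lambda>x. L (f x))"
  using assms(2)
proof (induction k arbitrary: f)
  case 0
  then show ?case by (simp add: bounded_linear.continuous_on[OF assms(1)])
next
  case (Suc k)
  then have cont: "continuous_on UNIV f"
    and diff: "\<And>j x. (\<lambda>t. f (x + t *\<^sub>R axis j 1)) differentiable (at 0)"
    and Ck: "\<And>j. Ck_on k UNIV (partial_deriv j f)"
    by auto
  have "(\<lambda>t. L (f (x + t *\<^sub>R axis j 1))) differentiable (at 0)" for j x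
    by (rule differentiableI_vector[OF bounded_linear.has_vector_derivative[OF assms(1)
          has_vector_derivative_partial_deriv[OF diff]]])
  then show ?case
    using Suc.IH[OF Ck] by (simp add: bounded_linear.continuous_on[OF assms(1) cont]
      partial_deriv_bounded_linear[OF assms(1) diff])
qed

lemma smooth_on_bounded_linear:
  "bounded_linear L \<Longrightarrow> smooth_on UNIV f \<Longrightarrow> smooth_on UNIV (\<lambda>x. L (f x))"
  by (simp add: smooth_on_def Ck_on_bounded_linear)

lemma test_fun_bounded_linear:
  assumes L: "bounded_linear L" and f: "test_fun \<Omega> f"
  shows "test_fun \<Omega> (\<lambda>x. L (f x))"
proof -
  let ?K = "closure {x. f x \<noteq> 0}" and ?K' = "closure {x. L (f x) \<noteq> 0}"
  have support: "compact ?K" "?K \<subseteq> \<Omega>" "smooth_on UNIV f" using f by (simp_all add: test_fun_def)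
  have support_subset: "?K' \<subseteq> ?K"
    by (intro closure_mono) (auto simp: linear_0[OF bounded_linear.linear[OF L]])
  then have "compact ?K'"
    using compact_Int_closed[OF support(1) closed_closure, of "{x. L (f x) \<noteq> 0}"]
    by (simp add: inf.absorb2)
  then show ?thesis
    using order_trans[OF support_subset support(2)] smooth_on_bounded_linear[OF L support(3)]
    by (simp add: test_fun_def)
qed

lemma
  assumes "smooth_on UNIV f"
  shows smooth_on_imp_continuous_on: "continuous_on UNIV f"
    and smooth_on_imp_continuous_on_partial_deriv: "continuous_on UNIV (partial_deriv j f)"
    and smooth_on_imp_differentiable: "(\<lambda>t. f (x + t *\<^sub>R axis j 1)) differentiable (at 0)"
proof -
  have "Ck_on (Suc 0) UNIV f" using assms unfolding smooth_on_def by blast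
  then show "continuous_on UNIV f" "continuous_on UNIV (partial_deriv j f)"
    "(\<lambda>t. f (x + t *\<^sub>R axis j 1)) differentiable (at 0)" by auto
qed

lemma has_vector_derivative_eq_0_off_support:
  fixes f :: "'a::real_normed_vector \<Rightarrow> 'b::real_normed_vector"
  assumes deriv: "((\<lambda>t. f (x + t *\<^sub>R v)) has_vector_derivative D) (at 0)"
    and K: "closed K" "x \<notin> K" and supp: "\<And>y. y \<notin> K \<Longrightarrow> f y = 0"
  shows "D = 0"
proof (rule vector_derivative_unique_at[OF deriv])
  let ?U = "(\<lambda>t. x + t *\<^sub>R v) -` (- K)"
  have "open ?U" using K by (intro open_vimage continuous_intros) auto
  then show "((\<lambda>t. f (x + t *\<^sub>R v)) has_vector_derivative 0) (at 0)"
    using K supp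
    by (intro has_vector_derivative_transform_within_open[where S = ?U,
          OF has_vector_derivative_const[of 0]]) auto
qed

lemma integrable_continuous_compact_support:
  fixes f :: "'a::euclidean_space \<Rightarrow> 'b::{banach,second_countable_topology}"
  assumes "continuous_on UNIV f" "compact K" "\<And>x. x \<notin> K \<Longrightarrow> f x = 0"
  shows "integrable lborel f"
proof -
  have "(\<lambda>x. indicator K x *\<^sub>R f x) = f" using assms(3) by (auto simp: indicator_def)
  then show ?thesis using borel_integrable_compact[OF assms(2) continuous_on_subset[OF assms(1)]]
    by simp
qed

lemma integral_directional_derivative_eq_0:
  fixes f f' :: "'a::euclidean_space \<Rightarrow> 'b::euclidean_space"
  assumes deriv: "\<And>x. ((\<lambda>t. f (x + t *\<^sub>R v)) has_vector_derivative f' x) (at 0)"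
    and cont: "continuous_on UNIV f" "continuous_on UNIV f'"
    and K: "compact K" and supp: "\<And>x. x \<notin> K \<Longrightarrow> f x = 0"
  shows "integral\<^sup>L lborel f' = 0"
proof -
  have [measurable]: "f' \<in> borel_measurable borel" using cont(2)
    by (rule borel_measurable_continuous_onI)
  have f: "integrable lborel f" by (rule integrable_continuous_compact_support[OF cont(1) K supp])
  have f': "integrable lborel f'"
    by (rule integrable_continuous_compact_support[OF cont(2) K])
      (rule has_vector_derivative_eq_0_off_support[OF deriv compact_imp_closed[OF K] _ supp])
  have deriv': "((\<lambda>t. f (x + t *\<^sub>R v)) has_vector_derivative f' (x + t *\<^sub>R v)) (at t)" for x t
    using vector_diff_chain_at[of "\<lambda>h. h - t" 1 t "\<lambda>h. f ((x + t *\<^sub>R v) + h *\<^sub>R v)"]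
      deriv[of "x + t *\<^sub>R v"]
    by (simp add: o_def has_vector_derivative_diff_const algebra_simps)
  have FTC: "(LINT t|lborel. indicator {0..1} t *\<^sub>R f' (t *\<^sub>R v + x)) = f (v + x) - f x" for x
    using integral_FTC_atLeastAtMost[OF zero_le_one
      has_vector_derivative_at_within[OF deriv'[of x]]]
    by (simp add: add.commute continuous_on_compose2[OF cont(2)] continuous_intros)
  let ?F = "\<lambda>t x. indicator {0..1} t *\<^sub>R f' (t *\<^sub>R v + x)"
  have int: "integrable (lborel \<Otimes>\<^sub>M lborel) (\<lambda>(t, x). ?F t x)"
    by (rule lborel_pair.Fubini_integrable)
       (auto simp: split_beta' lborel_integral_translate[OF integrable_norm[OF f']]
          intro!: lborel_integrable_translate[OF f'])
  have "integral\<^sup>L lborel f' = (LINT t|lborel. indicator {0..1::real} t *\<^sub>R integral\<^sup>L lborel f')"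
    by simp
  also have "\<dots> = (LINT t|lborel. LINT x|lborel. ?F t x)"
    by (simp add: lborel_integral_translate[OF f'])
  also have "\<dots> = (LINT x|lborel. LINT t|lborel. ?F t x)"
    by (rule lborel_pair.Fubini_integral[OF int, symmetric])
  also have "\<dots> = 0"
    unfolding FTC using f lborel_integrable_translate[OF f] by (simp add: lborel_integral_translate)
  finally show ?thesis .
qed

lemma integral_lebesgue_on_eq_lborel:
  fixes f :: "'a::euclidean_space \<Rightarrow> 'b::{banach,second_countable_topology}"
  assumes "f \<in> borel_measurable borel" "\<Omega> \<in> sets lebesgue" "\<And>x. x \<notin> \<Omega> \<Longrightarrow> f x = 0"
  shows "integral\<^sup>L (lebesgue_on \<Omega>) f = integral\<^sup>L lborel f"
proof -
  have "(\<lambda>x. indicator \<Omega> x *\<^sub>R f x) = f" using assms(3) by (auto simp: indicator_def)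
  then show ?thesis using assms(1,2) by (simp add: integral_restrict_space integral_completion)
qed

lemma integral_product_rule_test_fun:
  fixes a b :: "real^3 \<Rightarrow> complex"
  assumes \<Omega>: "open \<Omega>" and a: "smooth_on UNIV a" and b: "test_fun \<Omega> b"
  shows "(LINT x|lebesgue_on \<Omega>. a x * partial_deriv j b x + partial_deriv j a x * b x) = 0"
proof -
  let ?K = "closure {x. b x \<noteq> 0}" and ?f = "\<lambda>x. a x * b x"
  let ?d = "\<lambda>x. a x * partial_deriv j b x + partial_deriv j a x * b x"
  have support: "compact ?K" "?K \<subseteq> \<Omega>" and smooth_b: "smooth_on UNIV b" using b
    by (auto simp: test_fun_def)
  note smooth = smooth_on_imp_continuous_on smooth_on_imp_continuous_on_partial_deriv
  have zero_off_support: "?f x = 0" if "x \<notin> ?K" for x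
  proof -
    have "b x = 0" using that closure_subset[of "{x. b x \<noteq> 0}"] by blast
    then show ?thesis by simp
  qed
  have deriv: "((\<lambda>t. ?f (x + t *\<^sub>R axis j 1)) has_vector_derivative ?d x) (at 0)" for x
    using has_vector_derivative_mult[OF
        has_vector_derivative_partial_deriv[OF smooth_on_imp_differentiable[OF a]]
        has_vector_derivative_partial_deriv[OF smooth_on_imp_differentiable[OF smooth_b]]]
    by simp
  have cont: "continuous_on UNIV ?f" "continuous_on UNIV ?d"
    by (intro continuous_intros smooth a smooth_b)+
  have "integral\<^sup>L lborel ?d = 0"
    by (rule integral_directional_derivative_eq_0[where f = ?f,
          OF deriv cont support(1) zero_off_support])
  moreover have "?d x = 0" if "x \<notin> \<Omega>" for x
    by (rule has_vector_derivative_eq_0_off_support[where f = ?f,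
          OF deriv closed_closure _ zero_off_support])
       (use that support(2) in blast)
  ultimately show ?thesis
    using cont(2) \<Omega>
    by (subst integral_lebesgue_on_eq_lborel) (simp_all add: borel_measurable_continuous_onI)
qed

lemma integrable_mult_continuous_lebesgue_on:
  fixes s h :: "'a::euclidean_space \<Rightarrow> 'b::{real_normed_field,banach,second_countable_topology}"
  assumes \<Omega>: "bounded \<Omega>" and s: "integrable (lebesgue_on \<Omega>) s" and h: "continuous_on UNIV h"
  shows "integrable (lebesgue_on \<Omega>) (\<lambda>x. s x * h x)"
proof -
  have "compact (h ` closure \<Omega>)"
    using \<Omega> by (intro compact_continuous_image continuous_on_subset[OF h]) auto
  then obtain B where bounded: "\<And>x. x \<in> closure \<Omega> \<Longrightarrow> norm (h x) \<le> B"
    using compact_imp_bounded[of "h ` closure \<Omega>"] by (auto simp: bounded_iff)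
  have [measurable]: "h \<in> borel_measurable (lebesgue_on \<Omega>)"
    using h by (intro borel_measurable_lebesgue_on borel_measurable_continuous_onI)
  note [measurable] = borel_measurable_integrable[OF s]
  show ?thesis
  proof (rule Bochner_Integration.integrable_bound)
    show "integrable (lebesgue_on \<Omega>) (\<lambda>x. B * norm (s x))" using s by simp
    show "AE x in lebesgue_on \<Omega>. norm (s x * h x) \<le> norm (B * norm (s x))"
    proof (rule AE_I2)
      fix x assume "x \<in> space (lebesgue_on \<Omega>)"
      then have "norm (s x) * norm (h x) \<le> norm (s x) * B"
        using bounded closure_subset[of \<Omega>] by (intro mult_left_mono) auto
      then show "norm (s x * h x) \<le> norm (B * norm (s x))"
        using order_trans[OF _ abs_ge_self] by (simp add: norm_mult mult.commute[of B])
    qed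
  qed simp
qed

lemma integrable_continuous_lebesgue_on:
  fixes f :: "'a::euclidean_space \<Rightarrow> 'b::{real_normed_field,banach,second_countable_topology}"
  assumes \<Omega>: "open \<Omega>" "bounded \<Omega>" and f: "continuous_on UNIV f"
  shows "integrable (lebesgue_on \<Omega>) f"
proof -
  interpret finite_measure "lebesgue_on \<Omega>"
    using \<Omega> by (intro finite_measure_lebesgue_on lmeasurable_open)
  show ?thesis
    using integrable_mult_continuous_lebesgue_on[OF \<Omega>(2) _ f, of "\<lambda>_. 1"] by simp
qed

lemma L2_continuous:
  fixes u :: "real^3 \<Rightarrow> 'b::{real_normed_vector,second_countable_topology}"
  assumes "open \<Omega>" "bounded \<Omega>" "continuous_on UNIV u"
  shows "L2 \<Omega> u"
  unfolding L2_def using assms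
  by (auto intro!: borel_measurable_lebesgue_on borel_measurable_continuous_onI
      integrable_continuous_lebesgue_on continuous_intros)

lemma cdot_3: "cdot a b = a$1 * b$1 + a$2 * b$2 + a$3 * b$3"
  by (simp add: cdot_def sum_3)

lemma continuous_on_curl:
  assumes "smooth_on UNIV u"
  shows "continuous_on UNIV (curl u)"
proof -
  have "continuous_on UNIV (partial_deriv j (\<lambda>y. u y $ i))" for i j
    by (rule smooth_on_imp_continuous_on_partial_deriv[OF
      smooth_on_bounded_linear[OF bounded_linear_vec_nth assms]])
  then have "continuous_on UNIV (\<lambda>x. curl u x $ i)" for i
    using exhaust_3[of i] by (elim disjE; simp add: curl_def; intro continuous_intros)
  then have "continuous_on UNIV (\<lambda>x. \<chi> i. curl u x $ i)"
    by (intro continuous_on_vec_lambda)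
  then show ?thesis by simp
qed

lemma weak_curl_smooth:
  assumes \<Omega>: "open \<Omega>" "bounded \<Omega>" and u: "smooth_on UNIV u"
  shows "weak_curl \<Omega> u (curl u)"
  unfolding weak_curl_def
proof (intro conjI allI impI L2_continuous \<Omega> continuous_on_curl smooth_on_imp_continuous_on u)
  fix \<phi> :: "real^3 \<Rightarrow> complex^3" assume \<phi>: "test_fun \<Omega> \<phi>"
  then have smooth_\<phi>: "smooth_on UNIV \<phi>" by (simp add: test_fun_def)
  define A where "A j i m x
      = u x $ i * partial_deriv j (\<lambda>y. \<phi> y $ m) x + partial_deriv j (\<lambda>y. u y $ i) x * \<phi> x $ m"
    for i j m x
  note comp = smooth_on_bounded_linear[OF bounded_linear_vec_nth]
  note cont = smooth_on_imp_continuous_on[OF comp]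
      smooth_on_imp_continuous_on_partial_deriv[OF comp]
  have product_rule: "integrable (lebesgue_on \<Omega>) (A j i m)"
    "integral\<^sup>L (lebesgue_on \<Omega>) (A j i m) = 0" for j i m
    unfolding A_def
    by (intro integrable_continuous_lebesgue_on \<Omega> continuous_intros cont u smooth_\<phi>)
       (intro integral_product_rule_test_fun \<Omega> comp u
         test_fun_bounded_linear[OF bounded_linear_vec_nth \<phi>])
  have int: "integrable (lebesgue_on \<Omega>) (\<lambda>x. cdot (curl u x) (\<phi> x))"
    unfolding cdot_3
    by (intro integrable_continuous_lebesgue_on \<Omega> continuous_intros continuous_on_curl u
        smooth_on_imp_continuous_on[OF smooth_\<phi>])
  have parts: "cdot (u x) (curl \<phi> x) = cdot (curl u x) (\<phi> x)
      + (A 2 1 3 x - A 3 1 2 x + (A 3 2 1 x - A 1 2 3 x) + (A 1 3 2 x - A 2 3 1 x))" for x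
    by (simp add: cdot_3 curl_def A_def algebra_simps)
  show "(LINT x|lebesgue_on \<Omega>. cdot (u x) (curl \<phi> x))
      = (LINT x|lebesgue_on \<Omega>. cdot (curl u x) (\<phi> x))"
    unfolding parts using product_rule int by simp
qed

section \<open>Plane waves\<close>

definition cvec :: "real^3 \<Rightarrow> complex^3" where
  "cvec x = (\<chi> i. complex_of_real (x $ i))"

definition ccross :: "complex^3 \<Rightarrow> complex^3 \<Rightarrow> complex^3" where
  "ccross a b = vector [a$2 * b$3 - a$3 * b$2, a$3 * b$1 - a$1 * b$3, a$1 * b$2 - a$2 * b$1]"

definition cwave :: "complex^3 \<Rightarrow> real^3 \<Rightarrow> complex" where
  "cwave \<zeta> x = exp (\<i> * cdot \<zeta> (cvec x))"

definition pwave :: "complex^3 \<Rightarrow> complex^3 \<Rightarrow> real^3 \<Rightarrow> complex^3" where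
  "pwave \<zeta> \<eta> x = cwave \<zeta> x *s \<eta>"

lemma cvec_nth [simp]: "cvec x $ i = complex_of_real (x $ i)"
  by (simp add: cvec_def)

lemma ccross_nth [simp]:
  "ccross a b $ 1 = a$2 * b$3 - a$3 * b$2"
  "ccross a b $ 2 = a$3 * b$1 - a$1 * b$3"
  "ccross a b $ 3 = a$1 * b$2 - a$2 * b$1"
  by (simp_all add: ccross_def)

lemma pwave_nth: "pwave \<zeta> \<eta> x $ i = cwave \<zeta> x * \<eta> $ i"
  by (simp add: pwave_def)

lemma cdot_smult_left: "cdot (c *s a) b = c * cdot a b"
  and cdot_smult_right: "cdot a (c *s b) = c * cdot a b"
  and cdot_diff_left: "cdot (a - a') b = cdot a b - cdot a' b"
  and cdot_minus_right: "cdot a (- b) = - cdot a b"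
  by (simp_all add: cdot_3 algebra_simps)

lemma cdot_ccross_self: "cdot a (ccross a b) = 0"
  by (simp add: cdot_3 algebra_simps)

lemma ccross_ccross: "ccross \<zeta> (ccross \<zeta> \<eta>) = cdot \<zeta> \<eta> *s \<zeta> - cdot \<zeta> \<zeta> *s \<eta>"
  by (simp add: vec_eq_iff forall_3 cdot_3 algebra_simps)

lemma ccross_smult: "ccross \<zeta> (c *s \<eta>) = c *s ccross \<zeta> \<eta>"
  by (simp add: vec_eq_iff forall_3 algebra_simps)

lemma norm_vector_smult: "norm (c *s (v :: complex^'n)) = norm c * norm v"
  by (simp add: norm_vec_def norm_mult L2_set_right_distrib)

lemma bounded_linear_vector_smult_left: "bounded_linear (\<lambda>c. c *s (v :: complex^'n))"
  by (rule bounded_linear_intro[where K = "norm v"])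
    (auto simp: vec_eq_iff algebra_simps norm_vector_smult)

lemma norm_cdot_le: "norm (cdot a b) \<le> norm a * norm b"
proof -
  have "norm (cdot a b) \<le> (\<Sum>i\<in>UNIV. \<bar>norm (a $ i)\<bar> * \<bar>norm (b $ i)\<bar>)"
    unfolding cdot_def by (rule sum_norm_le[THEN order_trans]) (auto simp: norm_mult)
  also have "\<dots> \<le> norm a * norm b"
    unfolding norm_vec_def by (rule L2_set_mult_ineq)
  finally show ?thesis .
qed

lemma cwave_mult: "cwave \<zeta> x * cwave \<zeta>' x = cwave (\<zeta> + \<zeta>') x"
  by (simp add: cwave_def exp_add[symmetric] cdot_3 algebra_simps)

lemma continuous_on_cwave [continuous_intros]: "continuous_on S (cwave \<zeta>)"
  unfolding cwave_def cdot_3 cvec_nth by (intro continuous_intros)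

lemma has_vector_derivative_cwave:
  "((\<lambda>t. cwave \<zeta> (x + t *\<^sub>R axis j 1)) has_vector_derivative \<i> * \<zeta> $ j * cwave \<zeta> x) (at 0)"
proof -
  have "cdot \<zeta> (cvec (x + t *\<^sub>R axis j 1)) = cdot \<zeta> (cvec x) + \<zeta> $ j * of_real t" for t
    using exhaust_3[of j] by (auto simp: cdot_3 axis_def algebra_simps)
  then have shift: "cwave \<zeta> (x + t *\<^sub>R axis j 1) = exp (\<i> * \<zeta> $ j * of_real t) * cwave \<zeta> x" for t
    by (simp add: cwave_def exp_add algebra_simps)
  have "((\<lambda>z. exp (\<i> * \<zeta> $ j * z) * cwave \<zeta> x)
      has_field_derivative \<i> * \<zeta> $ j * cwave \<zeta> x) (at (of_real 0))"
    by (auto intro!: derivative_eq_intros)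
  from has_vector_derivative_real_field[OF this] show ?thesis by (simp add: shift)
qed

lemma partial_deriv_cwave: "partial_deriv j (cwave \<zeta>) = (\<lambda>x. \<i> * \<zeta> $ j * cwave \<zeta> x)"
  by (intro ext partial_deriv_eqI has_vector_derivative_cwave)

lemma smooth_on_cwave: "smooth_on UNIV (cwave \<zeta>)"
proof -
  have "Ck_on k UNIV (cwave \<zeta>)" for k
  proof (induction k)
    case 0
    show ?case by (simp add: continuous_on_cwave)
  next
    case (Suc k)
    then show ?case
      by (auto simp: partial_deriv_cwave continuous_on_cwave
          intro: differentiableI_vector has_vector_derivative_cwave
              Ck_on_bounded_linear[OF bounded_linear_mult_right])
  qed
  then show ?thesis by (simp add: smooth_on_def)
qed

lemma smooth_on_pwave: "smooth_on UNIV (pwave \<zeta> \<eta>)"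
  unfolding pwave_def[abs_def]
  by (rule smooth_on_bounded_linear[OF bounded_linear_vector_smult_left smooth_on_cwave])

lemma curl_pwave: "curl (pwave \<zeta> \<eta>) = pwave \<zeta> (\<i> *s ccross \<zeta> \<eta>)"
proof -
  have deriv: "partial_deriv j (\<lambda>y. cwave \<zeta> y * c) = (\<lambda>x. \<i> * \<zeta> $ j * cwave \<zeta> x * c)" for c j
    by (simp add: partial_deriv_bounded_linear[OF bounded_linear_mult_left
      smooth_on_imp_differentiable[OF smooth_on_cwave]]
        partial_deriv_cwave)
  show ?thesis
    unfolding fun_eq_iff curl_def pwave_nth deriv
    by (simp add: vec_eq_iff forall_3 pwave_nth algebra_simps)
qed

lemma L2norm_pwave: "L2norm \<Omega> (pwave \<zeta> \<eta>) = norm \<eta> * L2norm \<Omega> (cwave \<zeta>)"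
  by (simp add: L2norm_def pwave_def norm_vector_smult power_mult_distrib real_sqrt_mult)

unbundle cross3_syntax

definition cplx :: "real^3 \<Rightarrow> real^3 \<Rightarrow> complex^3" where
  "cplx a b = cvec a + \<i> *s cvec b"

lemma cplx_nth [simp]: "cplx a b $ i = Complex (a $ i) (b $ i)"
  by (simp add: cplx_def complex_eq_iff)

lemma cplx_add: "cplx a b + cplx c d = cplx (a + c) (b + d)"
  by (simp add: vec_eq_iff complex_eq_iff)

lemma cdot_cplx: "cdot (cplx a b) (cplx c d) = Complex (a \<bullet> c - b \<bullet> d) (a \<bullet> d + b \<bullet> c)"
  by (simp add: cdot_3 complex_eq_iff inner_vec_def sum_3)

lemma ccross_cplx: "ccross (cplx a b) (cplx c 0) = cplx (a \<times> c) (b \<times> c)"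
  by (simp add: vec_eq_iff forall_3 cross3_def complex_eq_iff)

lemma norm_cplx: "norm (cplx a b) = sqrt ((norm a)\<^sup>2 + (norm b)\<^sup>2)"
proof -
  have "(\<Sum>i\<in>UNIV. (norm (cplx a b $ i))\<^sup>2) = (norm a)\<^sup>2 + (norm b)\<^sup>2"
    unfolding power2_norm_eq_inner[of a] power2_norm_eq_inner[of b]
    unfolding cmod_power2 by (simp add: sum_3 inner_vec_def power2_eq_square)
  then show ?thesis by (simp add: norm_vec_def L2_set_def)
qed

lemma norm_cwave_cplx: "norm (cwave (cplx a b) x) = exp (- (b \<bullet> x))"
  by (simp add: cwave_def cdot_3 inner_vec_def sum_3)

lemma cwave_cplx_0: "cwave (cplx \<xi> 0) x = cis (\<xi> \<bullet> x)"
  by (simp add: cwave_def cdot_3 inner_vec_def sum_3 cis_conv_exp complex_eq_iff Complex_eq)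

lemma norm_cross_orthogonal: "a \<bullet> b = 0 \<Longrightarrow> norm (a \<times> b) = norm a * norm b" for a b :: "real^3"
  using norm_cross_dot[of a b] by (simp add: power2_eq_iff_nonneg)

section \<open>The boundary map tested against plane waves\<close>

lemma
  fixes u v :: "real^3 \<Rightarrow> complex^3"
  assumes u: "L2 \<Omega> u" and v: "L2 \<Omega> v"
  shows integrable_cdot: "integrable (lebesgue_on \<Omega>) (\<lambda>x. cdot (u x) (v x))"
    and norm_integral_cdot_le: "norm (LINT x|lebesgue_on \<Omega>. cdot (u x) (v x))
        \<le> L2norm \<Omega> u * L2norm \<Omega> v"
proof -
  have [measurable]: "u \<in> borel_measurable (lebesgue_on \<Omega>)" "v \<in> borel_measurable (lebesgue_on \<Omega>)"
    using u v by (auto simp: L2_def)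
  have [measurable]: "(\<lambda>w :: complex^3. w $ i) \<in> borel_measurable borel" for i
    by (intro borel_measurable_continuous_onI continuous_intros)
  have [measurable]: "(\<lambda>x. cdot (u x) (v x)) \<in> borel_measurable (lebesgue_on \<Omega>)"
    unfolding cdot_3 by measurable
  have int_norm: "integrable (lebesgue_on \<Omega>) (\<lambda>x. norm (u x) * norm (v x))"
    using u v by (intro integrable_mult_of_squares) (auto simp: L2_def)
  show int: "integrable (lebesgue_on \<Omega>) (\<lambda>x. cdot (u x) (v x))"
    by (rule Bochner_Integration.integrable_bound[OF int_norm]) (auto simp: norm_cdot_le)
  have "norm (LINT x|lebesgue_on \<Omega>. cdot (u x) (v x))
      \<le> (LINT x|lebesgue_on \<Omega>. norm (u x) * norm (v x))"
    by (intro order_trans[OF integral_norm_bound] Bochner_Integration.integral_mono integrable_norm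
      int_norm int norm_cdot_le)
  also have "\<dots> \<le> L2norm \<Omega> u * L2norm \<Omega> v"
    unfolding L2norm_def using u v
    by (intro order_trans[OF abs_ge_self Cauchy_Schwarz_integral]) (auto simp: L2_def)
  finally show "norm (LINT x|lebesgue_on \<Omega>. cdot (u x) (v x)) \<le> L2norm \<Omega> u * L2norm \<Omega> v" .
qed

lemma L2norm_nonneg: "0 \<le> L2norm \<Omega> u"
  by (simp add: L2norm_def)

lemma TH_norm_le:
  assumes "weak_curl \<Omega> u cu"
  shows "TH_norm \<Omega> u cu \<le> L2norm \<Omega> u + L2norm \<Omega> cu"
  unfolding TH_norm_def
  by (rule cInf_lower)
     (use assms in \<open>auto simp: same_tan_trace_def
       intro!: bdd_belowI[where m = 0] add_nonneg_nonneg L2norm_nonneg\<close>)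

lemma norm_tan_trace_le_L2norm:
  assumes v: "weak_curl \<Omega> v cv" and \<phi>: "L2 \<Omega> \<phi>" "L2 \<Omega> (curl \<phi>)"
  shows "norm (tan_trace \<Omega> v cv \<phi>)
      \<le> max (L2norm \<Omega> \<phi>) (L2norm \<Omega> (curl \<phi>)) * (L2norm \<Omega> v + L2norm \<Omega> cv)"
proof -
  let ?m = "max (L2norm \<Omega> \<phi>) (L2norm \<Omega> (curl \<phi>))"
  have L2: "L2 \<Omega> v" "L2 \<Omega> cv" using v by (auto simp: weak_curl_def)
  have "tan_trace \<Omega> v cv \<phi>
      = (LINT x|lebesgue_on \<Omega>. cdot (cv x) (\<phi> x)) - (LINT x|lebesgue_on \<Omega>. cdot (v x) (curl \<phi> x))"
    unfolding tan_trace_def by (intro Bochner_Integration.integral_diff integrable_cdot L2 \<phi>)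
  also have "norm \<dots> \<le> L2norm \<Omega> cv * L2norm \<Omega> \<phi> + L2norm \<Omega> v * L2norm \<Omega> (curl \<phi>)"
    by (intro order_trans[OF norm_triangle_ineq4] add_mono norm_integral_cdot_le L2 \<phi>)
  also have "\<dots> \<le> L2norm \<Omega> cv * ?m + L2norm \<Omega> v * ?m"
    by (intro add_mono mult_left_mono L2norm_nonneg) auto
  finally show ?thesis by (simp add: algebra_simps)
qed

lemma norm_tan_trace_le_TH_norm:
  assumes u: "weak_curl \<Omega> u cu" and \<phi>: "smooth_on UNIV \<phi>" "L2 \<Omega> \<phi>" "L2 \<Omega> (curl \<phi>)"
  shows "norm (tan_trace \<Omega> u cu \<phi>) \<le> max (L2norm \<Omega> \<phi>) (L2norm \<Omega> (curl \<phi>)) * TH_norm \<Omega> u cu"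
proof -
  let ?m = "max (L2norm \<Omega> \<phi>) (L2norm \<Omega> (curl \<phi>))"
  let ?S = "{L2norm \<Omega> v + L2norm \<Omega> cv | v cv. weak_curl \<Omega> v cv \<and> same_tan_trace \<Omega> v cv u cu}"
  have nonempty: "?S \<noteq> {}" using u by (auto simp: same_tan_trace_def)
  have bound: "norm (tan_trace \<Omega> u cu \<phi>) \<le> ?m * s" if s_in: "s \<in> ?S" for s
  proof -
    obtain v cv where s: "s = L2norm \<Omega> v + L2norm \<Omega> cv" and v: "weak_curl \<Omega> v cv"
      and trace: "same_tan_trace \<Omega> v cv u cu" using s_in by blast
    have "tan_trace \<Omega> u cu \<phi> = tan_trace \<Omega> v cv \<phi>" using trace \<phi>(1)
      by (simp add: same_tan_trace_def)
    then show ?thesis using norm_tan_trace_le_L2norm[OF v \<phi>(2,3)] by (simp only: s)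
  qed
  have "0 \<le> ?m" using L2norm_nonneg[of \<Omega> \<phi>] by simp
  then consider (zero) "?m = 0" | (positive) "0 < ?m" by linarith
  then show ?thesis
  proof cases
    case zero
    then show ?thesis using bound nonempty by auto
  next
    case positive
    then have "norm (tan_trace \<Omega> u cu \<phi>) / ?m \<le> TH_norm \<Omega> u cu"
      unfolding TH_norm_def using bound
      by (intro cInf_greatest[OF nonempty]) (simp add: divide_le_eq mult.commute)
    then show ?thesis using positive by (simp add: divide_le_eq mult.commute)
  qed
qed

lemma tan_trace_problem1:
  assumes p1: "problem1 \<omega> \<epsilon>\<^sub>0 \<mu>\<^sub>0 \<Omega> \<sigma> E0 E1 H1"
    and L2: "L2 \<Omega> E" "L2 \<Omega> (curl E)" "L2 \<Omega> H" "L2 \<Omega> (curl H)" and smooth: "smooth_on UNIV H"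
    and curl_E: "curl E = (\<lambda>x. (\<i> * \<omega> * \<mu>\<^sub>0) *s H x)"
    and curl_H: "curl H = (\<lambda>x. - (\<i> * \<omega> * \<epsilon>\<^sub>0) *s E x)"
  shows "tan_trace \<Omega> H1 (\<lambda>x. complex_of_real (\<sigma> x) *s E0 x - (\<i> * \<omega> * \<epsilon>\<^sub>0) *s E1 x) E
    = (LINT x|lebesgue_on \<Omega>. complex_of_real (\<sigma> x) * cdot (E0 x) (E x))"
proof -
  let ?cE1 = "\<lambda>x. (\<i> * \<omega> * \<mu>\<^sub>0) *s H1 x"
    and ?cH1 = "\<lambda>x. complex_of_real (\<sigma> x) *s E0 x - (\<i> * \<omega> * \<epsilon>\<^sub>0) *s E1 x"
  let ?a = "\<lambda>x. cdot (?cH1 x) (E x) - cdot (H1 x) (curl E x)"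
  let ?b = "\<lambda>x. cdot (?cE1 x) (H x) - cdot (E1 x) (curl H x)"
  have "weak_curl \<Omega> E1 ?cE1" "weak_curl \<Omega> H1 ?cH1" and trace: "zero_tan_trace \<Omega> E1 ?cE1"
    using p1 by (auto simp: problem1_def maxwell_sol_def)
  then have "L2 \<Omega> E1" "L2 \<Omega> ?cE1" "L2 \<Omega> H1" "L2 \<Omega> ?cH1" by (simp_all add: weak_curl_def)
  then have int: "integrable (lebesgue_on \<Omega>) ?a" "integrable (lebesgue_on \<Omega>) ?b"
    using L2 by (auto intro!: Bochner_Integration.integrable_diff integrable_cdot)
  have "integral\<^sup>L (lebesgue_on \<Omega>) ?b = 0"
    using trace smooth by (simp add: zero_tan_trace_def tan_trace_def)
  then have "tan_trace \<Omega> H1 ?cH1 E = (LINT x|lebesgue_on \<Omega>. ?a x + ?b x)"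
    using int by (simp add: tan_trace_def)
  also have "(\<lambda>x. ?a x + ?b x) = (\<lambda>x. complex_of_real (\<sigma> x) * cdot (E0 x) (E x))"
    by (simp add: curl_E curl_H fun_eq_iff cdot_smult_left cdot_smult_right cdot_diff_left
      cdot_minus_right)
  finally show ?thesis .
qed

lemma
  assumes pos: "0 < \<epsilon>\<^sub>0" "0 < \<mu>\<^sub>0" "0 < \<omega>"
    and \<zeta>: "cdot \<zeta> \<zeta> = complex_of_real (\<omega>\<^sup>2 * \<epsilon>\<^sub>0 * \<mu>\<^sub>0)" "cdot \<zeta> \<eta> = 0"
  defines "H \<equiv> pwave \<zeta> (complex_of_real (1 / (\<omega> * \<mu>\<^sub>0)) *s ccross \<zeta> \<eta>)"
  shows curl_pwave_electric: "curl (pwave \<zeta> \<eta>) = (\<lambda>x. (\<i> * \<omega> * \<mu>\<^sub>0) *s H x)"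
    and curl_pwave_magnetic: "curl H = (\<lambda>x. - (\<i> * \<omega> * \<epsilon>\<^sub>0) *s pwave \<zeta> \<eta> x)"
proof -
  show "curl (pwave \<zeta> \<eta>) = (\<lambda>x. (\<i> * \<omega> * \<mu>\<^sub>0) *s H x)"
    using pos by (auto simp: curl_pwave H_def pwave_def vec_eq_iff)
  have "\<omega>\<^sup>2 * \<epsilon>\<^sub>0 * \<mu>\<^sub>0 / (\<omega> * \<mu>\<^sub>0) = \<omega> * \<epsilon>\<^sub>0" using pos by (simp add: power2_eq_square)
  then have "\<i> *s ccross \<zeta> (complex_of_real (1 / (\<omega> * \<mu>\<^sub>0)) *s ccross \<zeta> \<eta>)
      = (- \<i> * complex_of_real (\<omega> * \<epsilon>\<^sub>0)) *s \<eta>"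
    unfolding ccross_smult ccross_ccross \<zeta>
    by (simp add: vec_eq_iff flip: of_real_mult of_real_divide)
  then have "curl H = pwave \<zeta> ((- \<i> * complex_of_real (\<omega> * \<epsilon>\<^sub>0)) *s \<eta>)"
    unfolding H_def curl_pwave by (rule arg_cong)
  then show "curl H = (\<lambda>x. - (\<i> * \<omega> * \<epsilon>\<^sub>0) *s pwave \<zeta> \<eta> x)"
    by (auto simp: pwave_def vec_eq_iff)
qed

lemma fourier_indicator:
  assumes "\<Omega> \<in> sets lebesgue"
  shows "fourier (\<lambda>x. indicator \<Omega> x * s x) \<xi>
      = (LINT x|lebesgue_on \<Omega>. complex_of_real (s x) * cis (\<xi> \<bullet> x))"
proof -
  have "(LINT x|lebesgue_on \<Omega>. complex_of_real (s x) * cis (\<xi> \<bullet> x))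
      = (LINT x|lebesgue. indicator \<Omega> x *\<^sub>R (complex_of_real (s x) * cis (\<xi> \<bullet> x)))"
    using assms by (simp add: integral_restrict_space)
  also have "\<dots> = fourier (\<lambda>x. indicator \<Omega> x * s x) \<xi>"
    unfolding fourier_def by (intro Bochner_Integration.integral_cong) (auto simp: indicator_def)
  finally show ?thesis ..
qed

lemma polarisation_factor_le:
  fixes N k :: real
  assumes "1 \<le> k" "k \<le> N"
  shows "(N + k\<^sup>2) * max N (k\<^sup>2) \<le> k * (1 + k) * N\<^sup>2"
proof (cases "N \<ge> k\<^sup>2")
  case True
  have "(N + k\<^sup>2) * N \<le> 2 * N\<^sup>2" using True assms
    by (simp add: power2_eq_square mult_right_mono distrib_right)
  also have "\<dots> \<le> k * (1 + k) * N\<^sup>2"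
    using assms(1) mult_mono[of 1 k 2 "1 + k"] by (intro mult_right_mono) auto
  finally show ?thesis using True by (simp add: max_def)
next
  case False
  have "N * k\<^sup>2 \<le> k * N\<^sup>2" using assms by (simp add: power2_eq_square mult_mono mult_left_mono)
  moreover have "k\<^sup>2 * k\<^sup>2 \<le> k\<^sup>2 * N\<^sup>2" using assms by (intro mult_left_mono power_mono) auto
  ultimately show ?thesis using False by (simp add: max_def algebra_simps power2_eq_square)
qed

lemma
  assumes ef: "norm e = 1" "norm f = 1" "e \<bullet> f = 0" "p \<bullet> e = 0" "p \<bullet> f = 0"
    and p: "(norm p)\<^sup>2 = k\<^sup>2 + t\<^sup>2"
  shows cdot_complex_frequency: "cdot (cplx p (t *\<^sub>R e)) (cplx p (t *\<^sub>R e)) = complex_of_real (k\<^sup>2)"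
    and norm_complex_polarisation: "norm (ccross (cplx p (t *\<^sub>R e)) (cplx f 0)) = sqrt (k\<^sup>2 + 2 * t\<^sup>2)"
    and norm_ccross_complex_polarisation:
      "norm (ccross (cplx p (t *\<^sub>R e)) (ccross (cplx p (t *\<^sub>R e)) (cplx f 0))) = k\<^sup>2"
    and cdot_complex_polarisations:
      "cdot (ccross (cplx p (t *\<^sub>R e)) (cplx f 0)) (ccross (cplx p ((- t) *\<^sub>R e)) (cplx f 0))
        = complex_of_real (k\<^sup>2 + 2 * t\<^sup>2)"
proof -
  have polarisation: "ccross (cplx p (c *\<^sub>R e)) (cplx f 0) = cplx (p \<times> f) (c *\<^sub>R (e \<times> f))" for c
    by (simp add: ccross_cplx cross_mult_left)
  have cross: "norm (p \<times> f) = norm p" "norm (e \<times> f) = 1"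
    using ef by (simp_all add: norm_cross_orthogonal)
  show frequency: "cdot (cplx p (t *\<^sub>R e)) (cplx p (t *\<^sub>R e)) = complex_of_real (k\<^sup>2)"
    using ef p by (simp add: cdot_cplx complex_eq_iff norm_eq_1 power2_norm_eq_inner
      power2_eq_square[of t] inner_commute[of e p])
  have "cdot (cplx p (t *\<^sub>R e)) (cplx f 0) = 0"
    using ef by (simp add: cdot_cplx complex_eq_iff)
  then show "norm (ccross (cplx p (t *\<^sub>R e)) (ccross (cplx p (t *\<^sub>R e)) (cplx f 0))) = k\<^sup>2"
    using ef unfolding ccross_ccross frequency by (simp add: norm_vector_smult norm_cplx norm_power)
  show "norm (ccross (cplx p (t *\<^sub>R e)) (cplx f 0)) = sqrt (k\<^sup>2 + 2 * t\<^sup>2)"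
    using cross p by (simp add: polarisation norm_cplx power_mult_distrib)
  show "cdot (ccross (cplx p (t *\<^sub>R e)) (cplx f 0)) (ccross (cplx p ((- t) *\<^sub>R e)) (cplx f 0))
        = complex_of_real (k\<^sup>2 + 2 * t\<^sup>2)"
    using cross p unfolding polarisation cdot_cplx
    by (simp add: complex_eq_iff inner_commute power2_norm_eq_inner[symmetric]
      power2_eq_square[symmetric])
qed

locale linearised_boundary_map =
  fixes \<Omega> :: "(real^3) set" and \<epsilon>\<^sub>0 \<mu>\<^sub>0 \<omega> k \<epsilon> :: real and \<sigma> :: "real^3 \<Rightarrow> real"
  assumes \<Omega>: "open \<Omega>" "bounded \<Omega>"
    and pos: "0 < \<epsilon>\<^sub>0" "0 < \<mu>\<^sub>0" "0 < \<omega>"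
    and wave_number: "k\<^sup>2 = \<omega>\<^sup>2 * \<epsilon>\<^sub>0 * \<mu>\<^sub>0" and k_ge_1: "1 \<le> k"
    and solvable: "uniquely_solvable \<omega> \<epsilon>\<^sub>0 \<mu>\<^sub>0 \<Omega> \<sigma>"
    and bound: "Lambda'_bound \<omega> \<epsilon>\<^sub>0 \<mu>\<^sub>0 \<Omega> \<sigma> \<epsilon>" and \<epsilon>_nonneg: "0 \<le> \<epsilon>"
begin

lemma TH_norm_problem1_pwave_le:
  assumes \<zeta>: "cdot \<zeta> \<zeta> = complex_of_real (k\<^sup>2)" "cdot \<zeta> \<eta> = 0"
  obtains E1 H1 where "problem1 \<omega> \<epsilon>\<^sub>0 \<mu>\<^sub>0 \<Omega> \<sigma> (pwave \<zeta> \<eta>) E1 H1"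
    "TH_norm \<Omega> H1 (\<lambda>x. complex_of_real (\<sigma> x) *s pwave \<zeta> \<eta> x - (\<i> * \<omega> * \<epsilon>\<^sub>0) *s E1 x)
      \<le> \<epsilon> * ((norm \<eta> + norm (ccross \<zeta> \<eta>)) * L2norm \<Omega> (cwave \<zeta>))"
proof -
  let ?E0 = "pwave \<zeta> \<eta>" and ?H0 = "pwave \<zeta> (complex_of_real (1 / (\<omega> * \<mu>\<^sub>0)) *s ccross \<zeta> \<eta>)"
  note curls = curl_pwave_electric[OF pos \<zeta>[unfolded wave_number]]
      curl_pwave_magnetic[OF pos \<zeta>[unfolded wave_number]]
  have E0: "weak_curl \<Omega> ?E0 (curl ?E0)" by (rule weak_curl_smooth[OF \<Omega> smooth_on_pwave])
  have "maxwell_sol \<omega> \<epsilon>\<^sub>0 \<mu>\<^sub>0 \<Omega> (\<lambda>x. 0) ?E0 ?H0"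
    using weak_curl_smooth[OF \<Omega> smooth_on_pwave, of \<zeta> \<eta>]
      weak_curl_smooth[OF \<Omega> smooth_on_pwave, of \<zeta> "complex_of_real (1 / (\<omega> * \<mu>\<^sub>0)) *s ccross \<zeta> \<eta>"]
    unfolding maxwell_sol_def curls by simp
  then have p0: "problem0 \<omega> \<epsilon>\<^sub>0 \<mu>\<^sub>0 \<Omega> ?E0 (curl ?E0) ?E0 ?H0"
    by (simp add: problem0_def same_tan_trace_def curls(1))
  obtain E1 H1 where p1: "problem1 \<omega> \<epsilon>\<^sub>0 \<mu>\<^sub>0 \<Omega> \<sigma> ?E0 E1 H1"
    using solvable E0 p0 unfolding uniquely_solvable_def by blast
  have "TH_norm \<Omega> H1 (\<lambda>x. complex_of_real (\<sigma> x) *s ?E0 x - (\<i> * \<omega> * \<epsilon>\<^sub>0) *s E1 x)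
      \<le> \<epsilon> * TH_norm \<Omega> ?E0 (curl ?E0)"
    using bound E0 p0 p1 unfolding Lambda'_bound_def by blast
  also have "\<dots> \<le> \<epsilon> * ((norm \<eta> + norm (ccross \<zeta> \<eta>)) * L2norm \<Omega> (cwave \<zeta>))"
    using TH_norm_le[OF E0] \<epsilon>_nonneg
    by (intro mult_left_mono)
      (simp_all add: curl_pwave L2norm_pwave norm_vector_smult algebra_simps)
  finally show thesis by (rule that[OF p1])
qed

lemma plane_wave_estimate:
  assumes \<zeta>: "cdot \<zeta> \<zeta> = complex_of_real (k\<^sup>2)" "cdot \<zeta> \<eta> = 0"
    and \<zeta>': "cdot \<zeta>' \<zeta>' = complex_of_real (k\<^sup>2)" "cdot \<zeta>' \<eta>' = 0"
  shows "norm (LINT x|lebesgue_on \<Omega>. complex_of_real (\<sigma> x) * cwave (\<zeta> + \<zeta>') x) * norm (cdot \<eta> \<eta>')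
    \<le> \<epsilon> * ((norm \<eta> + norm (ccross \<zeta> \<eta>)) * max (norm \<eta>') (norm (ccross \<zeta>' \<eta>')))
        * (L2norm \<Omega> (cwave \<zeta>) * L2norm \<Omega> (cwave \<zeta>'))"
proof -
  let ?E = "pwave \<zeta>' \<eta>'" and ?I = "LINT x|lebesgue_on \<Omega>. complex_of_real (\<sigma> x) * cwave (\<zeta> + \<zeta>') x"
  obtain E1 H1 where p1: "problem1 \<omega> \<epsilon>\<^sub>0 \<mu>\<^sub>0 \<Omega> \<sigma> (pwave \<zeta> \<eta>) E1 H1"
    and TH: "TH_norm \<Omega> H1 (\<lambda>x. complex_of_real (\<sigma> x) *s pwave \<zeta> \<eta> x - (\<i> * \<omega> * \<epsilon>\<^sub>0) *s E1 x)
      \<le> \<epsilon> * ((norm \<eta> + norm (ccross \<zeta> \<eta>)) * L2norm \<Omega> (cwave \<zeta>))"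
    by (rule TH_norm_problem1_pwave_le[OF \<zeta>])
  let ?cH1 = "\<lambda>x. complex_of_real (\<sigma> x) *s pwave \<zeta> \<eta> x - (\<i> * \<omega> * \<epsilon>\<^sub>0) *s E1 x"
  let ?m = "max (L2norm \<Omega> ?E) (L2norm \<Omega> (curl ?E))"
  have L2: "L2 \<Omega> (pwave \<zeta>' \<theta>)" "L2 \<Omega> (curl (pwave \<zeta>' \<theta>))" for \<theta>
    by (intro L2_continuous \<Omega> continuous_on_curl smooth_on_imp_continuous_on smooth_on_pwave)+
  have "tan_trace \<Omega> H1 ?cH1 ?E
      = (LINT x|lebesgue_on \<Omega>. complex_of_real (\<sigma> x) * cdot (pwave \<zeta> \<eta> x) (?E x))"
    by (rule tan_trace_problem1[OF p1 L2 L2 smooth_on_pwave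
          curl_pwave_electric[OF pos \<zeta>'[unfolded wave_number]]
              curl_pwave_magnetic[OF pos \<zeta>'[unfolded wave_number]]])
  also have "\<dots> = ?I * cdot \<eta> \<eta>'"
    by (simp add: pwave_def cdot_smult_left cdot_smult_right mult_ac cwave_mult[symmetric]
      flip: integral_mult_left_zero)
  finally have "norm ?I * norm (cdot \<eta> \<eta>') = norm (tan_trace \<Omega> H1 ?cH1 ?E)" by (simp add: norm_mult)
  also have "\<dots> \<le> ?m * TH_norm \<Omega> H1 ?cH1"
    using p1 by (intro norm_tan_trace_le_TH_norm L2 smooth_on_pwave)
      (simp add: problem1_def maxwell_sol_def)
  also have "\<dots> \<le> ?m * (\<epsilon> * ((norm \<eta> + norm (ccross \<zeta> \<eta>)) * L2norm \<Omega> (cwave \<zeta>)))"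
    by (intro mult_left_mono TH) (simp add: L2norm_nonneg le_max_iff_disj)
  also have "?m = max (norm \<eta>') (norm (ccross \<zeta>' \<eta>')) * L2norm \<Omega> (cwave \<zeta>')"
    by (simp add: curl_pwave L2norm_pwave norm_vector_smult max_mult_distrib_right L2norm_nonneg)
  finally show ?thesis by (simp only: mult_ac)
qed

abbreviation \<sigma>_hat :: "real^3 \<Rightarrow> complex" where
  "\<sigma>_hat \<equiv> fourier (\<lambda>x. indicator \<Omega> x * \<sigma> x)"

lemma \<sigma>_hat_eq_integral_cwave:
  "\<sigma>_hat \<xi> = (LINT x|lebesgue_on \<Omega>. complex_of_real (\<sigma> x) * cwave (cplx \<xi> 0) x)"
  using \<Omega>(1) by (simp add: fourier_indicator cwave_cplx_0)

lemma norm_\<sigma>_hat_le_low: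
  assumes \<xi>: "norm \<xi> \<le> 2 * k"
  shows "norm (\<sigma>_hat \<xi>) \<le> \<epsilon> * (k * (1 + k)) * Vol \<Omega>"
proof -
  define p where "p = \<xi> /\<^sub>R 2"
  obtain e f where ef: "norm e = 1" "norm f = 1" "e \<bullet> f = 0" "p \<bullet> e = 0" "p \<bullet> f = 0"
    by (rule orthonormal_complement)
  define s where "s = sqrt (k\<^sup>2 - (norm p)\<^sup>2)"
  have "norm p \<le> k" using \<xi> by (simp add: p_def)
  then have s: "s\<^sup>2 = k\<^sup>2 - (norm p)\<^sup>2" by (simp add: s_def power_mono)
  define a where "a c = p + c *\<^sub>R e" for c
  have a_inner_a: "a c \<bullet> a c = k\<^sup>2" if "c\<^sup>2 = s\<^sup>2" for c
    using that s ef by (simp add: a_def inner_add_left inner_add_right inner_commute[of e p]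
      power2_norm_eq_inner power2_eq_square[of c] norm_eq_1)
  then have norm_a: "norm (a c) = k" if "c\<^sup>2 = s\<^sup>2" for c
    using that k_ge_1 by (simp add: norm_eq_sqrt_inner)
  have a_inner_f: "a c \<bullet> f = 0" for c using ef by (simp add: a_def inner_add_left)
  have L2norm_wave: "L2norm \<Omega> (cwave (cplx b 0)) = sqrt (Vol \<Omega>)" for b
    using \<Omega>(1) by (simp add: L2norm_def norm_cwave_cplx Vol_def measure_restrict_space)
  have "cplx (a s) 0 + cplx (a (- s)) 0 = cplx \<xi> 0"
    by (simp add: cplx_add a_def p_def scaleR_2[symmetric])
  then have "norm (\<sigma>_hat \<xi>) * norm (cdot (cplx f 0) (cplx f 0))
    \<le> \<epsilon> * ((norm (cplx f 0) + norm (ccross (cplx (a s) 0) (cplx f 0))) *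
          max (norm (cplx f 0)) (norm (ccross (cplx (a (- s)) 0) (cplx f 0))))
        * (L2norm \<Omega> (cwave (cplx (a s) 0)) * L2norm \<Omega> (cwave (cplx (a (- s)) 0)))"
    using plane_wave_estimate[of "cplx (a s) 0" "cplx f 0" "cplx (a (- s)) 0" "cplx f 0"]
    by (simp add: \<sigma>_hat_eq_integral_cwave cdot_cplx a_inner_a a_inner_f complex_eq_iff)
  then show ?thesis
    using ef k_ge_1 unfolding L2norm_wave
    by (simp add: cdot_cplx norm_eq_1 ccross_cplx norm_cplx norm_cross_orthogonal a_inner_f norm_a
      Vol_def Complex_eq max_def mult_ac)
qed

lemma L2norm_cwave_product_le:
  assumes e: "norm e = 1" and t: "0 < t"
  shows "L2norm \<Omega> (cwave (cplx p (t *\<^sub>R e))) * L2norm \<Omega> (cwave (cplx p ((- t) *\<^sub>R e)))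
    \<le> Vol2 \<Omega> * (sinh (t * diameter \<Omega>) / t)"
proof -
  let ?B = "Vol2 \<Omega> * (sinh (t * diameter \<Omega>) / t)"
  have square: "(exp (- (c * u)))\<^sup>2 = exp (- 2 * c * u)" for c u :: real
    by (simp add: exp_double[symmetric])
  have "L2norm \<Omega> (cwave (cplx p (t *\<^sub>R e))) * L2norm \<Omega> (cwave (cplx p ((- t) *\<^sub>R e)))
    = sqrt ((LINT x|lebesgue_on \<Omega>. exp (- 2 * t * (e \<bullet> x)))
        * (LINT x|lebesgue_on \<Omega>. exp (2 * t * (e \<bullet> x))))"
    unfolding L2norm_def norm_cwave_cplx real_sqrt_mult inner_scaleR_left square by simp
  also have "\<dots> \<le> sqrt (?B\<^sup>2)"
    by (intro real_sqrt_le_mono integral_exp_inner_product_le \<Omega> e t)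
  also have "\<dots> = ?B"
    using Vol2_nonneg[OF \<Omega>] t diameter_ge_0[OF \<Omega>(2)] by simp
  finally show ?thesis .
qed

text \<open>For \<open>|\<xi>| > 2 k\<close> the frequencies are complex, and the polarisation \<open>\<zeta> \<times> f\<close> is used because
  \<open>\<zeta> \<times> (\<zeta> \<times> f) = - k\<^sup>2 f\<close> does not grow with \<open>|\<zeta>|\<close>, whereas the polarisation \<open>f\<close> would lose
  a factor \<open>|\<zeta>|\<^sup>2\<close>.\<close>

lemma norm_\<sigma>_hat_le_high:
  assumes \<xi>: "2 * k < norm \<xi>" and t: "t = sqrt ((norm \<xi>)\<^sup>2 / 4 - k\<^sup>2)"
  shows "norm (\<sigma>_hat \<xi>) \<le> \<epsilon> * (k * (1 + k)) * (Vol2 \<Omega> * (sinh (t * diameter \<Omega>) / t))"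
proof -
  define p where "p = \<xi> /\<^sub>R 2"
  obtain e f where ef: "norm e = 1" "norm f = 1" "e \<bullet> f = 0" "p \<bullet> e = 0" "p \<bullet> f = 0"
    by (rule orthonormal_complement)
  have "(2 * k)\<^sup>2 < (norm \<xi>)\<^sup>2" using \<xi> k_ge_1 by (intro power_strict_mono) auto
  then have t0: "0 < t" and p: "(norm p)\<^sup>2 = k\<^sup>2 + t\<^sup>2"
    by (simp_all add: t p_def power_divide power_mult_distrib)
  define N where "N = sqrt (k\<^sup>2 + 2 * t\<^sup>2)"
  have N: "N\<^sup>2 = k\<^sup>2 + 2 * t\<^sup>2" by (simp add: N_def)
  have Nk: "k \<le> N" unfolding N_def by (rule real_le_rsqrt) simp
  let ?z = "\<lambda>c. cplx p (c *\<^sub>R e)"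
  have p': "(norm p)\<^sup>2 = k\<^sup>2 + (- t)\<^sup>2" using p by simp
  have N_minus: "N = sqrt (k\<^sup>2 + 2 * (- t)\<^sup>2)" by (simp add: N_def)
  note norms = norm_complex_polarisation[OF ef p, folded N_def]
      norm_complex_polarisation[OF ef p', folded N_minus]
    norm_ccross_complex_polarisation[OF ef p] norm_ccross_complex_polarisation[OF ef p']
  let ?W = "L2norm \<Omega> (cwave (?z t)) * L2norm \<Omega> (cwave (?z (- t)))"
    and ?B = "Vol2 \<Omega> * (sinh (t * diameter \<Omega>) / t)"
  have sum: "?z t + ?z (- t) = cplx \<xi> 0" by (simp add: cplx_add p_def scaleR_2[symmetric])
  have "norm (\<sigma>_hat \<xi>) * N\<^sup>2 \<le> \<epsilon> * ((N + k\<^sup>2) * max N (k\<^sup>2)) * ?W"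
    using plane_wave_estimate[OF cdot_complex_frequency[OF ef p] cdot_ccross_self
        cdot_complex_frequency[OF ef p'] cdot_ccross_self, of "cplx f 0" "cplx f 0"]
    unfolding norms sum cdot_complex_polarisations[OF ef p, folded N] \<sigma>_hat_eq_integral_cwave
    by (simp only: norm_of_real abs_power2)
  also have "\<dots> \<le> \<epsilon> * (k * (1 + k) * N\<^sup>2) * ?B"
    using polarisation_factor_le[OF k_ge_1 Nk] L2norm_cwave_product_le[OF ef(1) t0] \<epsilon>_nonneg k_ge_1
    by (intro mult_mono[OF mult_left_mono] mult_nonneg_nonneg L2norm_nonneg) auto
  finally have "norm (\<sigma>_hat \<xi>) * N\<^sup>2 \<le> (\<epsilon> * (k * (1 + k)) * ?B) * N\<^sup>2"
    by (simp add: mult_ac)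
  moreover have "0 < N\<^sup>2" using Nk k_ge_1 by simp
  ultimately show ?thesis using mult_le_cancel_right_pos by blast
qed

end

section \<open>Splitting the frequencies\<close>

lemma integral_le_ball_annulus_tail:
  fixes u :: "'a::euclidean_space \<Rightarrow> real"
  assumes u: "integrable lborel u" and weighted: "integrable lborel (\<lambda>\<xi>. (norm \<xi>)\<^sup>2 * u \<xi>)"
    and nonneg: "\<And>\<xi>. 0 \<le> u \<xi>" and r: "r \<le> \<rho>" "0 \<le> \<rho>"
    and u_ball: "\<And>\<xi>. norm \<xi> \<le> r \<Longrightarrow> u \<xi> \<le> a"
    and u_annulus: "\<And>\<xi>. r < norm \<xi> \<Longrightarrow> norm \<xi> \<le> \<rho> \<Longrightarrow> u \<xi> \<le> b"
  shows "(LINT \<xi>|lborel. u \<xi>) \<le> a * measure lborel (cball (0::'a) r)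
    + b * (measure lborel (cball (0::'a) \<rho>) - measure lborel (cball (0::'a) r))
    + ((LINT \<xi>|lborel. u \<xi>) + (LINT \<xi>|lborel. (norm \<xi>)\<^sup>2 * u \<xi>)) / (1 + \<rho>\<^sup>2)"
proof -
  let ?I = "\<lambda>q. indicator (cball (0::'a) q) :: 'a \<Rightarrow> real"
  let ?h = "\<lambda>\<xi>. a * ?I r \<xi> + b * (?I \<rho> \<xi> - ?I r \<xi>) + (u \<xi> + (norm \<xi>)\<^sup>2 * u \<xi>) / (1 + \<rho>\<^sup>2)"
  have integrable_cball: "integrable lborel (?I q)" for q
    by (intro integrable_real_indicator emeasure_lborel_cball_finite) simp
  have pos: "0 < 1 + \<rho>\<^sup>2" by (simp add: add_pos_nonneg)
  have "u \<xi> \<le> ?h \<xi>" for \<xi>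
  proof -
    have tail_nonneg: "0 \<le> (u \<xi> + (norm \<xi>)\<^sup>2 * u \<xi>) / (1 + \<rho>\<^sup>2)" using nonneg by simp
    consider (ball) "norm \<xi> \<le> r" | (annulus) "r < norm \<xi>" "norm \<xi> \<le> \<rho>" | (tail) "\<rho> < norm \<xi>"
      by linarith
    then show ?thesis
    proof cases
      case ball
      then show ?thesis using u_ball[OF ball] tail_nonneg r by simp
    next
      case annulus
      then show ?thesis using u_annulus[OF annulus] tail_nonneg by simp
    next
      case tail
      then have "\<rho>\<^sup>2 \<le> (norm \<xi>)\<^sup>2" using r by (intro power_mono) auto
      then have "(1 + \<rho>\<^sup>2) * u \<xi> \<le> (1 + (norm \<xi>)\<^sup>2) * u \<xi>" using nonneg
        by (intro mult_right_mono) auto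
      then show ?thesis using tail r pos by (simp add: pos_le_divide_eq algebra_simps)
    qed
  qed
  then have "(LINT \<xi>|lborel. u \<xi>) \<le> (LINT \<xi>|lborel. ?h \<xi>)"
    using u weighted integrable_cball by (intro Bochner_Integration.integral_mono) auto
  also have "\<dots> = a * measure lborel (cball (0::'a) r)
    + b * (measure lborel (cball (0::'a) \<rho>) - measure lborel (cball (0::'a) r))
    + ((LINT \<xi>|lborel. u \<xi>) + (LINT \<xi>|lborel. (norm \<xi>)\<^sup>2 * u \<xi>)) / (1 + \<rho>\<^sup>2)"
    using u weighted integrable_cball by simp
  finally show ?thesis .
qed

lemma
  fixes s :: "real^3 \<Rightarrow> real"
  assumes \<Omega>: "open \<Omega>" "bounded \<Omega>" and s: "L2 \<Omega> s"
  shows integrable_L2: "integrable (lebesgue_on \<Omega>) s"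
    and integrable_zero_extension: "integrable lebesgue (\<lambda>x. indicator \<Omega> x * s x)"
    and integrable_zero_extension_square: "integrable lebesgue (\<lambda>x. (indicator \<Omega> x * s x)\<^sup>2)"
    and integral_zero_extension_square: "(LINT x|lebesgue. (indicator \<Omega> x * s x)\<^sup>2) = (L2norm \<Omega> s)\<^sup>2"
proof -
  interpret finite_measure "lebesgue_on \<Omega>"
    using \<Omega> by (intro finite_measure_lebesgue_on lmeasurable_open)
  have meas: "s \<in> borel_measurable (lebesgue_on \<Omega>)"
    and square: "integrable (lebesgue_on \<Omega>) (\<lambda>x. (s x)\<^sup>2)"
    using s by (simp_all add: L2_def)
  have indicator: "(indicator \<Omega> x * s x)\<^sup>2 = indicator \<Omega> x * (s x)\<^sup>2" for x
    by (simp add: indicator_def)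
  have sets: "\<Omega> \<in> sets lebesgue" using \<Omega>(1) by simp
  show int: "integrable (lebesgue_on \<Omega>) s"
    by (rule square_integrable_imp_integrable[OF meas square])
  show "integrable lebesgue (\<lambda>x. indicator \<Omega> x * s x)"
    using int sets by (simp add: integrable_restrict_space)
  show "integrable lebesgue (\<lambda>x. (indicator \<Omega> x * s x)\<^sup>2)"
    unfolding indicator using square sets by (simp add: integrable_restrict_space)
  show "(LINT x|lebesgue. (indicator \<Omega> x * s x)\<^sup>2) = (L2norm \<Omega> s)\<^sup>2"
    unfolding indicator using sets by (simp add: L2norm_def integral_restrict_space)
qed

lemma power2_norm_eq_sum_component: "(norm x)\<^sup>2 = (\<Sum>j\<in>UNIV. (x $ j)\<^sup>2)" for x :: "real^'n"
  by (simp add: norm_vec_def L2_set_def sum_nonneg)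

lemma
  fixes g :: "real^3 \<Rightarrow> real^3"
  assumes g: "L2 \<Omega> g"
  shows L2_component: "L2 \<Omega> (\<lambda>x. g x $ j)"
    and sum_L2norm_component: "(\<Sum>j\<in>UNIV. (L2norm \<Omega> (\<lambda>x. g x $ j))\<^sup>2) = (L2norm \<Omega> g)\<^sup>2"
proof -
  have meas: "g \<in> borel_measurable (lebesgue_on \<Omega>)"
    and square: "integrable (lebesgue_on \<Omega>) (\<lambda>x. (norm (g x))\<^sup>2)"
    using g by (simp_all add: L2_def)
  have [measurable]: "(\<lambda>x. g x $ j) \<in> borel_measurable (lebesgue_on \<Omega>)" for j
    by (rule measurable_compose[OF meas borel_measurable_continuous_onI]) (intro continuous_intros)
  have int: "integrable (lebesgue_on \<Omega>) (\<lambda>x. (g x $ j)\<^sup>2)" for j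
  proof (rule Bochner_Integration.integrable_bound[OF square])
    show "AE x in lebesgue_on \<Omega>. norm ((g x $ j)\<^sup>2) \<le> norm ((norm (g x))\<^sup>2)"
      using power_mono[OF component_le_norm_cart abs_ge_zero, of _ j 2] by (intro AE_I2) simp
  qed simp
  then show "L2 \<Omega> (\<lambda>x. g x $ j)" by (simp add: L2_def)
  show "(\<Sum>j\<in>UNIV. (L2norm \<Omega> (\<lambda>x. g x $ j))\<^sup>2) = (L2norm \<Omega> g)\<^sup>2"
    using int by (simp add: L2norm_def power2_norm_eq_sum_component sum_nonneg)
qed

lemma zero_trace_complex:
  fixes \<phi> :: "real^3 \<Rightarrow> complex"
  assumes \<Omega>: "bounded \<Omega>" and trace: "zero_trace \<Omega> \<sigma> g" and \<phi>: "smooth_on UNIV \<phi>"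
    and \<sigma>: "integrable (lebesgue_on \<Omega>) \<sigma>" and g: "integrable (lebesgue_on \<Omega>) (\<lambda>x. g x $ j)"
  shows "(LINT x|lebesgue_on \<Omega>. complex_of_real (\<sigma> x) * partial_deriv j \<phi> x)
    = - (LINT x|lebesgue_on \<Omega>. complex_of_real (g x $ j) * \<phi> x)"
proof -
  let ?a = "\<lambda>x. complex_of_real (\<sigma> x) * partial_deriv j \<phi> x"
    and ?b = "\<lambda>x. complex_of_real (g x $ j) * \<phi> x"
  have int: "integrable (lebesgue_on \<Omega>) ?a" "integrable (lebesgue_on \<Omega>) ?b"
    using \<phi> \<sigma> g
    by (auto intro!: integrable_mult_continuous_lebesgue_on \<Omega> smooth_on_imp_continuous_on
      smooth_on_imp_continuous_on_partial_deriv)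
  have functional: "(LINT x|lebesgue_on \<Omega>. L (?a x + ?b x)) = 0"
    if L: "bounded_linear L" and real: "\<And>r z. L (complex_of_real r * z) = r * L z"
        for L :: "complex \<Rightarrow> real"
    using trace[unfolded zero_trace_def, rule_format, OF smooth_on_bounded_linear[OF L \<phi>], of j]
    by (simp add: partial_deriv_bounded_linear[OF L smooth_on_imp_differentiable[OF \<phi>]]
      real linear_add[OF bounded_linear.linear[OF L]])
  note int_sum = Bochner_Integration.integrable_add[OF int]
  have "Re (LINT x|lebesgue_on \<Omega>. ?a x + ?b x) = 0" "Im (LINT x|lebesgue_on \<Omega>. ?a x + ?b x) = 0"
    unfolding integral_Re[OF int_sum, symmetric] integral_Im[OF int_sum, symmetric]
    by (rule functional; simp add: bounded_linear_Re bounded_linear_Im)+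
  then have "(LINT x|lebesgue_on \<Omega>. ?a x + ?b x) = 0"
    by (simp only: complex_eq_iff zero_complex.sel)
  then show ?thesis using int by (simp add: eq_neg_iff_add_eq_0)
qed

lemma norm_fourier_zero_trace_grad:
  assumes \<Omega>: "open \<Omega>" "bounded \<Omega>" and grad: "weak_grad \<Omega> \<sigma> g" and trace: "zero_trace \<Omega> \<sigma> g"
  shows "norm (fourier (\<lambda>x. indicator \<Omega> x * g x $ j) \<xi>)
      = \<bar>\<xi> $ j\<bar> * norm (fourier (\<lambda>x. indicator \<Omega> x * \<sigma> x) \<xi>)"
proof -
  have L2: "L2 \<Omega> \<sigma>" "L2 \<Omega> (\<lambda>x. g x $ j)" using grad L2_component by (auto simp: weak_grad_def)
  have sets: "\<Omega> \<in> sets lebesgue" using \<Omega>(1) by simp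
  have "fourier (\<lambda>x. indicator \<Omega> x * g x $ j) \<xi>
      = (LINT x|lebesgue_on \<Omega>. complex_of_real (g x $ j) * cwave (cplx \<xi> 0) x)"
    by (simp add: fourier_indicator[OF sets] cwave_cplx_0)
  also have "\<dots>
      = - (LINT x|lebesgue_on \<Omega>. complex_of_real (\<sigma> x) * partial_deriv j (cwave (cplx \<xi> 0)) x)"
    using zero_trace_complex[OF \<Omega>(2) trace smooth_on_cwave integrable_L2[OF \<Omega> L2(1)]
      integrable_L2[OF \<Omega> L2(2)]]
    by simp
  also have "\<dots> = - \<i> * \<xi> $ j * fourier (\<lambda>x. indicator \<Omega> x * \<sigma> x) \<xi>"
    by (simp add: fourier_indicator[OF sets] partial_deriv_cwave cwave_cplx_0 Complex_eq
      mult.left_commute[of "complex_of_real (\<sigma> _)"])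
  finally show ?thesis by (simp add: norm_mult)
qed

lemma
  assumes \<Omega>: "open \<Omega>" "bounded \<Omega>" and grad: "weak_grad \<Omega> \<sigma> g" and trace: "zero_trace \<Omega> \<sigma> g"
  defines "F \<equiv> fourier (\<lambda>x. indicator \<Omega> x * \<sigma> x)"
  shows plancherel_gradient_integrable: "integrable lborel (\<lambda>\<xi>. (norm \<xi>)\<^sup>2 * (cmod (F \<xi>))\<^sup>2)"
    and plancherel_gradient: "(LINT \<xi>|lborel. (norm \<xi>)\<^sup>2 * (cmod (F \<xi>))\<^sup>2)
        = (2 * pi) ^ 3 * (L2norm \<Omega> g)\<^sup>2"
proof -
  have L2_g: "L2 \<Omega> g" using grad by (simp add: weak_grad_def)
  let ?h = "\<lambda>j x. indicator \<Omega> x * g x $ j"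
  have components: "(norm \<xi>)\<^sup>2 * (cmod (F \<xi>))\<^sup>2 = (\<Sum>j\<in>UNIV. (cmod (fourier (?h j) \<xi>))\<^sup>2)" for \<xi>
    by (simp add: norm_fourier_zero_trace_grad[OF \<Omega> grad trace] F_def power2_norm_eq_sum_component
      power_mult_distrib sum_distrib_right)
  note plancherel_h = integrable_zero_extension[OF \<Omega> L2_component[OF L2_g]]
    integrable_zero_extension_square[OF \<Omega> L2_component[OF L2_g]]
  show "integrable lborel (\<lambda>\<xi>. (norm \<xi>)\<^sup>2 * (cmod (F \<xi>))\<^sup>2)"
    unfolding components
    by (intro Bochner_Integration.integrable_sum plancherel_integrable plancherel_h)
  have "(LINT \<xi>|lborel. (norm \<xi>)\<^sup>2 * (cmod (F \<xi>))\<^sup>2)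
      = (\<Sum>j\<in>UNIV. LINT \<xi>|lborel. (cmod (fourier (?h j) \<xi>))\<^sup>2)"
    unfolding components
    by (intro Bochner_Integration.integral_sum plancherel_integrable plancherel_h)
  also have "\<dots> = (\<Sum>j\<in>UNIV. (2 * pi) ^ 3 * (L2norm \<Omega> (\<lambda>x. g x $ j))\<^sup>2)"
    by (simp add: plancherel[OF plancherel_h]
      integral_zero_extension_square[OF \<Omega> L2_component[OF L2_g]])
  finally show "(LINT \<xi>|lborel. (norm \<xi>)\<^sup>2 * (cmod (F \<xi>))\<^sup>2) = (2 * pi) ^ 3 * (L2norm \<Omega> g)\<^sup>2"
    by (simp add: sum_L2norm_component[OF L2_g] flip: sum_distrib_left)
qed

lemma L2norm_le_of_fourier_bounds:
  assumes \<Omega>: "open \<Omega>" "bounded \<Omega>"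
    and grad: "weak_grad \<Omega> \<sigma> g" and H1: "H1norm \<Omega> \<sigma> g \<le> M" and trace: "zero_trace \<Omega> \<sigma> g"
  defines "F \<equiv> fourier (\<lambda>x. indicator \<Omega> x * \<sigma> x)"
  assumes ball: "\<And>\<xi>. norm \<xi> \<le> r \<Longrightarrow> norm (F \<xi>) \<le> A"
    and annulus: "\<And>\<xi>. r < norm \<xi> \<Longrightarrow> norm \<xi> \<le> \<rho> \<Longrightarrow> norm (F \<xi>) \<le> B"
    and r: "0 \<le> r" "r \<le> \<rho>"
  shows "(L2norm \<Omega> \<sigma>)\<^sup>2 \<le> (A\<^sup>2 * r ^ 3 + B\<^sup>2 * (\<rho> ^ 3 - r ^ 3)) / (6 * pi\<^sup>2) + M\<^sup>2 / (1 + \<rho>\<^sup>2)"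
proof -
  have L2_\<sigma>: "L2 \<Omega> \<sigma>" using grad by (simp add: weak_grad_def)
  note ext = integrable_zero_extension[OF \<Omega> L2_\<sigma>] integrable_zero_extension_square[OF \<Omega> L2_\<sigma>]
  let ?u = "\<lambda>\<xi>. (cmod (F \<xi>))\<^sup>2"
  have volume: "measure lborel (cball (0::real^3) q) = 4 / 3 * pi * q ^ 3" if "0 \<le> q" for q
    using that by (simp add: content_cball unit_ball_vol_3)
  have energy: "(LINT \<xi>|lborel. ?u \<xi>) = (2 * pi) ^ 3 * (L2norm \<Omega> \<sigma>)\<^sup>2"
    unfolding F_def plancherel[OF ext] by (simp add: integral_zero_extension_square[OF \<Omega> L2_\<sigma>])
  have "(LINT \<xi>|lborel. ?u \<xi>) \<le> A\<^sup>2 * measure lborel (cball (0::real^3) r)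
      + B\<^sup>2 * (measure lborel (cball (0::real^3) \<rho>) - measure lborel (cball (0::real^3) r))
      + ((LINT \<xi>|lborel. ?u \<xi>) + (LINT \<xi>|lborel. (norm \<xi>)\<^sup>2 * ?u \<xi>)) / (1 + \<rho>\<^sup>2)"
  proof (rule integral_le_ball_annulus_tail)
    show "integrable lborel ?u" unfolding F_def by (rule plancherel_integrable[OF ext])
    show "integrable lborel (\<lambda>\<xi>. (norm \<xi>)\<^sup>2 * ?u \<xi>)"
      unfolding F_def by (rule plancherel_gradient_integrable[OF \<Omega> grad trace])
  qed (use r ball annulus in \<open>auto intro: power_mono\<close>)
  also have "(LINT \<xi>|lborel. ?u \<xi>) + (LINT \<xi>|lborel. (norm \<xi>)\<^sup>2 * ?u \<xi>)
      = (2 * pi) ^ 3 * (H1norm \<Omega> \<sigma> g)\<^sup>2"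
    unfolding energy unfolding F_def plancherel_gradient[OF \<Omega> grad trace]
    by (simp add: H1norm_def distrib_left)
  also have "(2 * pi) ^ 3 * (H1norm \<Omega> \<sigma> g)\<^sup>2 / (1 + \<rho>\<^sup>2) \<le> (2 * pi) ^ 3 * M\<^sup>2 / (1 + \<rho>\<^sup>2)"
    using H1 by (intro divide_right_mono mult_left_mono power_mono) (auto simp: H1norm_def)
  finally have "(2 * pi) ^ 3 * (L2norm \<Omega> \<sigma>)\<^sup>2 \<le> A\<^sup>2 * (4 / 3 * pi * r ^ 3)
      + B\<^sup>2 * (4 / 3 * pi * \<rho> ^ 3 - 4 / 3 * pi * r ^ 3) + (2 * pi) ^ 3 * M\<^sup>2 / (1 + \<rho>\<^sup>2)"
    using r unfolding energy by (simp add: volume)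
  also have "\<dots> = (2 * pi) ^ 3 * ((A\<^sup>2 * r ^ 3 + B\<^sup>2 * (\<rho> ^ 3 - r ^ 3)) / (6 * pi\<^sup>2) + M\<^sup>2 / (1 + \<rho>\<^sup>2))"
    by (simp add: distrib_left power3_eq_cube power2_eq_square field_simps)
  finally show ?thesis by simp
qed

section \<open>The stability estimate\<close>

lemma sinh_over_self_mono:
  fixes x y :: real
  assumes "0 < x" "x \<le> y"
  shows "sinh x / x \<le> sinh y / y"
proof (cases "x = y")
  case False
  then have xy: "x < y" using assms by simp
  have deriv: "(sinh has_real_derivative cosh u) (at u)" for u :: real
    by (auto intro!: derivative_eq_intros)
  obtain c where c: "0 < c" "c < x" "sinh x - sinh 0 = (x - 0) * cosh c"
    using MVT2[OF assms(1), of sinh cosh] deriv by blast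
  obtain d where d: "x < d" "d < y" "sinh y - sinh x = (y - x) * cosh d"
    using MVT2[OF xy, of sinh cosh] deriv by blast
  have "cosh c \<le> cosh d" using c d by (intro cosh_real_nonneg_le_iff[THEN iffD2]) auto
  then have "(y - x) * cosh c \<le> sinh y - sinh x" using xy d by simp
  moreover have "sinh x = x * cosh c" using c by simp
  ultimately have "y * cosh c \<le> sinh y" by (simp add: algebra_simps)
  then show ?thesis using \<open>sinh x = x * cosh c\<close> assms by (simp add: field_simps)
qed simp

lemma cube_diff_le:
  fixes r \<rho> :: real
  assumes "0 \<le> r" "r \<le> \<rho>"
  shows "\<rho> ^ 3 - r ^ 3 \<le> 3 / 2 * \<rho> * (\<rho>\<^sup>2 - r\<^sup>2)"
proof -
  have "0 \<le> (\<rho> - r)\<^sup>2 * (\<rho> + 2 * r) / 2" using assms by simp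
  also have "\<dots> = 3 / 2 * \<rho> * (\<rho>\<^sup>2 - r\<^sup>2) - (\<rho> ^ 3 - r ^ 3)"
    by (simp add: power2_eq_square power3_eq_cube field_simps)
  finally show ?thesis by simp
qed

lemma annulus_cube_diff_le:
  fixes E D k :: real
  assumes "0 < D" "0 \<le> k" "k \<le> E"
  defines "\<rho> \<equiv> sqrt (E\<^sup>2 / D\<^sup>2 + 4 * k\<^sup>2)"
  shows "\<rho> ^ 3 - (2 * k) ^ 3 \<le> 3 / 2 * (E / D) ^ 3 * sqrt (1 + (2 * D)\<^sup>2)"
proof -
  have "2 * k \<le> \<rho>" unfolding \<rho>_def by (rule real_le_rsqrt) (simp add: power_mult_distrib)
  then have "\<rho> ^ 3 - (2 * k) ^ 3 \<le> 3 / 2 * \<rho> * (\<rho>\<^sup>2 - (2 * k)\<^sup>2)"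
    using assms(2) by (intro cube_diff_le) auto
  also have "\<rho>\<^sup>2 - (2 * k)\<^sup>2 = (E / D)\<^sup>2" by (simp add: \<rho>_def power_mult_distrib power_divide)
  also have "3 / 2 * \<rho> * (E / D)\<^sup>2 \<le> 3 / 2 * (E / D * sqrt (1 + (2 * D)\<^sup>2)) * (E / D)\<^sup>2"
  proof (intro mult_right_mono mult_left_mono)
    have "\<rho> \<le> sqrt ((E / D)\<^sup>2 * (1 + (2 * D)\<^sup>2))"
      unfolding \<rho>_def using assms(1-3)
      by (intro real_sqrt_le_mono) (simp add: field_simps power_mult_distrib power_mono)
    also have "\<dots> = E / D * sqrt (1 + (2 * D)\<^sup>2)" using assms(1-3) by (simp add: real_sqrt_mult)
    finally show "\<rho> \<le> E / D * sqrt (1 + (2 * D)\<^sup>2)" .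
  qed simp_all
  also have "\<dots> = 3 / 2 * (E / D) ^ 3 * sqrt (1 + (2 * D)\<^sup>2)"
    by (simp add: power2_eq_square power3_eq_cube mult_ac)
  finally show ?thesis .
qed

lemma wave_number_factor_le:
  fixes k q :: real
  assumes "0 \<le> k" "k \<le> q"
  shows "(k * (1 + k))\<^sup>2 \<le> (1 + q) ^ 4"
proof -
  have "(k * (1 + k))\<^sup>2 \<le> ((1 + q) * (1 + q))\<^sup>2" using assms by (intro power_mono mult_mono) auto
  then show ?thesis by (simp add: power2_eq_square power4_eq_xxxx mult_ac)
qed

lemma diameter_pos_open:
  fixes S :: "'a::euclidean_space set"
  assumes "open S" "bounded S" "S \<noteq> {}"
  shows "0 < diameter S"
proof -
  obtain x r where r: "0 < r" "ball x r \<subseteq> S"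
    using assms(1,3) open_contains_ball by (metis all_not_in_conv)
  have "2 * r \<le> diameter S" using diameter_subset[OF r(2) assms(2)] r(1) by simp
  then show ?thesis using r(1) by linarith
qed

context linearised_boundary_map
begin

lemma norm_\<sigma>_hat_le_annulus:
  assumes \<epsilon>: "\<epsilon> = exp (- E)" and E: "0 < E" and D: "0 < diameter \<Omega>"
    and \<xi>: "2 * k < norm \<xi>" "norm \<xi> \<le> sqrt (E\<^sup>2 / (diameter \<Omega>)\<^sup>2 + 4 * k\<^sup>2)"
  shows "norm (\<sigma>_hat \<xi>) \<le> exp (- E / 2) * (k * (1 + k)) * (Vol2 \<Omega> * (diameter \<Omega> / E))"
proof -
  let ?D = "diameter \<Omega>"
  define t where "t = sqrt ((norm \<xi>)\<^sup>2 / 4 - k\<^sup>2)"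
  have "(2 * k)\<^sup>2 < (norm \<xi>)\<^sup>2" using \<xi> k_ge_1 by (intro power_strict_mono) auto
  then have t: "0 < t" by (simp add: t_def power_mult_distrib)
  have "(norm \<xi>)\<^sup>2 \<le> E\<^sup>2 / ?D\<^sup>2 + 4 * k\<^sup>2" using power_mono[OF \<xi>(2) norm_ge_zero, of 2] by simp
  then have "t \<le> sqrt ((E / (2 * ?D))\<^sup>2)"
    unfolding t_def by (intro real_sqrt_le_mono) (simp add: power_divide power_mult_distrib)
  then have "t \<le> E / (2 * ?D)" using E D by (simp only: real_sqrt_abs) simp
  then have "t * ?D \<le> E / 2" using D by (simp add: field_simps)
  then have "sinh (t * ?D) / (t * ?D) \<le> sinh (E / 2) / (E / 2)"
    using t D by (intro sinh_over_self_mono) auto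
  also have "\<dots> \<le> exp (E / 2) / E" using E by (simp add: sinh_def field_simps)
  finally have sinh: "sinh (t * ?D) / t \<le> exp (E / 2) * (?D / E)" using D t E
    by (simp add: field_simps)
  have "norm (\<sigma>_hat \<xi>) \<le> \<epsilon> * (k * (1 + k)) * (Vol2 \<Omega> * (sinh (t * ?D) / t))"
    by (rule norm_\<sigma>_hat_le_high[OF \<xi>(1) t_def])
  also have "\<dots> \<le> \<epsilon> * (k * (1 + k)) * (Vol2 \<Omega> * (exp (E / 2) * (?D / E)))"
    using \<epsilon>_nonneg k_ge_1 Vol2_nonneg[OF \<Omega>] by (intro mult_left_mono sinh) auto
  also have "\<dots> = (\<epsilon> * exp (E / 2)) * (k * (1 + k)) * (Vol2 \<Omega> * (?D / E))" by (simp only: mult_ac)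
  also have "\<epsilon> * exp (E / 2) = exp (- E / 2)" by (simp add: \<epsilon> mult_exp_exp)
  finally show ?thesis .
qed

lemma L2norm_le_small_data_exponent:
  assumes grad: "weak_grad \<Omega> \<sigma> g" "H1norm \<Omega> \<sigma> g \<le> M" "zero_trace \<Omega> \<sigma> g"
    and \<alpha>: "0 < \<alpha>" "\<alpha> \<le> 1" and E: "0 \<le> E" "E \<le> k"
  shows "(L2norm \<Omega> \<sigma>)\<^sup>2 \<le> 4 / (3 * pi\<^sup>2) * (Vol \<Omega>)\<^sup>2 * ((1 + k) ^ 4 * k powr (3 * \<alpha>)) * \<epsilon>\<^sup>2
    + M\<^sup>2 * (1 / (1 + 2 * E powr (2 * \<alpha>) + 2 * k powr (2 * \<alpha>)))"
proof -
  define A where "A = \<epsilon> * (k * (1 + k)) * Vol \<Omega>"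
  define \<rho> where "\<rho> = 2 * k powr \<alpha>"
  have "k powr \<alpha> \<le> k powr 1" using k_ge_1 \<alpha> by (intro powr_mono) auto
  then have \<rho>: "0 \<le> \<rho>" "\<rho> \<le> 2 * k" using k_ge_1 by (auto simp: \<rho>_def)
  have \<rho>_square: "\<rho>\<^sup>2 = 4 * k powr (2 * \<alpha>)" and \<rho>_cube: "\<rho> ^ 3 = 8 * k powr (3 * \<alpha>)"
    using k_ge_1 powr_powr[of k \<alpha> 2] powr_powr[of k \<alpha> 3]
    by (simp_all add: \<rho>_def power_mult_distrib mult.commute)
  have "(L2norm \<Omega> \<sigma>)\<^sup>2 \<le> (A\<^sup>2 * \<rho> ^ 3 + A\<^sup>2 * (\<rho> ^ 3 - \<rho> ^ 3)) / (6 * pi\<^sup>2) + M\<^sup>2 / (1 + \<rho>\<^sup>2)"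
    unfolding A_def
    by (rule L2norm_le_of_fourier_bounds[OF \<Omega> grad]) (use norm_\<sigma>_hat_le_low \<rho> in auto)
  also have "\<dots> = A\<^sup>2 * \<rho> ^ 3 / (6 * pi\<^sup>2) + M\<^sup>2 * (1 / (1 + \<rho>\<^sup>2))" by simp
  also have "A\<^sup>2 * \<rho> ^ 3 / (6 * pi\<^sup>2)
      = 4 / (3 * pi\<^sup>2) * (Vol \<Omega>)\<^sup>2 * ((k * (1 + k))\<^sup>2 * k powr (3 * \<alpha>)) * \<epsilon>\<^sup>2"
    unfolding A_def \<rho>_cube power_mult_distrib by (simp add: field_simps)
  also have "\<dots> \<le> 4 / (3 * pi\<^sup>2) * (Vol \<Omega>)\<^sup>2 * ((1 + k) ^ 4 * k powr (3 * \<alpha>)) * \<epsilon>\<^sup>2"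
    using k_ge_1 by (intro mult_right_mono mult_left_mono wave_number_factor_le) auto
  also have "M\<^sup>2 * (1 / (1 + \<rho>\<^sup>2)) \<le> M\<^sup>2 * (1 / (1 + 2 * E powr (2 * \<alpha>) + 2 * k powr (2 * \<alpha>)))"
  proof -
    have "E powr (2 * \<alpha>) \<le> k powr (2 * \<alpha>)" using E \<alpha> by (intro powr_mono2) auto
    then show ?thesis
      unfolding \<rho>_square by (intro mult_left_mono divide_left_mono mult_pos_pos add_pos_nonneg) auto
  qed
  finally show ?thesis by simp
qed

lemma L2norm_le_large_data_exponent:
  assumes grad: "weak_grad \<Omega> \<sigma> g" "H1norm \<Omega> \<sigma> g \<le> M" "zero_trace \<Omega> \<sigma> g"
    and nonempty: "\<Omega> \<noteq> {}" and \<epsilon>: "\<epsilon> = exp (- E)" and E: "k \<le> E"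
  defines "D \<equiv> diameter \<Omega>"
  shows "(L2norm \<Omega> \<sigma>)\<^sup>2 \<le> 4 / (3 * pi\<^sup>2) * (Vol \<Omega>)\<^sup>2 * ((1 + E) ^ 4 * E ^ 3) * \<epsilon>\<^sup>2
    + 1 / (4 * pi\<^sup>2) * (Vol2 \<Omega>)\<^sup>2 * (1 / D) * sqrt (1 + (2 * D)\<^sup>2) * (1 + E) ^ 4 * E * \<epsilon>
    + M\<^sup>2 * (1 / (1 + E\<^sup>2 / D\<^sup>2 + 4 * k\<^sup>2))"
proof -
  have D: "0 < D" unfolding D_def by (rule diameter_pos_open[OF \<Omega> nonempty])
  have E0: "0 < E" using E k_ge_1 by linarith
  define \<rho> where "\<rho> = sqrt (E\<^sup>2 / D\<^sup>2 + 4 * k\<^sup>2)"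
  have \<rho>_square: "\<rho>\<^sup>2 = E\<^sup>2 / D\<^sup>2 + 4 * k\<^sup>2" by (simp add: \<rho>_def)
  have \<rho>: "2 * k \<le> \<rho>" unfolding \<rho>_def by (rule real_le_rsqrt) (simp add: power_mult_distrib)
  define A where "A = \<epsilon> * (k * (1 + k)) * Vol \<Omega>"
  define B where "B = exp (- E / 2) * (k * (1 + k)) * (Vol2 \<Omega> * (D / E))"
  have "A\<^sup>2 * (2 * k) ^ 3 / (6 * pi\<^sup>2) = 4 / (3 * pi\<^sup>2) * (Vol \<Omega>)\<^sup>2 * ((k * (1 + k))\<^sup>2 * k ^ 3) * \<epsilon>\<^sup>2"
    unfolding A_def power_mult_distrib by (simp add: field_simps)
  also have "\<dots> \<le> 4 / (3 * pi\<^sup>2) * (Vol \<Omega>)\<^sup>2 * ((1 + E) ^ 4 * E ^ 3) * \<epsilon>\<^sup>2"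
    using k_ge_1 E
    by (intro mult_right_mono mult_left_mono mult_mono wave_number_factor_le power_mono) auto
  finally have ball_term: "A\<^sup>2 * (2 * k) ^ 3 / (6 * pi\<^sup>2) \<le> \<dots>" .
  have "(exp (- E / 2))\<^sup>2 = \<epsilon>" by (simp add: \<epsilon> exp_double[symmetric])
  then have "B\<^sup>2 = \<epsilon> * (k * (1 + k))\<^sup>2 * ((Vol2 \<Omega>)\<^sup>2 * (D / E)\<^sup>2)"
    unfolding B_def power_mult_distrib by simp
  also have "\<dots> \<le> \<epsilon> * (1 + E) ^ 4 * ((Vol2 \<Omega>)\<^sup>2 * (D / E)\<^sup>2)"
    using \<epsilon>_nonneg k_ge_1 E by (intro mult_right_mono mult_left_mono wave_number_factor_le) auto
  finally have "B\<^sup>2 * (\<rho> ^ 3 - (2 * k) ^ 3)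
      \<le> (\<epsilon> * (1 + E) ^ 4 * ((Vol2 \<Omega>)\<^sup>2 * (D / E)\<^sup>2)) * (3 / 2 * (E / D) ^ 3 * sqrt (1 + (2 * D)\<^sup>2))"
    using annulus_cube_diff_le[OF D _ E] power_mono[OF \<rho>, of 3] k_ge_1 \<epsilon>_nonneg E0
    by (intro mult_mono) (auto simp: \<rho>_def)
  also have "\<dots> = 3 / 2 * (\<epsilon> * (1 + E) ^ 4 * (Vol2 \<Omega>)\<^sup>2 * (E / D * sqrt (1 + (2 * D)\<^sup>2)))"
    using D E0 by (simp add: power2_eq_square power3_eq_cube)
  finally have "B\<^sup>2 * (\<rho> ^ 3 - (2 * k) ^ 3) / (6 * pi\<^sup>2)
      \<le> 3 / 2 * (\<epsilon> * (1 + E) ^ 4 * (Vol2 \<Omega>)\<^sup>2 * (E / D * sqrt (1 + (2 * D)\<^sup>2))) / (6 * pi\<^sup>2)"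
    by (rule divide_right_mono) simp
  then have annulus_term: "B\<^sup>2 * (\<rho> ^ 3 - (2 * k) ^ 3) / (6 * pi\<^sup>2)
      \<le> 1 / (4 * pi\<^sup>2) * (Vol2 \<Omega>)\<^sup>2 * (1 / D) * sqrt (1 + (2 * D)\<^sup>2) * (1 + E) ^ 4 * E * \<epsilon>"
    by (simp add: mult_ac)
  have "(L2norm \<Omega> \<sigma>)\<^sup>2 \<le> (A\<^sup>2 * (2 * k) ^ 3 + B\<^sup>2 * (\<rho> ^ 3 - (2 * k) ^ 3)) / (6 * pi\<^sup>2) + M\<^sup>2 / (1 + \<rho>\<^sup>2)"
  proof (rule L2norm_le_of_fourier_bounds[OF \<Omega> grad])
    show "norm (\<sigma>_hat \<xi>) \<le> A" if "norm \<xi> \<le> 2 * k" for \<xi>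
      unfolding A_def by (rule norm_\<sigma>_hat_le_low[OF that])
    show "norm (\<sigma>_hat \<xi>) \<le> B" if "2 * k < norm \<xi>" "norm \<xi> \<le> \<rho>" for \<xi>
      using norm_\<sigma>_hat_le_annulus[OF \<epsilon> E0] D that by (simp add: B_def D_def \<rho>_def)
  qed (use k_ge_1 \<rho> in auto)
  then show ?thesis
    using ball_term annulus_term unfolding \<rho>_square add_divide_distrib by (simp add: add.assoc)
qed

end

theorem theorem2p1:
  fixes \<Omega> :: "(real^3) set" and \<epsilon>\<^sub>0 \<mu>\<^sub>0 \<omega> k M\<^sub>1 \<alpha> \<epsilon> :: real
    and \<sigma> :: "real^3 \<Rightarrow> real"
  assumes dom: "open \<Omega>" "connected \<Omega>" "bounded \<Omega>" "\<Omega> \<noteq> {}" "C2_boundary \<Omega>"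
    and pos: "\<epsilon>\<^sub>0 > 0" "\<mu>\<^sub>0 > 0" "\<omega> > 0"
    and solv: "uniquely_solvable \<omega> \<epsilon>\<^sub>0 \<mu>\<^sub>0 \<Omega> \<sigma>"
    and kdef: "k = \<omega> * sqrt (\<epsilon>\<^sub>0 * \<mu>\<^sub>0)"
    and sig_inf: "Linfty \<Omega> \<sigma>"
    and sig_H1: "\<exists>g. weak_grad \<Omega> \<sigma> g \<and> H1norm \<Omega> \<sigma> g \<le> M\<^sub>1 \<and> zero_trace \<Omega> \<sigma> g"
    and k1: "k \<ge> 1"
    and alpha: "0 < \<alpha>" "\<alpha> \<le> 1"
    and epsnorm: "is_Lambda'_norm \<omega> \<epsilon>\<^sub>0 \<mu>\<^sub>0 \<Omega> \<sigma> \<epsilon>"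
    and eps: "0 < \<epsilon>" "\<epsilon> < 1"
  shows "let \<E> = - ln \<epsilon>; chi = (if k \<le> \<E> then 1 else 0 :: real);
             D = diameter \<Omega> in
         (L2norm \<Omega> \<sigma>)\<^sup>2 \<le>
           4 / (3 * pi\<^sup>2) * (Vol \<Omega>)\<^sup>2 *
             ((1 - chi) * (1 + k) ^ 4 * k powr (3 * \<alpha>) + chi * (1 + \<E>) ^ 4 * \<E> ^ 3) * \<epsilon>\<^sup>2
         + chi * (1 / (4 * pi\<^sup>2)) * (Vol2 \<Omega>)\<^sup>2 * (1 / D) * sqrt (1 + (2 * D)\<^sup>2)
             * (1 + \<E>) ^ 4 * \<E> * \<epsilon>
         + M\<^sub>1\<^sup>2 * ((1 - chi) * (1 / (1 + 2 * \<E> powr (2 * \<alpha>) + 2 * k powr (2 * \<alpha>)))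
                  + chi * (1 / (1 + \<E>\<^sup>2 / D\<^sup>2 + 4 * k\<^sup>2)))"
proof -
  obtain g where grad: "weak_grad \<Omega> \<sigma> g" "H1norm \<Omega> \<sigma> g \<le> M\<^sub>1" "zero_trace \<Omega> \<sigma> g"
    using sig_H1 by blast
  interpret linearised_boundary_map \<Omega> \<epsilon>\<^sub>0 \<mu>\<^sub>0 \<omega> k \<epsilon> \<sigma>
    using dom pos solv kdef k1 epsnorm eps
    by unfold_locales (simp_all add: is_Lambda'_norm_def power_mult_distrib)
  define E where "E = - ln \<epsilon>"
  have E: "0 < E" "\<epsilon> = exp (- E)" using eps by (simp_all add: E_def)
  show ?thesis
  proof (cases "k \<le> E")
    case True
    then show ?thesis
      using L2norm_le_large_data_exponent[OF grad dom(4) E(2) True]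
      by (simp add: Let_def E_def[symmetric] mult.assoc)
  next
    case False
    then show ?thesis
      using L2norm_le_small_data_exponent[OF grad alpha, of E] E(1)
      by (simp add: Let_def E_def[symmetric] mult.assoc)
  qed
qed

end
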